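(* Let $1<p<\infty$. The complete ideal $\mathcal{L}_{mCoh,p}$ of multiple Cohen strongly $p$-summing multilinear operators has property (B) with constant $C=1$. Therefore, the ideal $\mathcal{P}_{mCoh,p}$ of multiple Cohen strongly $p$-summing polynomials is a global holomorphy type with constant $\sigma=2$.
   Context: Banach spaces are over $\mathbb{K}=\mathbb{R}$ or $\mathbb{C}$; $F'$ is the topological dual; $1/p+1/p^{*}=1$. $\mathcal{L}(E_1,\dots,E_n;F)$ and $\mathcal{P}(^nE;F)$ are the spaces of continuous $n$-linear operators and continuous $n$-homogeneous polynomials; $\check P$ is the symmetric $n$-linear operator associated with $P$. For a countable family $(\varphi_i)_{i\in I}$ in $F'$, $\|(\varphi_i)_{i\in I}\|_{w,p^{*}}=\sup_{y\in B_F}\big(\sum_{i\in I}|\varphi_i(y)|^{p^{*}}\big)^{1/p^{*}}$, and $\ell_{p^{*}}^w(F')$ is the set of families for which this is finite. $\|(x_j)_j\|_p=(\sum_j\|x_j\|^p)^{1/p}$, and $\ell_p(E)$ is the space of sequences for which this is finite. A family $(y_i)_{i\in I}$ in $F$ belongs to $\ell_p\langle F\rangle$ if $\sum_{i\in I}|\varphi_i(y_i)|<\infty$ for all $(\varphi_i)_{i\in I}\in\ell_{p^{*}}^w(F')$. $T\in\mathcal{L}(E_1,\dots,E_n;F)$ is multiple Cohen strongly $p$-summing, written $T\in\mathcal{L}_{mCoh,p}(E_1,\dots,E_n;F)$, if $\big(T(x_{j_1}^{(1)},\dots,x_{j_n}^{(n)})\big)_{(j_1,\dots,j_n)\in\mathbb{N}^n}\in\ell_p\langle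 F\rangle$ (families indexed by $\mathbb{N}^n$) whenever $(x_j^{(i)})_{j=1}^\infty\in\ell_p(E_i)$, $i=1,\dots,n$. The norm $\|T\|_{mCoh,p}$ is the smallest $C$ with $$\sum_{j_1,\dots,j_n=1}^m\big|\varphi_{j_1,\dots,j_n}\big(T(x_{j_1}^{(1)},\dots,x_{j_n}^{(n)})\big)\big|\le C\prod_{i=1}^n\big\|(x_j^{(i)})_{j=1}^m\big\|_p\,\big\|(\varphi_{j_1,\dots,j_n})_{j_1,\dots,j_n=1}^m\big\|_{w,p^{*}}$$ for all $m\in\mathbb{N}$, $x_j^{(i)}\in E_i$, $\varphi_{j_1,\dots,j_n}\in F'$. A polynomial $P\in\mathcal{P}(^nE;F)$ belongs to $\mathcal{P}_{mCoh,p}$ if $\check P\in\mathcal{L}_{mCoh,p}(^nE;F)$, with norm $\|P\|=\|\check P\|_{mCoh,p}$. Property (B). Let $\mathcal{J}$ be a class of continuous multilinear mappings between Banach spaces whose components $\mathcal{J}(E_1,\dots,E_n;F):=\mathcal{L}(E_1,\dots,E_n;F)\cap\mathcal{J}$ are linear subspaces of $\mathcal{L}(E_1,\dots,E_n;F)$ equipped with a norm $\|\cdot\|_{\mathcal{J}}$. $\mathcal{J}$ has property (B) with constant $C\ge1$ if for every $n\in\mathbb{N}$, all Banach spaces $E,F$ and every $A\in\mathcal{J}(E,\overset{(n)}{\dots},E,\mathbb{K};F)$ symmetric in the first $n$ variables, the map $A1:E^n\to F$, $A1(x_1,\dots,x_n):=A(x_1,\dots,x_n,1)$, satisfies $A1\in\mathcal{J}(^nE;F)$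 and $\|A1\|_{\mathcal{J}}\le C\|A\|_{\mathcal{J}}$. Global holomorphy type with constant $\sigma\ge1$: a class $\mathcal{P}_H$ of continuous homogeneous polynomials between Banach spaces such that, for all $n$ and all Banach spaces $E,F$, the components $\mathcal{P}_H(^nE;F):=\mathcal{P}(^nE;F)\cap\mathcal{P}_H$ satisfy: (i) $\mathcal{P}_H(^nE;F)$ is a linear subspace of $\mathcal{P}(^nE;F)$ which is a Banach space for a norm $\|\cdot\|_H$; (ii) $\mathcal{P}_H(^0E;F)=F$ as a normed linear space (degree-$0$ polynomials being the constants); (iii) for all $n\in\mathbb{N}$, $k\le n$, $a\in E$ and $P\in\mathcal{P}_H(^nE;F)$, $\hat d^kP(a)\in\mathcal{P}_H(^kE;F)$ and $\big\|\frac1{k!}\hat d^kP(a)\big\|_H\le\sigma^n\|P\|_H\|a\|^{n-k}$, where $\hat d^kP(a)$ is the $k$-th differential of $P$ at $a$, i.e. $\frac1{k!}\hat d^kP(a)(x)=\binom nk\check P(a,\overset{(n-k)}{\dots},a,x,\overset{(k)}{\dots},x)$. *)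

theory Defs
  imports "HOL-Analysis.Analysis" "HOL-Library.Function_Algebras" "HOL-Combinatorics.Permutations"
begin

section \<open>Banach spaces over a scalar field\<close>

text \<open>
  A space is a set of vectors in an ambient abelian group, together with a scalar multiplication
  by the field \<open>'k\<close> and a norm. Only the values of \<open>scl\<close> and \<open>nrm\<close> on \<open>vecs\<close> matter. Carriers,
  rather than types, allow one to quantify over all Banach spaces inside a definition and to form
  lists \<open>[E\<^sub>1, \<dots>, E\<^sub>n]\<close> of different spaces. Nothing is lost by taking the additions of
  \<open>E\<^sub>1, \<dots>, E\<^sub>n\<close> from one group, since they can be placed in their direct sum; the scalar
  multiplications and the norms may differ from space to space.
\<close>

record ('k, 'u) nspace =
  vecs :: "'u set"
  scl :: "'k \<Rightarrow> 'u \<Rightarrow> 'u"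
  nrm :: "'u \<Rightarrow> real"

definition normed_space :: "('k::real_normed_field, 'u::ab_group_add) nspace \<Rightarrow> bool" where
  "normed_space E \<longleftrightarrow>
     0 \<in> vecs E \<and>
     (\<forall>x\<in>vecs E. \<forall>y\<in>vecs E. x + y \<in> vecs E) \<and>
     (\<forall>c. \<forall>x\<in>vecs E. scl E c x \<in> vecs E) \<and>
     (\<forall>c. \<forall>x\<in>vecs E. \<forall>y\<in>vecs E. scl E c (x + y) = scl E c x + scl E c y) \<and>
     (\<forall>c d. \<forall>x\<in>vecs E. scl E (c + d) x = scl E c x + scl E d x) \<and>
     (\<forall>c d. \<forall>x\<in>vecs E. scl E c (scl E d x) = scl E (c * d) x) \<and>
     (\<forall>x\<in>vecs E. scl E 1 x = x) \<and>
     (\<forall>x\<in>vecs E. 0 \<le> nrm E x) \<and>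
     (\<forall>x\<in>vecs E. nrm E x = 0 \<longleftrightarrow> x = 0) \<and>
     (\<forall>c. \<forall>x\<in>vecs E. nrm E (scl E c x) = norm c * nrm E x) \<and>
     (\<forall>x\<in>vecs E. \<forall>y\<in>vecs E. nrm E (x + y) \<le> nrm E x + nrm E y)"

text \<open>
  The value 0 off the carrier is needed because the locale \<open>Metric_space\<close> requires
  nonnegativity and symmetry of the distance on the whole type.
\<close>

definition ndist :: "('k, 'u::ab_group_add) nspace \<Rightarrow> 'u \<Rightarrow> 'u \<Rightarrow> real" where
  "ndist E x y = (if x \<in> vecs E \<and> y \<in> vecs E then nrm E (x - y) else 0)"

definition norm_topology :: "('k, 'u::ab_group_add) nspace \<Rightarrow> 'u topology" where
  "norm_topology E = Metric_space.mtopology (vecs E) (ndist E)"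

definition banach_space :: "('k::real_normed_field, 'u::ab_group_add) nspace \<Rightarrow> bool" where
  "banach_space E \<longleftrightarrow> normed_space E \<and> Metric_space.mcomplete (vecs E) (ndist E)"

lemma normed_space_uminus:
  assumes "normed_space E" "x \<in> vecs E"
  shows "scl E (-1) x = - x"
proof -
  have add: "\<And>c d. scl E (c + d) x = scl E c x + scl E d x" and one: "scl E 1 x = x"
    using assms by (simp_all add: normed_space_def)
  have "scl E 0 x = 0"
    using add[of 0 0] by simp
  moreover have "scl E 0 x = scl E 1 x + scl E (-1) x"
    using add[of 1 "-1"] by simp
  ultimately show ?thesis
    using one by (simp add: eq_neg_iff_add_eq_0 add.commute)
qed

lemma Metric_space_ndist:
  assumes E: "normed_space E"
  shows "Metric_space (vecs E) (ndist E)"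
proof -
  have add: "\<And>x y. x \<in> vecs E \<Longrightarrow> y \<in> vecs E \<Longrightarrow> x + y \<in> vecs E"
    and scl: "\<And>c x. x \<in> vecs E \<Longrightarrow> scl E c x \<in> vecs E"
    and nonneg: "\<And>x. x \<in> vecs E \<Longrightarrow> 0 \<le> nrm E x"
    and zero: "\<And>x. x \<in> vecs E \<Longrightarrow> nrm E x = 0 \<longleftrightarrow> x = 0"
    and hom: "\<And>c x. x \<in> vecs E \<Longrightarrow> nrm E (scl E c x) = norm c * nrm E x"
    and tri: "\<And>x y. x \<in> vecs E \<Longrightarrow> y \<in> vecs E \<Longrightarrow> nrm E (x + y) \<le> nrm E x + nrm E y"
    using E by (simp_all add: normed_space_def)
  have minus: "- x \<in> vecs E" if "x \<in> vecs E" for x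
    using scl[OF that, of "-1"] normed_space_uminus[OF E that] by simp
  have diff: "x - y \<in> vecs E" if "x \<in> vecs E" "y \<in> vecs E" for x y
    using add[OF that(1) minus[OF that(2)]] by simp
  have nminus: "nrm E (- x) = nrm E x" if "x \<in> vecs E" for x
    using hom[OF that, of "-1"] normed_space_uminus[OF E that] by simp
  show ?thesis
  proof
    show "0 \<le> ndist E x y" for x y
      by (simp add: ndist_def nonneg diff)
    show "ndist E x y = ndist E y x" for x y
      using nminus[OF diff, of x y] by (simp add: ndist_def)
    show "(ndist E x y = 0) = (x = y)" if "x \<in> vecs E" "y \<in> vecs E" for x y
      using that zero[OF diff[OF that]] by (simp add: ndist_def)
    show "ndist E x z \<le> ndist E x y + ndist E y z"
      if "x \<in> vecs E" "y \<in> vecs E" "z \<in> vecs E" for x y z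
      using that tri[OF diff diff, of x y y z] by (simp add: ndist_def)
  qed
qed

definition unit_ball :: "('k, 'u) nspace \<Rightarrow> 'u set" where
  "unit_ball E = {x \<in> vecs E. nrm E x \<le> 1}"

definition dual :: "('k::real_normed_field, 'u::ab_group_add) nspace \<Rightarrow> ('u \<Rightarrow> 'k) set" where
  "dual F = {\<phi>.
     (\<forall>x\<in>vecs F. \<forall>y\<in>vecs F. \<phi> (x + y) = \<phi> x + \<phi> y) \<and>
     (\<forall>c. \<forall>x\<in>vecs F. \<phi> (scl F c x) = c * \<phi> x) \<and>
     continuous_map (norm_topology F) euclidean \<phi>}"

text \<open>
  A copy of the scalar field as a one-dimensional space in the ambient group \<open>'a \<times> 'k\<close>,
  with \<open>(0, 1)\<close> as the scalar 1. The ambient group \<open>'a \<times> 'k\<close> leaves room for any space \<open>E\<close> on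
  \<open>'a\<close> (as \<open>E \<times> {0}\<close>) next to the scalar field.
\<close>

definition scalar_space :: "('k::real_normed_field, 'a::ab_group_add \<times> 'k) nspace" where
  "scalar_space =
     \<lparr>vecs = {0} \<times> UNIV, scl = (\<lambda>c x. (0, c * snd x)), nrm = (\<lambda>x. norm (snd x))\<rparr>"


section \<open>Multilinear operators and homogeneous polynomials\<close>

text \<open>
  Indices are counted from 0. The product \<open>E\<^sub>1 \<times> \<dots> \<times> E\<^sub>n\<close> is a \<open>Pi\<^sub>E\<close>-set over \<open>{..<n}\<close>, with the
  one-point set for \<open>n = 0\<close>. Operators and polynomials are extended by 0 outside their domains,
  which makes them unique as functions and makes the pointwise operations of
  \<open>Function_Algebras\<close> the vector space operations.
\<close>

definition tuples :: "('k, 'u) nspace list \<Rightarrow> (nat \<Rightarrow> 'u) set" where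
  "tuples Es = (\<Pi>\<^sub>E i\<in>{..<length Es}. vecs (Es ! i))"

definition multilinear ::
  "('k::real_normed_field, 'u::ab_group_add) nspace list \<Rightarrow> ('k, 'v::ab_group_add) nspace
    \<Rightarrow> ((nat \<Rightarrow> 'u) \<Rightarrow> 'v) \<Rightarrow> bool" where
  "multilinear Es F T \<longleftrightarrow>
     (\<forall>x\<in>tuples Es. T x \<in> vecs F) \<and>
     (\<forall>x. x \<notin> tuples Es \<longrightarrow> T x = 0) \<and>
     (\<forall>x\<in>tuples Es. \<forall>i<length Es. \<forall>u\<in>vecs (Es ! i). \<forall>v\<in>vecs (Es ! i).
        T (x(i := u + v)) = T (x(i := u)) + T (x(i := v))) \<and>
     (\<forall>x\<in>tuples Es. \<forall>i<length Es. \<forall>c. \<forall>u\<in>vecs (Es ! i).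
        T (x(i := scl (Es ! i) c u)) = scl F c (T (x(i := u))))"

definition cont_multilinear ::
  "('k::real_normed_field, 'u::ab_group_add) nspace list \<Rightarrow> ('k, 'v::ab_group_add) nspace
    \<Rightarrow> ((nat \<Rightarrow> 'u) \<Rightarrow> 'v) set" where
  "cont_multilinear Es F = {T. multilinear Es F T \<and>
     continuous_map (product_topology (\<lambda>i. norm_topology (Es ! i)) {..<length Es})
       (norm_topology F) T}"

text \<open>Symmetry in the first \<open>n\<close> variables; \<open>n\<close> may be smaller than the number of variables.\<close>

definition symmetric_in ::
  "nat \<Rightarrow> ('k, 'u) nspace list \<Rightarrow> ((nat \<Rightarrow> 'u) \<Rightarrow> 'v) \<Rightarrow> bool" where
  "symmetric_in n Es T \<longleftrightarrow> (\<forall>x\<in>tuples Es. \<forall>\<pi>. \<pi> permutes {..<n} \<longrightarrow> T (x \<circ> \<pi>) = T x)"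

definition diag ::
  "nat \<Rightarrow> ('k, 'u) nspace \<Rightarrow> ((nat \<Rightarrow> 'u) \<Rightarrow> 'v::zero) \<Rightarrow> 'u \<Rightarrow> 'v" where
  "diag n E A = (\<lambda>x. if x \<in> vecs E then A (\<lambda>i\<in>{..<n}. x) else 0)"

definition cont_polynomials ::
  "nat \<Rightarrow> ('k::real_normed_field, 'u::ab_group_add) nspace \<Rightarrow> ('k, 'v::ab_group_add) nspace
    \<Rightarrow> ('u \<Rightarrow> 'v) set" where
  "cont_polynomials n E F = diag n E ` cont_multilinear (replicate n E) F"

definition polar ::
  "nat \<Rightarrow> ('k::real_normed_field, 'u::ab_group_add) nspace \<Rightarrow> ('k, 'v::ab_group_add) nspace
    \<Rightarrow> ('u \<Rightarrow> 'v) \<Rightarrow> (nat \<Rightarrow> 'u) \<Rightarrow> 'v" where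
  "polar n E F P = (THE A. multilinear (replicate n E) F A \<and>
     symmetric_in n (replicate n E) A \<and> diag n E A = P)"

text \<open>\<open>differential k n E F a P\<close> is the \<open>k\<close>-th differential at \<open>a\<close> of the \<open>n\<close>-homogeneous \<open>P\<close>.\<close>

definition differential ::
  "nat \<Rightarrow> nat \<Rightarrow> ('k::real_normed_field, 'u::ab_group_add) nspace \<Rightarrow> ('k, 'v::ab_group_add) nspace
    \<Rightarrow> 'u \<Rightarrow> ('u \<Rightarrow> 'v) \<Rightarrow> 'u \<Rightarrow> 'v" where
  "differential k n E F a P = (\<lambda>x. if x \<in> vecs E
     then scl F (fact k * of_nat (n choose k))
            (polar n E F P (\<lambda>i\<in>{..<n}. if i < n - k then a else x))
     else 0)"

text \<open>A set of \<open>F\<close>-valued functions with the pointwise operations and a given norm.\<close>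

definition fun_space ::
  "('k, 'v) nspace \<Rightarrow> ('x \<Rightarrow> 'v) set \<Rightarrow> (('x \<Rightarrow> 'v) \<Rightarrow> real) \<Rightarrow> ('k, 'x \<Rightarrow> 'v) nspace" where
  "fun_space F S N = \<lparr>vecs = S, scl = (\<lambda>c f x. scl F c (f x)), nrm = N\<rparr>"


section \<open>Property (B) and global holomorphy types\<close>

text \<open>
  A class of multilinear operators is given by its components \<open>J [E\<^sub>1, \<dots>, E\<^sub>n] F\<close> and a class of
  polynomials by its components \<open>PH n E F\<close>.
\<close>

type_synonym ('k, 'u, 'v) mult_class =
  "('k, 'u) nspace list \<Rightarrow> ('k, 'v) nspace \<Rightarrow> ((nat \<Rightarrow> 'u) \<Rightarrow> 'v) set"
type_synonym ('k, 'u, 'v) mult_norm =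
  "('k, 'u) nspace list \<Rightarrow> ('k, 'v) nspace \<Rightarrow> ((nat \<Rightarrow> 'u) \<Rightarrow> 'v) \<Rightarrow> real"
type_synonym ('k, 'u, 'v) poly_class =
  "nat \<Rightarrow> ('k, 'u) nspace \<Rightarrow> ('k, 'v) nspace \<Rightarrow> ('u \<Rightarrow> 'v) set"
type_synonym ('k, 'u, 'v) poly_norm =
  "nat \<Rightarrow> ('k, 'u) nspace \<Rightarrow> ('k, 'v) nspace \<Rightarrow> ('u \<Rightarrow> 'v) \<Rightarrow> real"

definition fix_last_1 ::
  "nat \<Rightarrow> ('k::real_normed_field, 'a::ab_group_add \<times> 'k) nspace
    \<Rightarrow> ((nat \<Rightarrow> 'a \<times> 'k) \<Rightarrow> 'v::zero) \<Rightarrow> (nat \<Rightarrow> 'a \<times> 'k) \<Rightarrow> 'v" where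
  "fix_last_1 n E A = (\<lambda>x. if x \<in> tuples (replicate n E) then A (x(n := (0, 1))) else 0)"

definition property_B ::
  "('k::real_normed_field, 'a::ab_group_add \<times> 'k, 'v::ab_group_add) mult_class
    \<Rightarrow> ('k, 'a \<times> 'k, 'v) mult_norm \<Rightarrow> real \<Rightarrow> bool" where
  "property_B J N C \<longleftrightarrow> 1 \<le> C \<and>
     (\<forall>Es F. Es \<noteq> [] \<and> (\<forall>E\<in>set Es. banach_space E) \<and> banach_space F \<longrightarrow>
        J Es F \<subseteq> cont_multilinear Es F \<and>
        normed_space (fun_space F (J Es F) (N Es F))) \<and>
     (\<forall>n E F A. 1 \<le> n \<and> banach_space E \<and> banach_space F \<and>
        A \<in> J (replicate n E @ [scalar_space]) F \<and>
        symmetric_in n (replicate n E @ [scalar_space]) A \<longrightarrow>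
        fix_last_1 n E A \<in> J (replicate n E) F \<and>
        N (replicate n E) F (fix_last_1 n E A) \<le> C * N (replicate n E @ [scalar_space]) F A)"

definition global_holomorphy_type ::
  "('k::real_normed_field, 'u::ab_group_add, 'v::ab_group_add) poly_class
    \<Rightarrow> ('k, 'u, 'v) poly_norm \<Rightarrow> real \<Rightarrow> bool" where
  "global_holomorphy_type PH N \<sigma> \<longleftrightarrow> 1 \<le> \<sigma> \<and>
     (\<forall>E F. banach_space E \<and> banach_space F \<longrightarrow>
        (\<forall>n. PH n E F \<subseteq> cont_polynomials n E F \<and>
             banach_space (fun_space F (PH n E F) (N n E F))) \<and>
        PH 0 E F = (\<lambda>y x. if x \<in> vecs E then y else 0) ` vecs F \<and>
        (\<forall>y\<in>vecs F. N 0 E F (\<lambda>x. if x \<in> vecs E then y else 0) = nrm F y) \<and>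
        (\<forall>n. \<forall>k\<le>n. \<forall>a\<in>vecs E. \<forall>P\<in>PH n E F.
           differential k n E F a P \<in> PH k E F \<and>
           N k E F (\<lambda>x. scl F (1 / fact k) (differential k n E F a P x))
             \<le> \<sigma> ^ n * N n E F P * nrm E a ^ (n - k)))"


section \<open>Multiple Cohen strongly \<open>p\<close>-summing operators and polynomials\<close>

definition conj_exp :: "real \<Rightarrow> real" where
  "conj_exp p = p / (p - 1)"

lemma conj_exp: "1 < p \<Longrightarrow> 1 / p + 1 / conj_exp p = 1"
  by (simp add: conj_exp_def field_simps)

definition ell :: "real \<Rightarrow> ('k, 'u) nspace \<Rightarrow> (nat \<Rightarrow> 'u) set" where
  "ell p E = {x. (\<forall>j. x j \<in> vecs E) \<and> summable (\<lambda>j. nrm E (x j) powr p)}"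

text \<open>The norm in \<open>\<ell>\<^sub>p\<close> of the first \<open>m\<close> terms.\<close>

definition ell_norm :: "real \<Rightarrow> ('k, 'u) nspace \<Rightarrow> nat \<Rightarrow> (nat \<Rightarrow> 'u) \<Rightarrow> real" where
  "ell_norm p E m x = (\<Sum>j<m. nrm E (x j) powr p) powr (1 / p)"

definition weak_norm ::
  "real \<Rightarrow> 'i set \<Rightarrow> ('k::real_normed_field, 'v) nspace \<Rightarrow> ('i \<Rightarrow> 'v \<Rightarrow> 'k) \<Rightarrow> real" where
  "weak_norm q I F \<phi> = (SUP y\<in>unit_ball F. (\<Sum>\<^sub>\<infinity>i\<in>I. norm (\<phi> i y) powr q) powr (1 / q))"

definition weak_ell ::
  "real \<Rightarrow> 'i set \<Rightarrow> ('k::real_normed_field, 'v::ab_group_add) nspace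
    \<Rightarrow> ('i \<Rightarrow> 'v \<Rightarrow> 'k) set" where
  "weak_ell q I F = {\<phi>. (\<forall>i\<in>I. \<phi> i \<in> dual F) \<and>
     (\<forall>y\<in>unit_ball F. (\<lambda>i. norm (\<phi> i y) powr q) summable_on I) \<and>
     bdd_above ((\<lambda>y. (\<Sum>\<^sub>\<infinity>i\<in>I. norm (\<phi> i y) powr q) powr (1 / q)) ` unit_ball F)}"

definition cohen_ell ::
  "real \<Rightarrow> 'i set \<Rightarrow> ('k::real_normed_field, 'v::ab_group_add) nspace \<Rightarrow> ('i \<Rightarrow> 'v) set" where
  "cohen_ell p I F = {y. (\<forall>i\<in>I. y i \<in> vecs F) \<and>
     (\<forall>\<phi>\<in>weak_ell (conj_exp p) I F. (\<lambda>i. norm (\<phi> i (y i))) summable_on I)}"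

definition mCoh ::
  "real \<Rightarrow> ('k::real_normed_field, 'u::ab_group_add, 'v::ab_group_add) mult_class" where
  "mCoh p Es F = {T \<in> cont_multilinear Es F.
     \<forall>x. (\<forall>i<length Es. x i \<in> ell p (Es ! i)) \<longrightarrow>
       (\<lambda>j. T (\<lambda>i\<in>{..<length Es}. x i (j i)))
         \<in> cohen_ell p (\<Pi>\<^sub>E i\<in>{..<length Es}. (UNIV :: nat set)) F}"

definition mCoh_norm ::
  "real \<Rightarrow> ('k::real_normed_field, 'u::ab_group_add, 'v::ab_group_add) mult_norm" where
  "mCoh_norm p Es F T = Inf {C. 0 \<le> C \<and>
     (\<forall>m x \<phi>.
        (\<forall>i<length Es. \<forall>j<m. x i j \<in> vecs (Es ! i)) \<and>
        (\<forall>j \<in> {..<length Es} \<rightarrow>\<^sub>E {..<m}. \<phi> j \<in> dual F) \<longrightarrow>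
        (\<Sum>j \<in> {..<length Es} \<rightarrow>\<^sub>E {..<m}. norm (\<phi> j (T (\<lambda>i\<in>{..<length Es}. x i (j i)))))
          \<le> C * (\<Prod>i<length Es. ell_norm p (Es ! i) m (x i))
              * weak_norm (conj_exp p) ({..<length Es} \<rightarrow>\<^sub>E {..<m}) F \<phi>)}"

definition poly_mCoh ::
  "real \<Rightarrow> ('k::real_normed_field, 'u::ab_group_add, 'v::ab_group_add) poly_class" where
  "poly_mCoh p n E F =
     {P \<in> cont_polynomials n E F. polar n E F P \<in> mCoh p (replicate n E) F}"

definition poly_mCoh_norm ::
  "real \<Rightarrow> ('k::real_normed_field, 'u::ab_group_add, 'v::ab_group_add) poly_norm" where
  "poly_mCoh_norm p n E F P = mCoh_norm p (replicate n E) F (polar n E F P)"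

end

theory Submission
  imports Defs
begin

text \<open>
  The defining condition of \<open>mCoh\<close> concerns infinite families and says nothing about uniformity. The
  whole proof rests on replacing it by a finite inequality: a multilinear \<open>T\<close> is multiple Cohen strongly
  \<open>p\<close>-summing iff some \<open>C\<close> satisfies \<open>cohen_bound p Es F T C\<close>, the inequality in the definition of the norm
  (lemmas \<open>mCoh_imp_cohen_bound\<close> and \<open>cohen_bound_imp_mCoh\<close>).

  If no constant worked, there would be finite data of norm at most 1 whose sums exceed
  \<open>2 ^ (N * (n + 1))\<close>, for every \<open>N\<close>. Damped by the factor \<open>1 / 2 ^ N\<close> and placed in disjoint blocks, these data form admissible
  infinite families along which the sum diverges. Conversely, the inequality bounds all
  finite partial sums, and for a single vector in each variable it bounds \<open>\<parallel>T x\<parallel>\<close> by \<open>C \<Prod> \<parallel>x\<^sub>i\<parallel>\<close>, so that \<open>T\<close> is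
  continuous. This last point needs a functional of norm at most 1 that attains the norm of
  \<open>T x\<close>. Such functionals exist by the Hahn-Banach theorem, proved below for spaces given by carriers: a
  minimal sublinear functional is linear. The same estimate shows that \<open>\<parallel>T\<parallel> = 0\<close> forces \<open>T = 0\<close> and that a
  Cauchy sequence converges pointwise; its pointwise limit inherits the inequality, so the components are
  complete.

  Property (B) then is an observation on finite data: given data for \<open>A1\<close>, use in the last variable of \<open>A\<close>
  the sequence \<open>(1, 0, 0, \<dots>)\<close>, of norm 1, and let the functionals vanish unless the last index is the first
  one. Neither side of the inequality changes. The same argument with an arbitrary vector \<open>a\<close> in
  place of 1 costs a factor \<open>\<parallel>a\<parallel>\<close> (lemma \<open>cohen_bound_fix_last\<close>).

  By polarisation, \<open>P\<close> and its symmetric operator determine each other linearly, so that the polynomials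
  form an isometric copy of the symmetric operators in \<open>mCoh\<close>, a subspace that is closed under pointwise limits
  and hence complete. The operator of \<open>d\<^sup>kP(a)/k!\<close> is the binomial coefficient \<open>n\<close> over \<open>k\<close> times the operator
  of \<open>P\<close> with \<open>n - k\<close> variables fixed at \<open>a\<close>. Fixing them one after the other gives the
  factor \<open>\<parallel>a\<parallel>\<^sup>n\<^sup>-\<^sup>k\<close>, and the binomial coefficient is at most \<open>2\<^sup>n\<close>, whence \<open>\<sigma> = 2\<close>.
\<close>

section \<open>Normed spaces given by carriers\<close>

context
  fixes E :: "('k::real_normed_field, 'u::ab_group_add) nspace"
  assumes E: "normed_space E"
begin

lemma vecs_zero: "0 \<in> vecs E"
  and vecs_add: "x \<in> vecs E \<Longrightarrow> y \<in> vecs E \<Longrightarrow> x + y \<in> vecs E"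
  and vecs_scl: "x \<in> vecs E \<Longrightarrow> scl E c x \<in> vecs E"
  and scl_add_right: "x \<in> vecs E \<Longrightarrow> y \<in> vecs E \<Longrightarrow> scl E c (x + y) = scl E c x + scl E c y"
  and scl_add_left: "x \<in> vecs E \<Longrightarrow> scl E (c + d) x = scl E c x + scl E d x"
  and scl_scl: "x \<in> vecs E \<Longrightarrow> scl E c (scl E d x) = scl E (c * d) x"
  and scl_one: "x \<in> vecs E \<Longrightarrow> scl E 1 x = x"
  and nrm_nonneg: "x \<in> vecs E \<Longrightarrow> 0 \<le> nrm E x"
  and nrm_eq_0: "x \<in> vecs E \<Longrightarrow> nrm E x = 0 \<longleftrightarrow> x = 0"
  and nrm_scl: "x \<in> vecs E \<Longrightarrow> nrm E (scl E c x) = norm c * nrm E x"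
  and nrm_add_le: "x \<in> vecs E \<Longrightarrow> y \<in> vecs E \<Longrightarrow> nrm E (x + y) \<le> nrm E x + nrm E y"
  using E by (simp_all add: normed_space_def)

lemma nrm_zero: "nrm E 0 = 0"
  using nrm_eq_0 vecs_zero by blast

lemma vecs_uminus: "x \<in> vecs E \<Longrightarrow> - x \<in> vecs E"
  by (metis E normed_space_uminus vecs_scl)

lemma vecs_diff: "x \<in> vecs E \<Longrightarrow> y \<in> vecs E \<Longrightarrow> x - y \<in> vecs E"
  by (metis add_uminus_conv_diff vecs_add vecs_uminus)

lemma vecs_sum: "(\<And>i. i \<in> I \<Longrightarrow> f i \<in> vecs E) \<Longrightarrow> sum f I \<in> vecs E"
  by (induction I rule: infinite_finite_induct) (auto simp: vecs_zero vecs_add)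

lemma scl_zero_right: "scl E c 0 = 0"
  by (metis E add_cancel_right_right scl_add_right vecs_zero)

lemma scl_zero_left: "x \<in> vecs E \<Longrightarrow> scl E 0 x = 0"
  by (metis add_cancel_right_right scl_add_left)

lemma scl_uminus_right: "x \<in> vecs E \<Longrightarrow> scl E c (- x) = - scl E c x"
  by (metis add.right_inverse add_eq_0_iff scl_add_right scl_zero_right vecs_uminus)

lemma scl_diff_right: "x \<in> vecs E \<Longrightarrow> y \<in> vecs E \<Longrightarrow> scl E c (x - y) = scl E c x - scl E c y"
  by (metis add_uminus_conv_diff scl_add_right scl_uminus_right vecs_uminus)

lemma scl_sum_right:
  "(\<And>i. i \<in> I \<Longrightarrow> f i \<in> vecs E) \<Longrightarrow> scl E c (sum f I) = (\<Sum>i\<in>I. scl E c (f i))"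
  by (induction I rule: infinite_finite_induct) (auto simp: scl_zero_right scl_add_right vecs_sum)

lemma scl_sum_left: "x \<in> vecs E \<Longrightarrow> scl E (sum c I) x = (\<Sum>i\<in>I. scl E (c i) x)"
  by (induction I rule: infinite_finite_induct) (auto simp: scl_zero_left scl_add_left)

lemma nrm_sum_le: "(\<And>i. i \<in> I \<Longrightarrow> f i \<in> vecs E) \<Longrightarrow> nrm E (sum f I) \<le> (\<Sum>i\<in>I. nrm E (f i))"
proof (induction I rule: infinite_finite_induct)
  case (insert i I)
  then show ?case using nrm_add_le[of "f i" "sum f I"] vecs_sum[of I f] by simp
qed (simp_all add: nrm_zero)

lemma nrm_uminus: "x \<in> vecs E \<Longrightarrow> nrm E (- x) = nrm E x"
  by (metis E mult_1 norm_minus_cancel norm_one normed_space_uminus nrm_scl)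

lemma nrm_diff_commute: "x \<in> vecs E \<Longrightarrow> y \<in> vecs E \<Longrightarrow> nrm E (x - y) = nrm E (y - x)"
  by (metis minus_diff_eq nrm_uminus vecs_diff)

lemma nrm_triangle_diff:
  "x \<in> vecs E \<Longrightarrow> y \<in> vecs E \<Longrightarrow> z \<in> vecs E \<Longrightarrow> nrm E (x - z) \<le> nrm E (x - y) + nrm E (y - z)"
  using nrm_add_le[of "x - y" "y - z"] by (simp add: vecs_diff)

lemma topspace_norm_topology: "topspace (norm_topology E) = vecs E"
  unfolding norm_topology_def by (rule Metric_space.topspace_mtopology[OF Metric_space_ndist[OF E]])

lemma limitin_norm_topology:
  "limitin (norm_topology E) s y Q \<longleftrightarrow>
     y \<in> vecs E \<and> eventually (\<lambda>k. s k \<in> vecs E) Q \<and> ((\<lambda>k. ndist E (s k) y) \<longlongrightarrow> 0) Q"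
  unfolding norm_topology_def
  by (rule Metric_space.limitin_metric_dist_null[OF Metric_space_ndist[OF E]])

text \<open>
  A criterion for continuity in terms of a continuous majorant \<open>g\<close> of the distance to \<open>f x\<close>. It reduces the
  continuity of a multilinear map on a product to that of a real function built from norms.
\<close>
lemma continuous_map_to_norm_topology:
  assumes "\<And>x. x \<in> topspace X \<Longrightarrow> f x \<in> vecs E"
    and "\<And>x. x \<in> topspace X \<Longrightarrow>
      \<exists>g. continuous_map X euclideanreal g \<and> g x = 0 \<and> (\<forall>y\<in>topspace X. nrm E (f y - f x) \<le> g y)"
  shows "continuous_map X (norm_topology E) f"
proof -
  interpret Metric_space "vecs E" "ndist E" by (rule Metric_space_ndist[OF E])
  show ?thesis
    unfolding continuous_map_atin
  proof
    fix x assume x: "x \<in> topspace X"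
    obtain g where g: "continuous_map X euclideanreal g" "g x = 0"
      and le: "\<And>y. y \<in> topspace X \<Longrightarrow> nrm E (f y - f x) \<le> g y" using assms(2)[OF x] by blast
    have lim: "(g \<longlongrightarrow> 0) (atin X x)"
      using g x by (auto simp: continuous_map_atin)
    have top: "eventually (\<lambda>y. y \<in> topspace X) (atin X x)"
      using x by (auto simp: eventually_atin)
    have "((\<lambda>y. ndist E (f y) (f x)) \<longlongrightarrow> 0) (atin X x)"
      by (rule tendsto_sandwich[OF _ _ tendsto_const lim];
          rule eventually_mono[OF top]) (simp_all add: ndist_def le assms(1) x nrm_nonneg vecs_diff)
    then show "limitin (norm_topology E) f (f x) (atin X x)"
      unfolding limitin_norm_topology using eventually_mono[OF top assms(1)] assms(1)[OF x] by simp
  qed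
qed

lemma continuous_map_nrm_diff:
  assumes f: "continuous_map X (norm_topology E) f" and a: "a \<in> vecs E"
  shows "continuous_map X euclideanreal (\<lambda>x. nrm E (f x - a))"
proof -
  interpret Metric_space "vecs E" "ndist E" by (rule Metric_space_ndist[OF E])
  have mem: "f x \<in> vecs E" if "x \<in> topspace X" for x
    using continuous_map_image_subset_topspace[OF f] that topspace_norm_topology by auto
  show ?thesis
    unfolding continuous_map_atin
  proof
    fix x assume x: "x \<in> topspace X"
    have lim: "((\<lambda>y. ndist E (f y) (f x)) \<longlongrightarrow> 0) (atin X x)"
      using f x by (simp add: continuous_map_atin limitin_norm_topology)
    have top: "eventually (\<lambda>y. y \<in> topspace X) (atin X x)"
      using x by (auto simp: eventually_atin)
    have "((\<lambda>y. nrm E (f y - a)) \<longlongrightarrow> nrm E (f x - a)) (atin X x)"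
    proof (rule Lim_transform_bound[THEN Lim_null[THEN iffD2], OF _ lim])
      show "\<forall>\<^sub>F y in atin X x. norm (nrm E (f y - a) - nrm E (f x - a)) \<le> norm (ndist E (f y) (f x))"
      proof (rule eventually_mono[OF top])
        fix y assume "y \<in> topspace X"
        then have "f y \<in> vecs E" "f x \<in> vecs E" using mem x by auto
        then show "norm (nrm E (f y - a) - nrm E (f x - a)) \<le> norm (ndist E (f y) (f x))"
          using nrm_triangle_diff[of "f y" "f x" a] nrm_triangle_diff[of "f x" "f y" a] a
          by (simp add: ndist_def nrm_diff_commute)
      qed
    qed
    then show "limitin euclideanreal (\<lambda>y. nrm E (f y - a)) (nrm E (f x - a)) (atin X x)"
      by simp
  qed
qed

end


section \<open>The topological dual\<close>

context
  fixes F :: "('k::real_normed_field, 'v::ab_group_add) nspace"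
  assumes F: "normed_space F"
begin

lemma dual_add: "\<phi> \<in> dual F \<Longrightarrow> x \<in> vecs F \<Longrightarrow> y \<in> vecs F \<Longrightarrow> \<phi> (x + y) = \<phi> x + \<phi> y"
  and dual_scl: "\<phi> \<in> dual F \<Longrightarrow> x \<in> vecs F \<Longrightarrow> \<phi> (scl F c x) = c * \<phi> x"
  by (simp_all add: dual_def)

lemma dual_zero: "\<phi> \<in> dual F \<Longrightarrow> \<phi> 0 = 0"
  using dual_add[of \<phi> 0 0] vecs_zero[OF F] by simp

lemma dual_diff: "\<phi> \<in> dual F \<Longrightarrow> x \<in> vecs F \<Longrightarrow> y \<in> vecs F \<Longrightarrow> \<phi> (x - y) = \<phi> x - \<phi> y"
  using dual_add[of \<phi> "x - y" y] vecs_diff[OF F] by simp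

lemma dualI:
  assumes add: "\<And>x y. x \<in> vecs F \<Longrightarrow> y \<in> vecs F \<Longrightarrow> \<phi> (x + y) = \<phi> x + \<phi> y"
    and scl: "\<And>c x. x \<in> vecs F \<Longrightarrow> \<phi> (scl F c x) = c * \<phi> x"
    and bd: "\<And>x. x \<in> vecs F \<Longrightarrow> norm (\<phi> x) \<le> K * nrm F x"
  shows "\<phi> \<in> dual F"
proof -
  have diff: "\<phi> (x - y) = \<phi> x - \<phi> y" if "x \<in> vecs F" "y \<in> vecs F" for x y
    using add[of "x - y" y] vecs_diff[OF F] that by simp
  have "continuous_map (norm_topology F) euclidean \<phi>"
    unfolding continuous_map_atin limitin_canonical_iff
  proof
    fix x assume x: "x \<in> topspace (norm_topology F)"
    then have xF: "x \<in> vecs F" by (simp add: topspace_norm_topology[OF F])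
    have "continuous_map (norm_topology F) euclideanreal (\<lambda>y. nrm F (y - x))"
      by (rule continuous_map_nrm_diff[OF F _ xF]) simp
    then have "((\<lambda>y. nrm F (y - x)) \<longlongrightarrow> nrm F (x - x)) (atin (norm_topology F) x)"
      using x unfolding continuous_map_atin limitin_canonical_iff by blast
    then have lim: "((\<lambda>y. K * nrm F (y - x)) \<longlongrightarrow> 0) (atin (norm_topology F) x)"
      using tendsto_mult_right_zero nrm_zero[OF F] by fastforce
    have top: "eventually (\<lambda>y. y \<in> vecs F) (atin (norm_topology F) x)"
      using x by (auto simp: eventually_atin topspace_norm_topology[OF F, symmetric])
    show "(\<phi> \<longlongrightarrow> \<phi> x) (atin (norm_topology F) x)"
    proof (rule Lim_transform_bound[THEN Lim_null[THEN iffD2], OF _ lim])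
      show "\<forall>\<^sub>F y in atin (norm_topology F) x. norm (\<phi> y - \<phi> x) \<le> norm (K * nrm F (y - x))"
      proof (rule eventually_mono[OF top])
        fix y assume "y \<in> vecs F"
        then show "norm (\<phi> y - \<phi> x) \<le> norm (K * nrm F (y - x))"
          using bd[of "y - x"] diff xF vecs_diff[OF F] by fastforce
      qed
    qed
  qed
  then show ?thesis using add scl by (simp add: dual_def)
qed

text \<open>
  Continuity at 0 makes \<open>\<phi>\<close> bounded by 1 on some ball, and scaling into this ball bounds it everywhere.
\<close>
lemma dual_bounded:
  assumes phi: "\<phi> \<in> dual F"
  shows "\<exists>K\<ge>0. \<forall>x\<in>vecs F. norm (\<phi> x) \<le> K * nrm F x"
proof -
  interpret Metric_space "vecs F" "ndist F" by (rule Metric_space_ndist[OF F])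
  have "continuous_map (norm_topology F) euclidean \<phi>" using phi by (simp add: dual_def)
  then have "openin (norm_topology F) {x \<in> topspace (norm_topology F). \<phi> x \<in> ball 0 1}"
    by (rule openin_continuous_map_preimage) simp
  moreover have "0 \<in> {x \<in> topspace (norm_topology F). \<phi> x \<in> ball 0 1}"
    using vecs_zero[OF F] by (simp add: topspace_norm_topology[OF F] dual_zero[OF phi])
  ultimately obtain r where r: "r > 0" and sub: "mball 0 r \<subseteq> {x \<in> vecs F. \<phi> x \<in> ball 0 1}"
    unfolding norm_topology_def openin_mtopology by (auto simp: norm_topology_def)
  have small: "norm (\<phi> x) \<le> 1" if "x \<in> vecs F" "nrm F x < r" for x
  proof -
    have "x \<in> mball 0 r"
      using that vecs_zero[OF F] by (simp add: ndist_def nrm_uminus[OF F])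
    then show ?thesis using sub by auto
  qed
  have "norm (\<phi> x) \<le> (2 / r) * nrm F x" if x: "x \<in> vecs F" for x
  proof (cases "x = 0")
    case True then show ?thesis using dual_zero[OF phi] nrm_zero[OF F] by simp
  next
    case False
    then have pos: "nrm F x > 0" using nrm_nonneg[OF F x] nrm_eq_0[OF F x] by linarith
    define c :: real where "c = r / (2 * nrm F x)"
    have c: "c > 0" using pos r by (simp add: c_def)
    have "norm (\<phi> (scl F (of_real c) x)) \<le> 1"
    proof (rule small[OF vecs_scl[OF F x]])
      have "nrm F (scl F (of_real c) x) = c * nrm F x" using c by (simp add: nrm_scl[OF F x])
      then show "nrm F (scl F (of_real c) x) < r" using pos r by (simp add: c_def)
    qed
    then have "c * norm (\<phi> x) \<le> 1" using c by (simp add: dual_scl[OF phi x] norm_mult)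
    then show ?thesis using pos r by (simp add: c_def field_simps)
  qed
  then show ?thesis using r by (intro exI[of _ "2 / r"]) auto
qed

lemma dual_zero_functional: "(\<lambda>_. 0) \<in> dual F"
  by (rule dualI[of _ 0]) auto

lemma dual_mult:
  assumes "\<phi> \<in> dual F"
  shows "(\<lambda>x. c * \<phi> x) \<in> dual F"
proof -
  obtain K where "\<forall>x\<in>vecs F. norm (\<phi> x) \<le> K * nrm F x" using dual_bounded[OF assms] by blast
  then show ?thesis
    by (intro dualI[of _ "norm c * K"])
       (auto simp: dual_add[OF assms] dual_scl[OF assms] distrib_left norm_mult
          mult.left_commute[of c] mult.assoc intro!: mult_left_mono)
qed

lemma dual_tendsto:
  assumes phi: "\<phi> \<in> dual F" and s: "\<And>k. s k \<in> vecs F" "y \<in> vecs F"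
    and lim: "(\<lambda>k. nrm F (s k - y)) \<longlonglongrightarrow> 0"
  shows "(\<lambda>k. \<phi> (s k)) \<longlonglongrightarrow> \<phi> y"
proof -
  obtain K where K: "\<forall>x\<in>vecs F. norm (\<phi> x) \<le> K * nrm F x" using dual_bounded[OF phi] by blast
  have "(\<lambda>k. \<phi> (s k) - \<phi> y) \<longlonglongrightarrow> 0"
    by (rule Lim_null_comparison[where g="\<lambda>k. K * nrm F (s k - y)"])
       (use K s vecs_diff[OF F] in \<open>auto simp: dual_diff[OF phi, symmetric] intro!: tendsto_mult_right_zero lim\<close>)
  then show ?thesis by (simp add: Lim_null[symmetric])
qed

end


section \<open>Norming functionals\<close>

text \<open>
  The conclusion of the Hahn-Banach theorem that is needed below. With it as a hypothesis, everything else can be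
  done for an arbitrary scalar field, and only the proof of the theorem itself treats the real and the complex case
  separately.
\<close>
definition norming :: "('k::real_normed_field, 'v::ab_group_add) nspace \<Rightarrow> bool" where
  "norming F \<longleftrightarrow> (\<forall>y\<in>vecs F. \<exists>\<phi>\<in>dual F. (\<forall>z\<in>vecs F. norm (\<phi> z) \<le> nrm F z) \<and> norm (\<phi> y) = nrm F y)"

text \<open>
  With the value 0 off the carrier, functionals that agree on the carrier are equal, so that minimality in the
  pointwise order can be expressed as an equation of functions.
\<close>
definition sublinear :: "(real, 'v::ab_group_add) nspace \<Rightarrow> ('v \<Rightarrow> real) \<Rightarrow> bool" where
  "sublinear F q \<longleftrightarrow>
     (\<forall>x. x \<notin> vecs F \<longrightarrow> q x = 0) \<and>
     (\<forall>x\<in>vecs F. \<forall>y\<in>vecs F. q (x + y) \<le> q x + q y) \<and>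
     (\<forall>x\<in>vecs F. \<forall>t\<ge>0. q (scl F t x) = t * q x) \<and>
     (\<forall>x\<in>vecs F. q x \<le> nrm F x)"

context
  fixes F :: "(real, 'v::ab_group_add) nspace"
  assumes F: "normed_space F"
begin

lemma sublinear_outside: "sublinear F q \<Longrightarrow> x \<notin> vecs F \<Longrightarrow> q x = 0"
  and sublinear_add: "sublinear F q \<Longrightarrow> x \<in> vecs F \<Longrightarrow> y \<in> vecs F \<Longrightarrow> q (x + y) \<le> q x + q y"
  and sublinear_scl: "sublinear F q \<Longrightarrow> x \<in> vecs F \<Longrightarrow> 0 \<le> t \<Longrightarrow> q (scl F t x) = t * q x"
  and sublinear_le_nrm: "sublinear F q \<Longrightarrow> x \<in> vecs F \<Longrightarrow> q x \<le> nrm F x"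
  by (simp_all add: sublinear_def)

lemma sublinear_zero: "sublinear F q \<Longrightarrow> q 0 = 0"
  using sublinear_scl[of q 0 0] by (simp add: vecs_zero[OF F] scl_zero_right[OF F])

lemma sublinear_ge_uminus: "sublinear F q \<Longrightarrow> x \<in> vecs F \<Longrightarrow> - q (- x) \<le> q x"
  using sublinear_add[of q x "- x"] sublinear_zero[of q] by (simp add: vecs_uminus[OF F])

lemma sublinear_ge_nrm: "sublinear F q \<Longrightarrow> x \<in> vecs F \<Longrightarrow> - nrm F x \<le> q x"
  using sublinear_ge_uminus[of q x] sublinear_le_nrm[of q "- x"]
  by (simp add: vecs_uminus[OF F] nrm_uminus[OF F])

text \<open>
  One inequality suffices for positive homogeneity: apply it to \<open>1/s\<close> and \<open>s x\<close> to obtain the other one.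
\<close>
lemma homogeneous_if_scl_le:
  assumes le: "\<And>s x. 0 < s \<Longrightarrow> x \<in> vecs F \<Longrightarrow> f (scl F s x) \<le> s * f x" and f0: "f 0 = 0"
    and x: "x \<in> vecs F" and t: "0 \<le> t"
  shows "f (scl F t x) = t * f x"
proof (cases "t = 0")
  case True then show ?thesis by (simp add: scl_zero_left[OF F x] f0)
next
  case False
  then have t: "t > 0" using t by simp
  have "f x = f (scl F (1/t) (scl F t x))"
    using t by (simp add: scl_scl[OF F x] scl_one[OF F x])
  also have "\<dots> \<le> (1/t) * f (scl F t x)"
    by (rule le) (use t vecs_scl[OF F x] in auto)
  finally have "t * f x \<le> f (scl F t x)" using t by (simp add: field_simps)
  then show ?thesis using le[OF t x] by simp
qed

text \<open>
  The largest functional \<open>r\<close> below \<open>q\<close> with \<open>r (x + t y) \<ge> r x + t q y\<close> for all \<open>x\<close> and all \<open>t \<ge> 0\<close>. Its value at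
  \<open>- y\<close> is at most \<open>- q y\<close>, so that passing from \<open>q\<close> to it enforces linearity in the direction \<open>y\<close>.
\<close>
definition lower_along :: "('v \<Rightarrow> real) \<Rightarrow> 'v \<Rightarrow> 'v \<Rightarrow> real" where
  "lower_along q y x = (if x \<in> vecs F then INF t\<in>{0..}. q (x + scl F t y) - t * q y else 0)"

context
  fixes q y assumes q: "sublinear F q" and y: "y \<in> vecs F"
begin

lemma lower_along_bdd_below:
  assumes x: "x \<in> vecs F"
  shows "bdd_below ((\<lambda>t. q (x + scl F t y) - t * q y) ` {0..})"
proof (rule bdd_belowI2[of _ "- q (- x)"])
  fix t :: real assume "t \<in> {0..}"
  then have "t * q y = q (scl F t y)" using sublinear_scl[OF q y] by simp
  also have "\<dots> = q ((x + scl F t y) + - x)" by simp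
  also have "\<dots> \<le> q (x + scl F t y) + q (- x)"
    by (rule sublinear_add[OF q]) (auto intro: vecs_add[OF F] x y vecs_scl[OF F] vecs_uminus[OF F])
  finally show "- q (- x) \<le> q (x + scl F t y) - t * q y" by simp
qed

lemma lower_along_le:
  assumes x: "x \<in> vecs F" and t: "0 \<le> t"
  shows "lower_along q y x \<le> q (x + scl F t y) - t * q y"
  unfolding lower_along_def using cINF_lower[OF lower_along_bdd_below[OF x], of t] x t by simp

lemma lower_along_greatest:
  assumes "x \<in> vecs F" "\<And>t. 0 \<le> t \<Longrightarrow> c \<le> q (x + scl F t y) - t * q y"
  shows "c \<le> lower_along q y x"
  unfolding lower_along_def using assms by (auto intro!: cINF_greatest)

lemma lower_along_le_self: "lower_along q y x \<le> q x"
proof (cases "x \<in> vecs F")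
  case True then show ?thesis using lower_along_le[of x 0] by (simp add: scl_zero_left[OF F y])
next
  case False then show ?thesis using sublinear_outside[OF q] by (simp add: lower_along_def)
qed

lemma lower_along_uminus: "lower_along q y (- y) \<le> - q y"
  using lower_along_le[of "- y" 1]
  by (simp add: vecs_uminus[OF F y] scl_one[OF F y] sublinear_zero[OF q])

lemma sublinear_lower_along: "sublinear F (lower_along q y)"
  unfolding sublinear_def
proof (intro conjI ballI allI impI)
  show "lower_along q y x = 0" if "x \<notin> vecs F" for x using that by (simp add: lower_along_def)
  show "lower_along q y x \<le> nrm F x" if "x \<in> vecs F" for x
    using lower_along_le_self[of x] sublinear_le_nrm[OF q that] by simp
  fix x assume x: "x \<in> vecs F"
  {
    fix z assume z: "z \<in> vecs F"
    have "lower_along q y (x + z) - (q (z + scl F t y) - t * q y) \<le> q (x + scl F s y) - s * q y"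
      if "0 \<le> s" "0 \<le> t" for s t
    proof -
      have "(x + z) + scl F (s + t) y = (x + scl F s y) + (z + scl F t y)"
        by (simp add: scl_add_left[OF F y] algebra_simps)
      moreover have "q ((x + scl F s y) + (z + scl F t y)) \<le> q (x + scl F s y) + q (z + scl F t y)"
        by (rule sublinear_add[OF q]) (simp_all add: vecs_add[OF F] vecs_scl[OF F] x y z)
      ultimately have "q ((x + z) + scl F (s + t) y) \<le> q (x + scl F s y) + q (z + scl F t y)"
        by (simp only:)
      then show ?thesis
        using lower_along_le[OF vecs_add[OF F x z], of "s + t"] that by (simp add: algebra_simps)
    qed
    then have "lower_along q y (x + z) - (q (z + scl F t y) - t * q y) \<le> lower_along q y x"
      if "0 \<le> t" for t
      using lower_along_greatest[OF x] that by blast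
    then have "lower_along q y (x + z) - lower_along q y x \<le> lower_along q y z"
      by (intro lower_along_greatest[OF z]) (simp add: algebra_simps)
    then show "lower_along q y (x + z) \<le> lower_along q y x + lower_along q y z" by simp
  }
  fix t :: real assume t: "0 \<le> t"
  show "lower_along q y (scl F t x) = t * lower_along q y x"
  proof (rule homogeneous_if_scl_le[OF _ _ x t])
    have "0 \<le> lower_along q y 0"
      by (rule lower_along_greatest) (auto simp: vecs_zero[OF F] sublinear_scl[OF q y])
    then show "lower_along q y 0 = 0" using lower_along_le_self[of 0] sublinear_zero[OF q] by simp
    fix s :: real and x assume s: "0 < s" and x: "x \<in> vecs F"
    have "lower_along q y (scl F s x) / s \<le> q (x + scl F t y) - t * q y" if t: "0 \<le> t" for t
    proof -
      have "scl F s x + scl F (s * t) y = scl F s (x + scl F t y)"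
        by (simp add: scl_add_right[OF F] scl_scl[OF F] x y vecs_scl[OF F])
      then have "q (scl F s x + scl F (s * t) y) = s * q (x + scl F t y)"
        using sublinear_scl[OF q, of "x + scl F t y" s] s
        by (simp add: x y vecs_add[OF F] vecs_scl[OF F])
      then have "lower_along q y (scl F s x) \<le> s * (q (x + scl F t y) - t * q y)"
        using lower_along_le[OF vecs_scl[OF F x, of s], of "s * t"] s t by (simp add: algebra_simps)
      then show ?thesis using s by (simp add: field_simps)
    qed
    then have "lower_along q y (scl F s x) / s \<le> lower_along q y x"
      using lower_along_greatest[OF x] by blast
    then show "lower_along q y (scl F s x) \<le> s * lower_along q y x"
      using s by (simp add: field_simps)
  qed
qed

end

text \<open>
  The pointwise infimum is finite because every sublinear functional lies above \<open>- nrm F\<close>. For its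
  subadditivity, two members of the chain are replaced by the smaller one.
\<close>
lemma sublinear_chain_Inf:
  assumes C: "C \<noteq> {}" "\<And>q. q \<in> C \<Longrightarrow> sublinear F q"
    and chain: "\<And>q r. q \<in> C \<Longrightarrow> r \<in> C \<Longrightarrow> q \<le> r \<or> r \<le> q"
  shows "\<exists>u. sublinear F u \<and> (\<forall>q\<in>C. u \<le> q)"
proof -
  define u where "u x = (if x \<in> vecs F then INF q\<in>C. q x else 0)" for x
  have bdd: "bdd_below ((\<lambda>q. q x) ` C)" if "x \<in> vecs F" for x
    using sublinear_ge_nrm[OF C(2) that] by (rule bdd_belowI2)
  have le: "u x \<le> q x" if "q \<in> C" "x \<in> vecs F" for q x
    using cINF_lower[OF bdd[OF that(2)] that(1)] that(2) by (simp add: u_def)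
  have greatest: "c \<le> u x" if "x \<in> vecs F" "\<And>q. q \<in> C \<Longrightarrow> c \<le> q x" for c x
    using that C(1) by (auto simp: u_def intro!: cINF_greatest)
  obtain q0 where q0: "q0 \<in> C" using C(1) by blast
  have "sublinear F u"
    unfolding sublinear_def
  proof (intro conjI ballI allI impI)
    show "u x = 0" if "x \<notin> vecs F" for x using that by (simp add: u_def)
    show "u x \<le> nrm F x" if "x \<in> vecs F" for x
      using le[OF q0 that] sublinear_le_nrm[OF C(2)[OF q0] that] by simp
    fix x assume x: "x \<in> vecs F"
    {
      fix y assume y: "y \<in> vecs F"
      have *: "u (x + y) - r y \<le> q x" if qr: "q \<in> C" "r \<in> C" for q r
      proof -
        obtain s where s: "s \<in> C" "s \<le> q" "s \<le> r" using chain[OF qr] qr by blast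
        have "u (x + y) \<le> s x + s y"
          using le[OF s(1) vecs_add[OF F x y]] sublinear_add[OF C(2)[OF s(1)] x y] by simp
        then show ?thesis using le_funD[OF s(2), of x] le_funD[OF s(3), of y] by simp
      qed
      have "u (x + y) - r y \<le> u x" if "r \<in> C" for r using that by (intro greatest[OF x] *)
      then have "u (x + y) - u x \<le> u y" by (intro greatest[OF y]) (simp add: algebra_simps)
      then show "u (x + y) \<le> u x + u y" by simp
    }
    fix t :: real assume t: "0 \<le> t"
    show "u (scl F t x) = t * u x"
    proof (rule homogeneous_if_scl_le[OF _ _ x t])
      show "u 0 = 0"
        using C(1) by (simp add: u_def vecs_zero[OF F] sublinear_zero C(2) cong: image_cong_simp)
      fix s :: real and x assume s: "0 < s" and x: "x \<in> vecs F"
      have "u (scl F s x) / s \<le> q x" if "q \<in> C" for q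
        using le[OF that vecs_scl[OF F x, of s]] sublinear_scl[OF C(2)[OF that] x, of s] s
        by (simp add: field_simps)
      then have "u (scl F s x) / s \<le> u x" by (rule greatest[OF x])
      then show "u (scl F s x) \<le> s * u x" using s by (simp add: field_simps)
    qed
  qed
  moreover have "u \<le> q" if "q \<in> C" for q
    using le[OF that] sublinear_outside[OF C(2)[OF that]] by (auto simp: le_fun_def u_def)
  ultimately show ?thesis by blast
qed

lemma minimal_sublinear_exists:
  assumes q0: "sublinear F q0"
  shows "\<exists>m. sublinear F m \<and> m \<le> q0 \<and> (\<forall>q. sublinear F q \<longrightarrow> q \<le> m \<longrightarrow> q = m)"
proof -
  define A where "A = {q. sublinear F q \<and> q \<le> q0}"
  have "\<exists>m\<in>A. \<forall>a\<in>A. a \<le> m \<longrightarrow> a = m"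
  proof (rule predicate_Zorn[where P="\<lambda>a b. b \<le> a"])
    show "partial_order_on A (relation_of (\<lambda>a b. b \<le> a) A)"
      by (rule partial_order_on_relation_ofI) auto
    fix C assume C: "C \<in> Chains (relation_of (\<lambda>a b. b \<le> a) A)"
    show "\<exists>u\<in>A. \<forall>a\<in>C. u \<le> a"
    proof (cases "C = {}")
      case True then show ?thesis using q0 by (auto simp: A_def)
    next
      case False
      have CA: "C \<subseteq> A" and ch: "\<And>q r. q \<in> C \<Longrightarrow> r \<in> C \<Longrightarrow> q \<le> r \<or> r \<le> q"
        using C by (auto simp: Chains_def relation_of_def)
      then obtain u where u: "sublinear F u" "\<forall>q\<in>C. u \<le> q"
        using sublinear_chain_Inf[OF False] by (auto simp: A_def)
      obtain q where "q \<in> C" using False by blast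
      then have "u \<le> q0" using u(2) CA unfolding A_def by fastforce
      then show ?thesis using u by (auto simp: A_def)
    qed
  qed
  then show ?thesis unfolding A_def by (metis (mono_tags, lifting) mem_Collect_eq order_trans)
qed

text \<open>
  By minimality \<open>m\<close> coincides with \<open>lower_along m y\<close>. Evaluating the infimum at \<open>t = 1\<close> gives \<open>m x \<le> m (x + y) - m y\<close>,
  which is the reverse of subadditivity.
\<close>
lemma minimal_sublinear_additive:
  assumes m: "sublinear F m" and min: "\<And>q. sublinear F q \<Longrightarrow> q \<le> m \<Longrightarrow> q = m"
    and x: "x \<in> vecs F" and y: "y \<in> vecs F"
  shows "m (x + y) = m x + m y"
proof -
  have "lower_along m y = m"
    by (rule min[OF sublinear_lower_along[OF m y]]) (simp add: le_fun_def lower_along_le_self[OF m y])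
  then have "m x \<le> m (x + y) - m y"
    using lower_along_le[OF m y x, of 1] by (simp add: scl_one[OF F y])
  then show ?thesis using sublinear_add[OF m x y] by simp
qed

text \<open>
  Start from the norm, lowered along \<open>y\<close>. A minimal sublinear functional \<open>m\<close> below it is linear with \<open>m \<le> nrm F\<close>,
  and \<open>- m y = m (- y) \<le> - nrm F y\<close> shows that it attains the norm of \<open>y\<close>.
\<close>
lemma norming_real: "norming F"
  unfolding norming_def
proof
  fix y assume y: "y \<in> vecs F"
  define p where "p x = (if x \<in> vecs F then nrm F x else 0)" for x
  have p: "sublinear F p"
    by (auto simp: sublinear_def p_def vecs_add[OF F] vecs_scl[OF F] nrm_scl[OF F] nrm_add_le[OF F])
  obtain m where m: "sublinear F m" "m \<le> lower_along p y"
    and min: "\<And>q. sublinear F q \<Longrightarrow> q \<le> m \<Longrightarrow> q = m"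
    using minimal_sublinear_exists[OF sublinear_lower_along[OF p y]] by blast
  have add: "m (u + v) = m u + m v" if "u \<in> vecs F" "v \<in> vecs F" for u v
    by (rule minimal_sublinear_additive[OF m(1) _ that]) (rule min)
  have minus: "m (- x) = - m x" if "x \<in> vecs F" for x
    using add[OF that vecs_uminus[OF F that]] sublinear_zero[OF m(1)] by simp
  have scl: "m (scl F c x) = c * m x" if x: "x \<in> vecs F" for c x
  proof (cases "0 \<le> c")
    case False
    then have "m (scl F (- c) x) = - c * m x" using sublinear_scl[OF m(1) x, of "- c"] by simp
    moreover have "scl F c x = - scl F (- c) x"
      using scl_scl[OF F x, of "-1" "- c"] normed_space_uminus[OF F vecs_scl[OF F x, of "-c"]] by simp
    ultimately show ?thesis using minus[OF vecs_scl[OF F x, of "-c"]] by simp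
  qed (rule sublinear_scl[OF m(1) x])
  have bd: "norm (m x) \<le> nrm F x" if "x \<in> vecs F" for x
    using sublinear_ge_nrm[OF m(1) that] sublinear_le_nrm[OF m(1) that] by simp
  have "m \<in> dual F"
    by (rule dualI[OF F, of _ 1]) (use add scl bd in auto)
  moreover have "norm (m y) = nrm F y"
  proof -
    have "- m y \<le> - nrm F y"
      using le_funD[OF m(2), of "- y"] lower_along_uminus[OF p y] minus[OF y] y by (simp add: p_def)
    then show ?thesis using bd[OF y] by simp
  qed
  ultimately show "\<exists>\<phi>\<in>dual F. (\<forall>z\<in>vecs F. norm (\<phi> z) \<le> nrm F z) \<and> norm (\<phi> y) = nrm F y"
    using bd by blast
qed

end

text \<open>
  The complex case follows from the real one by the usual complexification \<open>\<phi> z = m z - i m (i z)\<close>; a rotation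
  by the phase of \<open>\<phi> z\<close> shows that passing to \<open>\<phi>\<close> does not increase the norm.
\<close>
lemma norming_complex:
  fixes F :: "(complex, 'v::ab_group_add) nspace"
  assumes F: "normed_space F"
  shows "norming F"
  unfolding norming_def
proof
  fix y assume y: "y \<in> vecs F"
  define R :: "(real, 'v) nspace" where
    "R = \<lparr>vecs = vecs F, scl = (\<lambda>c. scl F (of_real c)), nrm = nrm F\<rparr>"
  have R: "normed_space R"
    using F by (simp add: normed_space_def R_def)
  obtain m where m: "m \<in> dual R" and bd: "\<And>z. z \<in> vecs F \<Longrightarrow> \<bar>m z\<bar> \<le> nrm F z"
    and my: "\<bar>m y\<bar> = nrm F y"
    using norming_real[OF R] y by (auto simp: norming_def R_def)
  have add: "m (u + v) = m u + m v" if "u \<in> vecs F" "v \<in> vecs F" for u v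
    using dual_add[OF R m] that by (simp add: R_def)
  have scl: "m (scl F (of_real c) u) = c * m u" if "u \<in> vecs F" for c u
    using dual_scl[OF R m] that by (simp add: R_def)
  define \<phi> where "\<phi> z = Complex (m z) (- m (scl F \<i> z))" for z
  have phi_add: "\<phi> (u + v) = \<phi> u + \<phi> v" if "u \<in> vecs F" "v \<in> vecs F" for u v
    using that by (simp add: \<phi>_def complex_eq_iff add scl_add_right[OF F] vecs_scl[OF F])
  have phi_scl: "\<phi> (scl F c u) = c * \<phi> u" if u: "u \<in> vecs F" for c u
  proof -
    have m_eq: "m (scl F d u) = Re d * m u + Im d * m (scl F \<i> u)" for d
    proof -
      have "scl F d u = scl F (of_real (Re d) + of_real (Im d) * \<i>) u"
        by (rule arg_cong[where f="\<lambda>c. scl F c u"]) (simp add: complex_eq_iff)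
      also have "\<dots> = scl F (of_real (Re d)) u + scl F (of_real (Im d)) (scl F \<i> u)"
        by (simp only: scl_scl[OF F u] scl_add_left[OF F u])
      finally show ?thesis by (simp add: add scl vecs_scl[OF F] u)
    qed
    show ?thesis
      using m_eq[of c] m_eq[of "\<i> * c"]
      by (simp add: \<phi>_def complex_eq_iff scl_scl[OF F u] algebra_simps)
  qed
  have phi_bd: "norm (\<phi> z) \<le> nrm F z" if z: "z \<in> vecs F" for z
  proof -
    \<comment> \<open>The scalar of modulus at most 1 that rotates \<open>\<phi> z\<close> onto the nonnegative real axis.\<close>
    define c where "c = cnj (sgn (\<phi> z))"
    have "norm c \<le> 1" by (simp add: c_def norm_sgn)
    have "c * \<phi> z = of_real (norm (\<phi> z))"
      using complex_norm_square[of "\<phi> z"]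
      by (cases "\<phi> z = 0") (auto simp: c_def sgn_eq field_simps power2_eq_square)
    then have "norm (\<phi> z) = Re (\<phi> (scl F c z))" by (simp add: phi_scl[OF z])
    also have "\<dots> = m (scl F c z)" by (simp add: \<phi>_def)
    also have "\<dots> \<le> nrm F (scl F c z)" using bd[OF vecs_scl[OF F z], of c] by simp
    also have "\<dots> \<le> nrm F z"
      using \<open>norm c \<le> 1\<close> nrm_nonneg[OF F z] by (simp add: nrm_scl[OF F z] mult_left_le_one_le)
    finally show ?thesis .
  qed
  have "nrm F y \<le> norm (\<phi> y)"
    using abs_Re_le_cmod[of "\<phi> y"] my by (simp add: \<phi>_def)
  moreover have "\<phi> \<in> dual F"
    by (rule dualI[OF F, of _ 1]) (use phi_add phi_scl phi_bd in auto)
  ultimately show "\<exists>\<phi>\<in>dual F. (\<forall>z\<in>vecs F. norm (\<phi> z) \<le> nrm F z) \<and> norm (\<phi> y) = nrm F y"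
    using phi_bd y by (metis order_antisym)
qed


section \<open>Multilinear operators\<close>

lemma normed_space_nth: "\<forall>E\<in>set Es. normed_space E \<Longrightarrow> i < length Es \<Longrightarrow> normed_space (Es ! i)"
  by simp

lemma tuples_nth: "x \<in> tuples Es \<Longrightarrow> i < length Es \<Longrightarrow> x i \<in> vecs (Es ! i)"
  by (auto simp: tuples_def)

lemma tuples_restrictI:
  "(\<And>i. i < length Es \<Longrightarrow> x i \<in> vecs (Es ! i)) \<Longrightarrow> restrict x {..<length Es} \<in> tuples Es"
  by (auto simp: tuples_def)

lemma tuples_restrict: "x \<in> tuples Es \<Longrightarrow> restrict x {..<length Es} = x"
  unfolding tuples_def by (rule PiE_restrict)

lemma tuples_upd:
  "x \<in> tuples Es \<Longrightarrow> i < length Es \<Longrightarrow> u \<in> vecs (Es ! i) \<Longrightarrow> x(i := u) \<in> tuples Es"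
  by (auto simp: tuples_def PiE_def extensional_def)

context
  fixes Es :: "('k::real_normed_field, 'u::ab_group_add) nspace list"
    and F :: "('k, 'v::ab_group_add) nspace"
  assumes Es: "\<forall>E\<in>set Es. normed_space E" and F: "normed_space F"
begin

lemma multilinear_mem: "multilinear Es F T \<Longrightarrow> x \<in> tuples Es \<Longrightarrow> T x \<in> vecs F"
  and multilinear_outside: "multilinear Es F T \<Longrightarrow> x \<notin> tuples Es \<Longrightarrow> T x = 0"
  and multilinear_upd_add: "multilinear Es F T \<Longrightarrow> x \<in> tuples Es \<Longrightarrow> i < length Es \<Longrightarrow>
    u \<in> vecs (Es ! i) \<Longrightarrow> v \<in> vecs (Es ! i) \<Longrightarrow> T (x(i := u + v)) = T (x(i := u)) + T (x(i := v))"
  and multilinear_upd_scl: "multilinear Es F T \<Longrightarrow> x \<in> tuples Es \<Longrightarrow> i < length Es \<Longrightarrow>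
    u \<in> vecs (Es ! i) \<Longrightarrow> T (x(i := scl (Es ! i) c u)) = scl F c (T (x(i := u)))"
  by (simp_all add: multilinear_def)

lemma multilinear_in_vecs: "multilinear Es F T \<Longrightarrow> T x \<in> vecs F"
  using multilinear_mem multilinear_outside vecs_zero[OF F] by metis

lemma multilinearI:
  assumes "\<And>x. x \<in> tuples Es \<Longrightarrow> T x \<in> vecs F"
    and "\<And>x. x \<notin> tuples Es \<Longrightarrow> T x = 0"
    and "\<And>x i u v. x \<in> tuples Es \<Longrightarrow> i < length Es \<Longrightarrow> u \<in> vecs (Es ! i) \<Longrightarrow> v \<in> vecs (Es ! i) \<Longrightarrow>
      T (x(i := u + v)) = T (x(i := u)) + T (x(i := v))"
    and "\<And>x i u c. x \<in> tuples Es \<Longrightarrow> i < length Es \<Longrightarrow> u \<in> vecs (Es ! i) \<Longrightarrow>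
      T (x(i := scl (Es ! i) c u)) = scl F c (T (x(i := u)))"
  shows "multilinear Es F T"
  using assms by (simp add: multilinear_def)

lemma multilinear_upd_zero:
  "multilinear Es F T \<Longrightarrow> x \<in> tuples Es \<Longrightarrow> i < length Es \<Longrightarrow> T (x(i := 0)) = 0"
  using multilinear_upd_add[of T x i 0 0] vecs_zero[OF normed_space_nth[OF Es]] by simp

lemma multilinear_upd_diff:
  "multilinear Es F T \<Longrightarrow> x \<in> tuples Es \<Longrightarrow> i < length Es \<Longrightarrow> u \<in> vecs (Es ! i) \<Longrightarrow> v \<in> vecs (Es ! i) \<Longrightarrow>
    T (x(i := u - v)) = T (x(i := u)) - T (x(i := v))"
  using multilinear_upd_add[of T x i "u - v" v] vecs_diff[OF normed_space_nth[OF Es]] by simp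

lemma multilinear_upd_sum:
  assumes "multilinear Es F T" "x \<in> tuples Es" "i < length Es"
    and "\<And>j. j \<in> S \<Longrightarrow> w j \<in> vecs (Es ! i)"
  shows "T (x(i := sum w S)) = (\<Sum>j\<in>S. T (x(i := w j)))"
  using assms(4)
  by (induction S rule: infinite_finite_induct)
     (simp_all add: multilinear_upd_zero assms multilinear_upd_add vecs_sum[OF normed_space_nth[OF Es]])

lemma multilinear_zero: "multilinear Es F 0"
  by (simp add: multilinear_def vecs_zero[OF F] scl_zero_right[OF F])

lemma multilinear_add:
  assumes S: "multilinear Es F S" and T: "multilinear Es F T"
  shows "multilinear Es F (S + T)"
proof (rule multilinearI)
  fix x i u c assume x: "x \<in> tuples Es" "i < length Es" "u \<in> vecs (Es ! i)"
  then show "(S + T) (x(i := scl (Es ! i) c u)) = scl F c ((S + T) (x(i := u)))"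
    by (simp add: multilinear_upd_scl S T scl_add_right[OF F] multilinear_in_vecs)
qed (simp_all add: multilinear_mem multilinear_outside multilinear_upd_add S T vecs_add[OF F])

lemma multilinear_scl:
  assumes T: "multilinear Es F T"
  shows "multilinear Es F (\<lambda>x. scl F c (T x))"
proof (rule multilinearI)
  fix x i u d assume x: "x \<in> tuples Es" "i < length Es" "u \<in> vecs (Es ! i)"
  then show "scl F c (T (x(i := scl (Es ! i) d u))) = scl F d (scl F c (T (x(i := u))))"
    by (simp add: multilinear_upd_scl T scl_scl[OF F] multilinear_in_vecs mult.commute)
qed (simp_all add: multilinear_mem multilinear_outside multilinear_upd_add T vecs_scl[OF F]
       scl_zero_right[OF F] multilinear_in_vecs scl_add_right[OF F])

lemma multilinear_uminus: "multilinear Es F T \<Longrightarrow> multilinear Es F (- T)"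
  using multilinear_scl[of T "-1"] by (simp add: normed_space_uminus[OF F] multilinear_in_vecs fun_Compl_def)

lemma multilinear_diff: "multilinear Es F S \<Longrightarrow> multilinear Es F T \<Longrightarrow> multilinear Es F (S - T)"
  using multilinear_add[of S "- T"] multilinear_uminus by simp

lemma multilinear_homogeneous:
  assumes T: "multilinear Es F T" and z: "\<And>i. i < length Es \<Longrightarrow> z i \<in> vecs (Es ! i)"
  shows "T (\<lambda>i\<in>{..<length Es}. scl (Es ! i) (c i) (z i)) =
    scl F (\<Prod>i<length Es. c i) (T (\<lambda>i\<in>{..<length Es}. z i))"
proof -
  let ?n = "length Es"
  define w where "w m = (\<lambda>i\<in>{..<?n}. if i < m then scl (Es ! i) (c i) (z i) else z i)" for m
  have w: "w m \<in> tuples Es" for m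
    unfolding w_def by (rule tuples_restrictI) (simp add: z vecs_scl[OF normed_space_nth[OF Es]])
  have "T (w m) = scl F (\<Prod>i<m. c i) (T (w 0))" if "m \<le> ?n" for m
    using that
  proof (induction m)
    case 0 show ?case by (simp add: scl_one[OF F multilinear_in_vecs[OF T]])
  next
    case (Suc m)
    have "w (Suc m) = (w m)(m := scl (Es ! m) (c m) (z m))" "(w m)(m := z m) = w m"
      using Suc.prems by (auto simp: w_def fun_eq_iff less_Suc_eq)
    then have "T (w (Suc m)) = scl F (c m) (T (w m))"
      using multilinear_upd_scl[OF T w[of m], of m "z m" "c m"] Suc.prems z by simp
    then show ?case
      using Suc by (simp add: scl_scl[OF F multilinear_in_vecs[OF T]] mult.commute)
  qed
  moreover have "w ?n = (\<lambda>i\<in>{..<?n}. scl (Es ! i) (c i) (z i))" "w 0 = (\<lambda>i\<in>{..<?n}. z i)"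
    by (auto simp: w_def fun_eq_iff)
  ultimately show ?thesis by (metis order_refl)
qed

text \<open>
  The difference \<open>T y - T x\<close> telescopes over the hybrid tuples \<open>z y i\<close>, which agree with \<open>y\<close> in the first \<open>i\<close>
  variables and with \<open>x\<close> in the others. Each summand is \<open>T\<close> at a tuple one of whose entries is \<open>y i - x i\<close>; the
  bound makes it a product of norms, continuous in \<open>y\<close> and zero at \<open>y = x\<close>.
\<close>
lemma bounded_multilinear_continuous:
  assumes T: "multilinear Es F T"
    and bd: "\<And>x. x \<in> tuples Es \<Longrightarrow> nrm F (T x) \<le> C * (\<Prod>i<length Es. nrm (Es ! i) (x i))"
  shows "T \<in> cont_multilinear Es F"
proof -
  let ?n = "length Es"
  let ?X = "product_topology (\<lambda>i. norm_topology (Es ! i)) {..<?n}"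
  have top: "topspace ?X = tuples Es"
    by (auto simp: tuples_def topspace_norm_topology[OF normed_space_nth[OF Es]] intro!: PiE_cong)
  have "continuous_map ?X (norm_topology F) T"
  proof (rule continuous_map_to_norm_topology[OF F], unfold top)
    show "T x \<in> vecs F" for x by (rule multilinear_in_vecs[OF T])
    fix x assume x: "x \<in> tuples Es"
    define z where "z y i = (\<lambda>j. if j < i then y j else x j)" for y :: "nat \<Rightarrow> 'u" and i :: nat
    define g where "g y = (\<Sum>i<?n. C * (\<Prod>j<?n. nrm (Es ! j) (((z y i)(i := y i - x i)) j)))" for y
    have z: "z y i \<in> tuples Es" if "y \<in> tuples Es" for y i
      using x that by (auto simp: z_def tuples_def PiE_def extensional_def Pi_def)
    have "continuous_map ?X euclideanreal g"
      unfolding g_def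
    proof (intro continuous_map_sum continuous_map_real_mult_left continuous_map_prod)
      fix i j assume "i \<in> {..<?n}" "j \<in> {..<?n}"
      then have proj: "continuous_map ?X (norm_topology (Es ! j)) (\<lambda>y. y j)" and j: "j < ?n"
        by (auto intro: continuous_map_product_projection)
      have "((z y i)(i := y i - x i)) j =
          (if j < i then y j - 0 else if j = i then y j - x j else x j)" for y
        by (auto simp: z_def)
      moreover have "continuous_map ?X euclideanreal (\<lambda>y. nrm (Es ! j)
          (if j < i then y j - 0 else if j = i then y j - x j else x j))"
        using continuous_map_nrm_diff[OF normed_space_nth[OF Es j] proj vecs_zero[OF normed_space_nth[OF Es j]]]
          continuous_map_nrm_diff[OF normed_space_nth[OF Es j] proj tuples_nth[OF x j]]
        by (cases "j < i"; cases "j = i") simp_all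
      ultimately show "continuous_map ?X euclideanreal
          (\<lambda>y. nrm (Es ! j) (((z y i)(i := y i - x i)) j))" by (simp only:)
    qed auto
    moreover have "g x = 0"
      unfolding g_def
      by (intro sum.neutral ballI) (auto intro!: prod_zero bexI simp: nrm_zero[OF normed_space_nth[OF Es]])
    moreover have "nrm F (T y - T x) \<le> g y" if y: "y \<in> tuples Es" for y
    proof -
      have ends: "z y ?n = y" "z y 0 = x"
        using x y by (auto simp: z_def tuples_def PiE_def extensional_def)
      have step: "T (z y (Suc i)) - T (z y i) = T ((z y i)(i := y i - x i))" if i: "i < ?n" for i
      proof -
        have "z y (Suc i) = (z y i)(i := y i)" "(z y i)(i := x i) = z y i"
          by (auto simp: z_def less_Suc_eq)
        then show ?thesis
          using multilinear_upd_diff[OF T z[OF y] i tuples_nth[OF y i] tuples_nth[OF x i], of i] by simp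
      qed
      have "T y - T x = (\<Sum>i<?n. T (z y (Suc i)) - T (z y i))"
        using sum_lessThan_telescope[of "\<lambda>i. T (z y i)" ?n] by (simp add: ends)
      also have "\<dots> = (\<Sum>i<?n. T ((z y i)(i := y i - x i)))"
        by (intro sum.cong) (auto simp: step)
      also have "nrm F \<dots> \<le> (\<Sum>i<?n. nrm F (T ((z y i)(i := y i - x i))))"
        by (rule nrm_sum_le[OF F]) (rule multilinear_in_vecs[OF T])
      also have "\<dots> \<le> g y"
        unfolding g_def
        by (intro sum_mono bd tuples_upd z y vecs_diff[OF normed_space_nth[OF Es]] tuples_nth[OF x] tuples_nth[OF y]) auto
      finally show ?thesis .
    qed
    ultimately show "\<exists>g. continuous_map ?X euclideanreal g \<and> g x = 0 \<and>
        (\<forall>y\<in>tuples Es. nrm F (T y - T x) \<le> g y)" by blast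
  qed
  then show ?thesis using T by (simp add: cont_multilinear_def)
qed

end


section \<open>Weak norms and the summing inequality\<close>

lemma powr_sum_scale:
  fixes a :: "'i \<Rightarrow> real"
  assumes "0 \<le> c" "0 < p" "\<And>i. i \<in> I \<Longrightarrow> 0 \<le> a i"
  shows "(\<Sum>i\<in>I. (c * a i) powr p) powr (1 / p) = c * (\<Sum>i\<in>I. a i powr p) powr (1 / p)"
proof -
  have "(\<Sum>i\<in>I. (c * a i) powr p) = c powr p * (\<Sum>i\<in>I. a i powr p)"
    using assms by (simp add: sum_distrib_left powr_mult)
  moreover have "(c powr p) powr (1 / p) = c" using assms by (simp add: powr_powr)
  ultimately show ?thesis by (simp add: powr_mult sum_nonneg)
qed

lemma powr_root_le_oneD:
  fixes s :: real
  assumes "s powr (1 / p) \<le> 1" "0 < p"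
  shows "s \<le> 1"
proof (rule ccontr)
  assume "\<not> s \<le> 1"
  then have "1 < s powr (1 / p)" using assms(2) by (intro gr_one_powr) auto
  then show False using assms(1) by simp
qed

lemma ell_norm_nonneg: "0 \<le> ell_norm p E m x"
  by (simp add: ell_norm_def)

lemma ell_norm_scl:
  assumes "normed_space E" "0 < p" "\<And>j. j < m \<Longrightarrow> x j \<in> vecs E"
  shows "ell_norm p E m (\<lambda>j. scl E c (x j)) = norm c * ell_norm p E m x"
  using powr_sum_scale[of "norm c" p "{..<m}" "\<lambda>j. nrm E (x j)"] assms
  by (simp add: ell_norm_def nrm_scl nrm_nonneg)

lemma ell_norm_Suc_0:
  assumes "normed_space E" "0 < p" "x 0 \<in> vecs E"
  shows "ell_norm p E (Suc 0) x = nrm E (x 0)"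
  using assms by (simp add: ell_norm_def powr_powr nrm_nonneg)

context
  fixes F :: "('k::real_normed_field, 'v::ab_group_add) nspace" and q :: real and I :: "'i set"
  assumes F: "normed_space F" and q: "0 < q" and I: "finite I"
begin

lemma weak_norm_bdd_above:
  assumes phi: "\<forall>i\<in>I. \<phi> i \<in> dual F"
  shows "bdd_above ((\<lambda>y. (\<Sum>\<^sub>\<infinity>i\<in>I. norm (\<phi> i y) powr q) powr (1 / q)) ` unit_ball F)"
proof -
  have "\<exists>K\<ge>0. \<forall>y\<in>vecs F. norm (\<phi> i y) \<le> K * nrm F y" if "i \<in> I" for i
    by (rule dual_bounded[OF F phi[rule_format, OF that]])
  then obtain K where K: "\<And>i. i \<in> I \<Longrightarrow> 0 \<le> K i"
    "\<And>i y. i \<in> I \<Longrightarrow> y \<in> vecs F \<Longrightarrow> norm (\<phi> i y) \<le> K i * nrm F y" by metis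
  have "norm (\<phi> i y) \<le> K i" if "i \<in> I" "y \<in> unit_ball F" for i y
    using K(2)[OF that(1), of y] mult_left_mono[OF _ K(1)[OF that(1)], of "nrm F y" 1] that(2)
    by (auto simp: unit_ball_def)
  then show ?thesis
    using I q
    by (intro bdd_aboveI2[where M="(\<Sum>i\<in>I. K i powr q) powr (1 / q)"])
       (auto intro!: powr_mono2 sum_mono sum_nonneg)
qed

lemma weak_norm_upper:
  assumes "\<forall>i\<in>I. \<phi> i \<in> dual F" "y \<in> unit_ball F"
  shows "(\<Sum>i\<in>I. norm (\<phi> i y) powr q) powr (1 / q) \<le> weak_norm q I F \<phi>"
  unfolding weak_norm_def using cSUP_upper[OF assms(2) weak_norm_bdd_above[OF assms(1)]] I by simp

lemma zero_in_unit_ball: "0 \<in> unit_ball F"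
  by (simp add: unit_ball_def vecs_zero[OF F] nrm_zero[OF F])

lemma weak_norm_least:
  assumes "\<And>y. y \<in> unit_ball F \<Longrightarrow> (\<Sum>i\<in>I. norm (\<phi> i y) powr q) powr (1 / q) \<le> B"
  shows "weak_norm q I F \<phi> \<le> B"
  unfolding weak_norm_def using assms zero_in_unit_ball I by (intro cSUP_least) auto

lemma weak_norm_nonneg: "\<forall>i\<in>I. \<phi> i \<in> dual F \<Longrightarrow> 0 \<le> weak_norm q I F \<phi>"
  by (rule order_trans[OF powr_ge_zero weak_norm_upper[OF _ zero_in_unit_ball]])

lemma weak_norm_mult_le:
  assumes phi: "\<forall>i\<in>I. \<phi> i \<in> dual F"
  shows "weak_norm q I F (\<lambda>i y. c * \<phi> i y) \<le> norm c * weak_norm q I F \<phi>"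
proof (rule weak_norm_least)
  fix y assume y: "y \<in> unit_ball F"
  show "(\<Sum>i\<in>I. norm (c * \<phi> i y) powr q) powr (1 / q) \<le> norm c * weak_norm q I F \<phi>"
    using powr_sum_scale[of "norm c" q I "\<lambda>i. norm (\<phi> i y)"] q
      mult_left_mono[OF weak_norm_upper[OF phi y], of "norm c"]
    by (simp add: norm_mult)
qed

lemma norm_le_weak_norm:
  assumes phi: "\<forall>i\<in>I. \<phi> i \<in> dual F" and i: "i \<in> I" and y: "y \<in> vecs F"
  shows "norm (\<phi> i y) \<le> nrm F y * weak_norm q I F \<phi>"
proof (cases "y = 0")
  case True then show ?thesis using dual_zero[OF F phi[rule_format, OF i]] by (simp add: nrm_zero[OF F])
next
  case False
  then have pos: "nrm F y > 0" using nrm_nonneg[OF F y] nrm_eq_0[OF F y] by linarith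
  define z where "z = scl F (of_real (1 / nrm F y)) y"
  have "norm (of_real (1 / nrm F y) :: 'k) = 1 / nrm F y" using pos by (simp only: norm_of_real) simp
  then have z: "z \<in> unit_ball F" and eq: "norm (\<phi> i z) = norm (\<phi> i y) / nrm F y"
    using pos by (simp_all add: z_def unit_ball_def vecs_scl[OF F y] nrm_scl[OF F y]
        dual_scl[OF F phi[rule_format, OF i] y] norm_mult del: of_real_divide)
  have "norm (\<phi> i z) = (norm (\<phi> i z) powr q) powr (1 / q)" using q by (simp add: powr_powr)
  also have "\<dots> \<le> (\<Sum>i\<in>I. norm (\<phi> i z) powr q) powr (1 / q)"
    using I i q by (intro powr_mono2) (auto intro!: member_le_sum)
  also have "\<dots> \<le> weak_norm q I F \<phi>" by (rule weak_norm_upper[OF phi z])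
  finally show ?thesis using pos by (simp add: eq field_simps)
qed

end

text \<open>
  The inequality in \<open>mCoh_norm\<close> is taken apart into sums, data and constants, so that the validity of a constant
  can be treated as a property of \<open>T\<close> that is compatible with the vector space operations.
\<close>
definition cohen_sum ::
  "('k::real_normed_field, 'u) nspace list \<Rightarrow> ((nat \<Rightarrow> 'u) \<Rightarrow> 'v) \<Rightarrow> nat
    \<Rightarrow> (nat \<Rightarrow> nat \<Rightarrow> 'u) \<Rightarrow> ((nat \<Rightarrow> nat) \<Rightarrow> 'v \<Rightarrow> 'k) \<Rightarrow> real" where
  "cohen_sum Es T m x \<phi> =
     (\<Sum>j \<in> {..<length Es} \<rightarrow>\<^sub>E {..<m}. norm (\<phi> j (T (\<lambda>i\<in>{..<length Es}. x i (j i)))))"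

definition cohen_data ::
  "('k::real_normed_field, 'u) nspace list \<Rightarrow> ('k, 'v::ab_group_add) nspace \<Rightarrow> nat
    \<Rightarrow> (nat \<Rightarrow> nat \<Rightarrow> 'u) \<Rightarrow> ((nat \<Rightarrow> nat) \<Rightarrow> 'v \<Rightarrow> 'k) \<Rightarrow> bool" where
  "cohen_data Es F m x \<phi> \<longleftrightarrow>
     (\<forall>i<length Es. \<forall>j<m. x i j \<in> vecs (Es ! i)) \<and>
     (\<forall>j \<in> {..<length Es} \<rightarrow>\<^sub>E {..<m}. \<phi> j \<in> dual F)"

definition cohen_bound ::
  "real \<Rightarrow> ('k::real_normed_field, 'u) nspace list \<Rightarrow> ('k, 'v::ab_group_add) nspace
    \<Rightarrow> ((nat \<Rightarrow> 'u) \<Rightarrow> 'v) \<Rightarrow> real \<Rightarrow> bool" where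
  "cohen_bound p Es F T C \<longleftrightarrow> 0 \<le> C \<and>
     (\<forall>m x \<phi>. cohen_data Es F m x \<phi> \<longrightarrow>
        cohen_sum Es T m x \<phi> \<le> C * (\<Prod>i<length Es. ell_norm p (Es ! i) m (x i))
              * weak_norm (conj_exp p) ({..<length Es} \<rightarrow>\<^sub>E {..<m}) F \<phi>)"

lemma mCoh_norm_eq: "mCoh_norm p Es F T = Inf {C. cohen_bound p Es F T C}"
  by (simp add: mCoh_norm_def cohen_bound_def cohen_data_def cohen_sum_def)

lemma conj_exp_gt_1: "1 < p \<Longrightarrow> 1 < conj_exp p"
  by (simp add: conj_exp_def field_simps)

lemma finite_index: "finite ({..<n::nat} \<rightarrow>\<^sub>E {..<m::nat})"
  by (simp add: finite_PiE)

lemma index_lt: "j \<in> {..<n} \<rightarrow>\<^sub>E {..<m::nat} \<Longrightarrow> i < n \<Longrightarrow> j i < m" for n :: nat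
  by (auto simp: PiE_iff)

context
  fixes p :: real and Es :: "('k::real_normed_field, 'u::ab_group_add) nspace list"
    and F :: "('k, 'v::ab_group_add) nspace"
  assumes p: "1 < p" and Es: "\<forall>E\<in>set Es. normed_space E"
    and F: "normed_space F"
begin

lemma conj_exp_pos: "0 < conj_exp p"
  using conj_exp_gt_1[OF p] by simp

lemma cohen_data_tuple:
  assumes "cohen_data Es F m x \<phi>" "j \<in> {..<length Es} \<rightarrow>\<^sub>E {..<m}"
  shows "(\<lambda>i\<in>{..<length Es}. x i (j i)) \<in> tuples Es"
  using assms index_lt[OF assms(2)] by (intro tuples_restrictI) (auto simp: cohen_data_def)

lemma cohen_data_dual:
  "cohen_data Es F m x \<phi> \<Longrightarrow> j \<in> {..<length Es} \<rightarrow>\<^sub>E {..<m} \<Longrightarrow> \<phi> j \<in> dual F"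
  by (simp add: cohen_data_def)

lemma cohen_rhs_nonneg:
  "cohen_data Es F m x \<phi> \<Longrightarrow> 0 \<le> (\<Prod>i<length Es. ell_norm p (Es ! i) m (x i))
      * weak_norm (conj_exp p) ({..<length Es} \<rightarrow>\<^sub>E {..<m}) F \<phi>"
  by (intro mult_nonneg_nonneg prod_nonneg ell_norm_nonneg ballI
      weak_norm_nonneg[OF F conj_exp_pos finite_index]) (simp add: cohen_data_def)

lemma cohen_boundD:
  "cohen_bound p Es F T C \<Longrightarrow> cohen_data Es F m x \<phi> \<Longrightarrow>
    cohen_sum Es T m x \<phi> \<le> C * ((\<Prod>i<length Es. ell_norm p (Es ! i) m (x i))
      * weak_norm (conj_exp p) ({..<length Es} \<rightarrow>\<^sub>E {..<m}) F \<phi>)"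
  by (simp add: cohen_bound_def mult.assoc)

lemma cohen_boundI:
  assumes "0 \<le> C"
    and "\<And>m x \<phi>. cohen_data Es F m x \<phi> \<Longrightarrow>
      cohen_sum Es T m x \<phi> \<le> C * ((\<Prod>i<length Es. ell_norm p (Es ! i) m (x i))
        * weak_norm (conj_exp p) ({..<length Es} \<rightarrow>\<^sub>E {..<m}) F \<phi>)"
  shows "cohen_bound p Es F T C"
  using assms by (simp add: cohen_bound_def mult.assoc)

lemma cohen_bound_mono:
  assumes T: "cohen_bound p Es F T C" and le: "C \<le> D"
  shows "cohen_bound p Es F T D"
proof (rule cohen_boundI)
  show "0 \<le> D" using T le by (simp add: cohen_bound_def)
qed (rule order_trans[OF cohen_boundD[OF T] mult_right_mono[OF le cohen_rhs_nonneg]])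

lemma cohen_bound_zero: "cohen_bound p Es F 0 0"
  by (rule cohen_boundI) (auto simp: cohen_sum_def dual_zero[OF F cohen_data_dual])

lemma cohen_bound_add:
  assumes S: "multilinear Es F S" "cohen_bound p Es F S C" and T: "multilinear Es F T" "cohen_bound p Es F T D"
  shows "cohen_bound p Es F (S + T) (C + D)"
proof (rule cohen_boundI)
  show "0 \<le> C + D" using S T by (simp add: cohen_bound_def)
  fix m x \<phi> assume data: "cohen_data Es F m x \<phi>"
  have "cohen_sum Es (S + T) m x \<phi> \<le> cohen_sum Es S m x \<phi> + cohen_sum Es T m x \<phi>"
    unfolding cohen_sum_def sum.distrib[symmetric]
    by (intro sum_mono)
       (simp add: dual_add[OF F cohen_data_dual[OF data]] multilinear_in_vecs[OF Es F] S(1) T(1) norm_triangle_ineq)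
  then show "cohen_sum Es (S + T) m x \<phi> \<le> (C + D) * ((\<Prod>i<length Es. ell_norm p (Es ! i) m (x i))
        * weak_norm (conj_exp p) ({..<length Es} \<rightarrow>\<^sub>E {..<m}) F \<phi>)"
    using cohen_boundD[OF S(2) data] cohen_boundD[OF T(2) data] by (simp add: distrib_right)
qed

lemma cohen_bound_scl:
  assumes T: "multilinear Es F T" "cohen_bound p Es F T C"
  shows "cohen_bound p Es F (\<lambda>x. scl F c (T x)) (norm c * C)"
proof (rule cohen_boundI)
  show "0 \<le> norm c * C" using T by (simp add: cohen_bound_def)
  fix m x \<phi> assume data: "cohen_data Es F m x \<phi>"
  have "cohen_sum Es (\<lambda>x. scl F c (T x)) m x \<phi> = norm c * cohen_sum Es T m x \<phi>"
    unfolding cohen_sum_def sum_distrib_left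
    by (intro sum.cong)
       (simp_all add: dual_scl[OF F cohen_data_dual[OF data]] multilinear_in_vecs[OF Es F] T(1) norm_mult)
  then show "cohen_sum Es (\<lambda>x. scl F c (T x)) m x \<phi> \<le> norm c * C * ((\<Prod>i<length Es. ell_norm p (Es ! i) m (x i))
        * weak_norm (conj_exp p) ({..<length Es} \<rightarrow>\<^sub>E {..<m}) F \<phi>)"
    using mult_left_mono[OF cohen_boundD[OF T(2) data], of "norm c"] by (simp add: mult.assoc)
qed

text \<open>
  The inequality for \<open>m = 1\<close>, applied to a norming functional of \<open>T x\<close>, whose weak norm is at most 1.
\<close>
lemma nrm_le_of_cohen_bound:
  assumes nf: "norming F" and T: "multilinear Es F T" "cohen_bound p Es F T C" and x: "x \<in> tuples Es"
  shows "nrm F (T x) \<le> C * (\<Prod>i<length Es. nrm (Es ! i) (x i))"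
proof -
  obtain \<phi> where phi: "\<phi> \<in> dual F" "\<And>z. z \<in> vecs F \<Longrightarrow> norm (\<phi> z) \<le> nrm F z"
    and eq: "norm (\<phi> (T x)) = nrm F (T x)"
    using nf multilinear_in_vecs[OF Es F T(1)] unfolding norming_def by blast
  let ?I = "{..<length Es} \<rightarrow>\<^sub>E {..<Suc 0}"
  have I: "?I = {\<lambda>i\<in>{..<length Es}. 0}"
    by (auto simp: PiE_eq_singleton)
  have xi: "x i \<in> vecs (Es ! i)" if "i < length Es" for i by (rule tuples_nth[OF x that])
  have data: "cohen_data Es F (Suc 0) (\<lambda>i _. x i) (\<lambda>_. \<phi>)"
    by (simp add: cohen_data_def xi phi)
  have "cohen_sum Es T (Suc 0) (\<lambda>i _. x i) (\<lambda>_. \<phi>) = nrm F (T x)"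
    by (simp add: cohen_sum_def I tuples_restrict[OF x] eq)
  moreover have "(\<Prod>i<length Es. ell_norm p (Es ! i) (Suc 0) (\<lambda>_. x i)) = (\<Prod>i<length Es. nrm (Es ! i) (x i))"
    by (intro prod.cong) (use p in \<open>auto intro!: ell_norm_Suc_0[OF normed_space_nth[OF Es]] xi\<close>)
  moreover have "weak_norm (conj_exp p) ?I F (\<lambda>_. \<phi>) \<le> 1"
  proof (rule weak_norm_least[OF F conj_exp_pos finite_index])
    fix y assume "y \<in> unit_ball F"
    then have "norm (\<phi> y) \<le> 1" using phi(2)[of y] by (auto simp: unit_ball_def)
    then show "(\<Sum>i\<in>?I. norm (\<phi> y) powr conj_exp p) powr (1 / conj_exp p) \<le> 1"
      unfolding I using conj_exp_pos by (simp add: powr_powr)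
  qed
  moreover have "0 \<le> C" "0 \<le> (\<Prod>i<length Es. nrm (Es ! i) (x i))"
    using T(2) by (auto simp: cohen_bound_def intro!: prod_nonneg nrm_nonneg[OF normed_space_nth[OF Es]] xi)
  ultimately show ?thesis
    using cohen_boundD[OF T(2) data] mult_left_mono[of _ 1 "C * (\<Prod>i<length Es. nrm (Es ! i) (x i))"]
    by (fastforce simp: mult.assoc)
qed

end


section \<open>Characterisation by the summing inequality\<close>

lemma finite_subset_index:
  assumes "finite X" "X \<subseteq> {..<n::nat} \<rightarrow>\<^sub>E (UNIV :: nat set)"
  shows "\<exists>m. X \<subseteq> {..<n} \<rightarrow>\<^sub>E {..<m}"
proof -
  have "finite ((\<lambda>(j, i). j i) ` (X \<times> {..<n}))" using assms by simp
  then obtain m where m: "\<And>k. k \<in> (\<lambda>(j, i). j i) ` (X \<times> {..<n}) \<Longrightarrow> k < m"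
    unfolding finite_nat_set_iff_bounded by blast
  have "j i < m" if "j \<in> X" "i < n" for j i
    by (rule m) (use that in \<open>auto intro: rev_image_eqI[of "(j, i)"]\<close>)
  then have "j \<in> {..<n} \<rightarrow>\<^sub>E {..<m}" if "j \<in> X" for j
    using subsetD[OF assms(2) that] that by (auto simp: PiE_iff)
  then show ?thesis by blast
qed

text \<open>
  The estimate behind the gluing of data: blocks whose sums are dominated by a geometric series are jointly
  summable.
\<close>
lemma summable_on_blocks:
  fixes f :: "nat \<times> 'j \<Rightarrow> real"
  assumes nonneg: "\<And>z. 0 \<le> f z" and fin: "\<And>N. finite (B N)"
    and le: "\<And>N. (\<Sum>j\<in>B N. f (N, j)) \<le> (1/2) ^ N"
  shows "f summable_on Sigma UNIV B" and "infsum f (Sigma UNIV B) \<le> 2"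
proof -
  have bd: "sum f X \<le> 2" if X: "finite X" "X \<subseteq> Sigma UNIV B" for X
  proof -
    obtain M where M: "\<And>N. N \<in> fst ` X \<Longrightarrow> N < M"
      using finite_imageI[OF X(1), of fst] unfolding finite_nat_set_iff_bounded by blast
    have "X \<subseteq> Sigma {..<M} B" using X(2) M by force
    then have "sum f X \<le> sum f (Sigma {..<M} B)" by (intro sum_mono2) (auto simp: fin nonneg)
    also have "\<dots> = (\<Sum>N<M. \<Sum>j\<in>B N. f (N, j))" by (simp add: sum.Sigma fin)
    also have "\<dots> \<le> (\<Sum>N<M. (1/2) ^ N)" by (intro sum_mono le)
    also have "\<dots> \<le> (\<Sum>N. (1/2) ^ N)" by (rule sum_le_suminf) (auto intro: summable_geometric)
    also have "\<dots> = 2" using suminf_geometric[of "1/2::real"] by simp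
    finally show ?thesis .
  qed
  show s: "f summable_on Sigma UNIV B"
    by (rule nonneg_bdd_above_summable_on) (auto simp: nonneg intro!: bdd_aboveI2[where M=2] bd)
  show "infsum f (Sigma UNIV B) \<le> 2" by (rule infsum_le_finite_sums[OF s bd])
qed

context
  fixes p :: real and Es :: "('k::real_normed_field, 'u::ab_group_add) nspace list"
    and F :: "('k, 'v::ab_group_add) nspace"
  assumes p: "1 < p" and Es: "\<forall>E\<in>set Es. normed_space E"
    and F: "normed_space F"
begin

lemma mCoh_multilinear: "T \<in> mCoh p Es F \<Longrightarrow> multilinear Es F T"
  by (simp add: mCoh_def cont_multilinear_def)

definition cohen_unit_data :: "nat \<Rightarrow> (nat \<Rightarrow> nat \<Rightarrow> 'u) \<Rightarrow> ((nat \<Rightarrow> nat) \<Rightarrow> 'v \<Rightarrow> 'k) \<Rightarrow> bool" where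
  "cohen_unit_data m x \<phi> \<longleftrightarrow> cohen_data Es F m x \<phi> \<and>
     (\<forall>i<length Es. ell_norm p (Es ! i) m (x i) \<le> 1) \<and>
     weak_norm (conj_exp p) ({..<length Es} \<rightarrow>\<^sub>E {..<m}) F \<phi> \<le> 1"

context
  fixes T m x \<phi>
  assumes T: "T \<in> mCoh p Es F" and ne: "Es \<noteq> []"
    and unit: "\<And>N. cohen_unit_data (m N) (x N) (\<phi> N)"
    and large: "\<And>N. 2 ^ (N * (length Es + 1)) < cohen_sum Es T (m N) (x N) (\<phi> N)"
begin

text \<open>
  The pieces \<open>x N\<close>, damped by the factor \<open>1 / 2 ^ N\<close>, are put into one sequence per variable. Placing the \<open>j\<close>-th entry
  of piece \<open>N\<close> at \<open>prod_encode (N, j)\<close> keeps the pieces disjoint without any bookkeeping of their lengths.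
\<close>
definition glued_x :: "nat \<Rightarrow> nat \<Rightarrow> 'u" where
  "glued_x i k = (case prod_decode k of (N, j) \<Rightarrow>
     if j < m N then scl (Es ! i) (of_real ((1/2) ^ N)) (x N i j) else 0)"

definition glue_index :: "nat \<times> (nat \<Rightarrow> nat) \<Rightarrow> nat \<Rightarrow> nat" where
  "glue_index = (\<lambda>(N, j). \<lambda>i\<in>{..<length Es}. prod_encode (N, j i))"

definition glued_indices :: "(nat \<times> (nat \<Rightarrow> nat)) set" where
  "glued_indices = Sigma UNIV (\<lambda>N. {..<length Es} \<rightarrow>\<^sub>E {..<m N})"

text \<open>
  The functionals of piece \<open>N\<close> live on the multi-indices all of whose coordinates belong to block \<open>N\<close>; on all
  mixed multi-indices the family is zero.
\<close>
definition glued_phi :: "(nat \<Rightarrow> nat) \<Rightarrow> 'v \<Rightarrow> 'k" where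
  "glued_phi J = (if J \<in> glue_index ` glued_indices
     then case inv_into glued_indices glue_index J of (N, j) \<Rightarrow> (\<lambda>y. of_real ((1/2) ^ N) * \<phi> N j y)
     else (\<lambda>_. 0))"

lemma half_power_powr_le: "1 < r \<Longrightarrow> ((1/2) ^ N) powr r \<le> (1/2 :: real) ^ N"
  by (rule powr_le_one_le) (auto simp: power_le_one)

lemma glued_x_in_ell:
  assumes i: "i < length Es"
  shows "glued_x i \<in> ell p (Es ! i)"
proof -
  note E = normed_space_nth[OF Es i]
  have mem: "x N i j \<in> vecs (Es ! i)" if "j < m N" for N j
    using unit[of N] i that by (auto simp: cohen_unit_data_def cohen_data_def)
  have "glued_x i k \<in> vecs (Es ! i)" for k
    by (auto simp: glued_x_def mem vecs_scl[OF E] vecs_zero[OF E] split: prod.split)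
  moreover have "(\<lambda>k. nrm (Es ! i) (glued_x i k) powr p) summable_on UNIV"
  proof -
    let ?f = "\<lambda>(N, j). ((1/2) ^ N * nrm (Es ! i) (x N i j)) powr p"
    have "?f summable_on Sigma UNIV (\<lambda>N. {..<m N})"
    proof (rule summable_on_blocks)
      fix N
      have "(\<Sum>j<m N. nrm (Es ! i) (x N i j) powr p) \<le> 1"
        using unit[of N] i p
        by - (rule powr_root_le_oneD[of _ p], auto simp: cohen_unit_data_def ell_norm_def)
      then have "((1/2) ^ N) powr p * (\<Sum>j<m N. nrm (Es ! i) (x N i j) powr p) \<le> (1/2) ^ N * 1"
        by (intro mult_mono half_power_powr_le p) (auto intro: sum_nonneg)
      then show "(\<Sum>j<m N. ?f (N, j)) \<le> (1/2) ^ N"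
        by (simp add: powr_mult nrm_nonneg[OF E mem] sum_distrib_left)
    qed auto
    then have "(\<lambda>z. nrm (Es ! i) (glued_x i (prod_encode z)) powr p) summable_on UNIV"
      by (rule summable_on_cong_neutral[THEN iffD1, rotated -1])
         (auto simp: glued_x_def nrm_zero[OF E] nrm_scl[OF E mem] norm_power norm_divide split: if_splits)
    then show ?thesis
      using summable_on_reindex_bij_betw[OF bij_prod_encode,
          of "\<lambda>k. nrm (Es ! i) (glued_x i k) powr p"] by simp
  qed
  ultimately show ?thesis
    by (simp add: ell_def summable_on_UNIV_nonneg_real_iff)
qed

text \<open>
  The block number can be read off any coordinate of a glued multi-index. This is where at least one variable is
  needed.
\<close>
lemma inj_glue_index: "inj_on glue_index glued_indices"
proof (rule inj_onI, clarify)
  fix N j N' j'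
  assume mem: "(N, j) \<in> glued_indices" "(N', j') \<in> glued_indices"
    and eq: "glue_index (N, j) = glue_index (N', j')"
  have *: "N = N' \<and> j i = j' i" if "i < length Es" for i
    using fun_cong[OF eq, of i] that by (simp add: glue_index_def)
  have "j = j'"
    by (rule extensionalityI[of _ "{..<length Es}"])
       (use mem * in \<open>auto simp: glued_indices_def PiE_iff\<close>)
  then show "N = N' \<and> j = j'" using * ne by blast
qed

lemma glued_phi_glue_index:
  assumes "(N, j) \<in> glued_indices"
  shows "glued_phi (glue_index (N, j)) = (\<lambda>y. of_real ((1/2) ^ N) * \<phi> N j y)"
  using assms by (auto simp: glued_phi_def inv_into_f_f[OF inj_glue_index])

lemma phi_dual: "(N, j) \<in> glued_indices \<Longrightarrow> \<phi> N j \<in> dual F"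
  using unit[of N] by (auto simp: glued_indices_def cohen_unit_data_def cohen_data_def)

lemma glue_index_subset: "glue_index ` glued_indices \<subseteq> {..<length Es} \<rightarrow>\<^sub>E UNIV"
  by (auto simp: glue_index_def PiE_def)

lemma glued_phi_in_weak_ell:
  "glued_phi \<in> weak_ell (conj_exp p) ({..<length Es} \<rightarrow>\<^sub>E UNIV) F"
proof -
  let ?q = "conj_exp p" and ?I = "{..<length Es} \<rightarrow>\<^sub>E (UNIV :: nat set)"
  have q: "1 < ?q" by (rule conj_exp_gt_1[OF p])
  have "glued_phi J \<in> dual F" for J
  proof (cases "J \<in> glue_index ` glued_indices")
    case True
    then show ?thesis by (auto simp: glued_phi_glue_index intro!: dual_mult[OF F] phi_dual)
  next
    case False
    then show ?thesis by (simp add: glued_phi_def dual_zero_functional[OF F])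
  qed
  moreover have "(\<lambda>J. norm (glued_phi J y) powr ?q) summable_on ?I"
    "(\<Sum>\<^sub>\<infinity>J\<in>?I. norm (glued_phi J y) powr ?q) \<le> 2" if y: "y \<in> unit_ball F" for y
  proof -
    let ?f = "\<lambda>(N, j). ((1/2) ^ N * norm (\<phi> N j y)) powr ?q"
    have le: "(\<Sum>j\<in>{..<length Es} \<rightarrow>\<^sub>E {..<m N}. ?f (N, j)) \<le> (1/2) ^ N" for N
    proof -
      have "(\<Sum>j\<in>{..<length Es} \<rightarrow>\<^sub>E {..<m N}. norm (\<phi> N j y) powr ?q) powr (1 / ?q)
          \<le> weak_norm ?q ({..<length Es} \<rightarrow>\<^sub>E {..<m N}) F (\<phi> N)"
        by (rule weak_norm_upper[OF F _ finite_index _ y])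
           (use q unit[of N] in \<open>auto simp: cohen_unit_data_def cohen_data_def\<close>)
      also have "\<dots> \<le> 1" using unit[of N] by (simp add: cohen_unit_data_def)
      finally have "(\<Sum>j\<in>{..<length Es} \<rightarrow>\<^sub>E {..<m N}. norm (\<phi> N j y) powr ?q) \<le> 1"
        using q by - (rule powr_root_le_oneD[of _ ?q], auto)
      then have "((1/2) ^ N) powr ?q * (\<Sum>j\<in>{..<length Es} \<rightarrow>\<^sub>E {..<m N}. norm (\<phi> N j y) powr ?q)
          \<le> (1/2) ^ N * 1"
        by (intro mult_mono half_power_powr_le q) (auto intro: sum_nonneg)
      then show ?thesis by (simp add: powr_mult sum_distrib_left)
    qed
    have blocks: "?f summable_on glued_indices" "infsum ?f glued_indices \<le> 2"
      unfolding glued_indices_def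
      by (rule summable_on_blocks; use finite_index le in force)+
    have f_eq: "((\<lambda>J. norm (glued_phi J y) powr ?q) \<circ> glue_index) z = ?f z"
      if "z \<in> glued_indices" for z
      using that by (cases z) (simp add: glued_phi_glue_index norm_mult norm_power)
    have outside: "norm (glued_phi J y) powr ?q = 0" if "J \<notin> glue_index ` glued_indices" for J
      using that by (simp add: glued_phi_def)
    have "(\<lambda>J. norm (glued_phi J y) powr ?q) summable_on glue_index ` glued_indices"
      using blocks(1) by (simp add: summable_on_reindex[OF inj_glue_index] summable_on_cong[OF f_eq])
    then show "(\<lambda>J. norm (glued_phi J y) powr ?q) summable_on ?I"
      by (rule summable_on_cong_neutral[THEN iffD1, rotated -1])
         (use outside glue_index_subset in auto)
    have "(\<Sum>\<^sub>\<infinity>J\<in>?I. norm (glued_phi J y) powr ?q)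
        = (\<Sum>\<^sub>\<infinity>J\<in>glue_index ` glued_indices. norm (glued_phi J y) powr ?q)"
      by (rule infsum_cong_neutral) (use outside glue_index_subset in auto)
    also have "\<dots> = infsum ?f glued_indices"
      by (simp add: infsum_reindex[OF inj_glue_index] infsum_cong[OF f_eq])
    finally show "(\<Sum>\<^sub>\<infinity>J\<in>?I. norm (glued_phi J y) powr ?q) \<le> 2" using blocks(2) by simp
  qed
  moreover have "bdd_above ((\<lambda>y. (\<Sum>\<^sub>\<infinity>J\<in>?I. norm (glued_phi J y) powr ?q) powr (1 / ?q)) ` unit_ball F)"
    by (rule bdd_aboveI2[where M="2 powr (1 / ?q)"])
       (use q calculation(3) in \<open>auto intro!: powr_mono2 infsum_nonneg\<close>)
  ultimately show ?thesis by (simp add: weak_ell_def)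
qed

text \<open>
  By homogeneity block \<open>N\<close> contributes its original sum divided by \<open>2 ^ (N * (n + 1))\<close>: one factor \<open>1 / 2 ^ N\<close> for each of the
  \<open>n\<close> variables and one for the functionals. This is at least 1 for every block, so the sum over all blocks
  diverges, contrary to \<open>T\<close> being summing.
\<close>
lemma glued_diverges: False
proof -
  let ?n = "length Es"
  let ?g = "\<lambda>J. norm (glued_phi J (T (\<lambda>i\<in>{..<?n}. glued_x i (J i))))"
  have "?g summable_on ({..<?n} \<rightarrow>\<^sub>E UNIV)"
    using T glued_x_in_ell glued_phi_in_weak_ell by (auto simp: mCoh_def cohen_ell_def)
  then have "?g summable_on glue_index ` glued_indices"
    by (rule summable_on_subset_banach[OF _ glue_index_subset])
  then have s: "(?g \<circ> glue_index) summable_on glued_indices"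
    by (simp add: summable_on_reindex[OF inj_glue_index])
  have g_eq: "?g (glue_index (N, j)) = (1/2) ^ (N * (?n + 1)) *
      norm (\<phi> N j (T (\<lambda>i\<in>{..<?n}. x N i (j i))))"
    if j: "j \<in> {..<?n} \<rightarrow>\<^sub>E {..<m N}" for N j
  proof -
    have mem: "(N, j) \<in> glued_indices" using j by (simp add: glued_indices_def)
    have data: "cohen_data Es F (m N) (x N) (\<phi> N)" using unit by (simp add: cohen_unit_data_def)
    have "(\<lambda>i\<in>{..<?n}. glued_x i (glue_index (N, j) i)) =
        (\<lambda>i\<in>{..<?n}. scl (Es ! i) (of_real ((1/2) ^ N)) (x N i (j i)))"
      using index_lt[OF j] by (auto simp: glued_x_def glue_index_def fun_eq_iff)
    then have "T (\<lambda>i\<in>{..<?n}. glued_x i (glue_index (N, j) i)) =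
        scl F (of_real ((1/2) ^ (N * ?n))) (T (\<lambda>i\<in>{..<?n}. x N i (j i)))"
      using multilinear_homogeneous[OF Es F mCoh_multilinear[OF T],
          of "\<lambda>i. x N i (j i)" "\<lambda>_. of_real ((1/2) ^ N)"] data index_lt[OF j]
      by (simp add: cohen_data_def power_mult)
    then show ?thesis
      by (simp add: glued_phi_glue_index[OF mem] dual_scl[OF F phi_dual[OF mem]]
          multilinear_in_vecs[OF Es F mCoh_multilinear[OF T]] norm_mult norm_power power_add)
  qed
  have block: "1 \<le> (\<Sum>j\<in>{..<?n} \<rightarrow>\<^sub>E {..<m N}. (?g \<circ> glue_index) (N, j))" for N
  proof -
    have "(\<Sum>j\<in>{..<?n} \<rightarrow>\<^sub>E {..<m N}. (?g \<circ> glue_index) (N, j))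
        = (1/2) ^ (N * (?n + 1)) * cohen_sum Es T (m N) (x N) (\<phi> N)"
      unfolding cohen_sum_def sum_distrib_left o_def by (intro sum.cong refl g_eq)
    moreover have "1 = (1/2 :: real) ^ (N * (?n + 1)) * 2 ^ (N * (?n + 1))"
      by (simp add: power_mult_distrib[symmetric])
    ultimately show ?thesis using mult_left_mono[OF less_imp_le[OF large[of N]], of "(1/2) ^ (N * (?n + 1))"]
      by simp
  qed
  obtain M :: nat where M: "infsum (?g \<circ> glue_index) glued_indices < M"
    using reals_Archimedean2 by blast
  have "real M \<le> (\<Sum>N<M. \<Sum>j\<in>{..<?n} \<rightarrow>\<^sub>E {..<m N}. (?g \<circ> glue_index) (N, j))"
    using sum_mono[of "{..<M}" "\<lambda>_. 1", OF block] by simp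
  also have "\<dots> = sum (?g \<circ> glue_index) (Sigma {..<M} (\<lambda>N. {..<?n} \<rightarrow>\<^sub>E {..<m N}))"
    by (subst sum.Sigma) (auto simp: finite_index)
  also have "\<dots> \<le> infsum (?g \<circ> glue_index) glued_indices"
    by (rule finite_sum_le_infsum[OF s]) (auto simp: finite_index glued_indices_def)
  finally show False using M by simp
qed

end

lemma mCoh_unit_bound:
  assumes T: "T \<in> mCoh p Es F" and ne: "Es \<noteq> []"
  shows "\<exists>K\<ge>0. \<forall>m x \<phi>. cohen_unit_data m x \<phi> \<longrightarrow> cohen_sum Es T m x \<phi> \<le> K"
proof (rule ccontr)
  assume "\<not> ?thesis"
  then have "\<exists>m x \<phi>. cohen_unit_data m x \<phi> \<and> 2 ^ (N * (length Es + 1)) < cohen_sum Es T m x \<phi>" for N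
    by (meson not_le zero_le_numeral zero_le_power)
  then obtain m x \<phi> where "\<And>N. cohen_unit_data (m N) (x N) (\<phi> N)"
    "\<And>N. 2 ^ (N * (length Es + 1)) < cohen_sum Es T (m N) (x N) (\<phi> N)" by metis
  then show False by (rule glued_diverges[OF T ne])
qed

text \<open>
  Without variables, \<open>T\<close> is a constant and the index set a singleton even for \<open>m = 0\<close>; the inequality becomes
  \<open>|\<phi> y| \<le> \<parallel>y\<parallel> \<parallel>\<phi>\<parallel>\<close>.
\<close>
lemma cohen_bound_no_variables:
  assumes T: "multilinear Es F T" and nil: "Es = []"
  shows "cohen_bound p Es F T (nrm F (T (\<lambda>_. undefined)))"
proof (rule cohen_boundI[OF p Es F])
  have mem: "T z \<in> vecs F" for z by (rule multilinear_in_vecs[OF Es F T])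
  show "0 \<le> nrm F (T (\<lambda>_. undefined))" by (rule nrm_nonneg[OF F mem])
  fix m x \<phi> assume "cohen_data Es F m x \<phi>"
  then have phi: "\<forall>j\<in>{..<length Es} \<rightarrow>\<^sub>E {..<m}. \<phi> j \<in> dual F" by (simp add: cohen_data_def)
  have "norm (\<phi> (\<lambda>_. undefined) (T (\<lambda>_. undefined))) \<le> nrm F (T (\<lambda>_. undefined))
      * weak_norm (conj_exp p) ({..<length Es} \<rightarrow>\<^sub>E {..<m}) F \<phi>"
    by (rule norm_le_weak_norm[OF F conj_exp_pos[OF p Es F] finite_index phi _ mem]) (simp add: nil)
  then show "cohen_sum Es T m x \<phi> \<le> nrm F (T (\<lambda>_. undefined)) *
      ((\<Prod>i<length Es. ell_norm p (Es ! i) m (x i))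
        * weak_norm (conj_exp p) ({..<length Es} \<rightarrow>\<^sub>E {..<m}) F \<phi>)"
    by (simp add: cohen_sum_def nil restrict_def)
qed

text \<open>
  The bound for unit data extends to all data by homogeneity. Dividing by the norms plus \<open>e > 0\<close> and letting \<open>e\<close>
  tend to 0 avoids a separate treatment of vanishing norms.
\<close>
lemma mCoh_imp_cohen_bound:
  assumes T: "T \<in> mCoh p Es F"
  shows "\<exists>C. cohen_bound p Es F T C"
proof (cases "Es = []")
  case True
  then show ?thesis using cohen_bound_no_variables[OF mCoh_multilinear[OF T]] by blast
next
  case False
  let ?n = "length Es"
  have mult: "multilinear Es F T" by (rule mCoh_multilinear[OF T])
  have q: "0 < conj_exp p" by (rule conj_exp_pos[OF p Es F])
  obtain K where K: "0 \<le> K" "\<And>m x \<phi>. cohen_unit_data m x \<phi> \<Longrightarrow> cohen_sum Es T m x \<phi> \<le> K"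
    using mCoh_unit_bound[OF T False] by blast
  have "cohen_bound p Es F T K"
  proof (rule cohen_boundI[OF p Es F K(1)])
    fix m x \<phi> assume data: "cohen_data Es F m x \<phi>"
    define X where "X i = ell_norm p (Es ! i) m (x i)" for i
    define W where "W = weak_norm (conj_exp p) ({..<?n} \<rightarrow>\<^sub>E {..<m}) F \<phi>"
    have X: "0 \<le> X i" for i by (simp add: X_def ell_norm_nonneg)
    have phi: "\<forall>j\<in>{..<?n} \<rightarrow>\<^sub>E {..<m}. \<phi> j \<in> dual F" using data by (simp add: cohen_data_def)
    have mem: "x i j \<in> vecs (Es ! i)" if "i < ?n" "j < m" for i j
      using data that by (simp add: cohen_data_def)
    have W: "0 \<le> W" unfolding W_def by (rule weak_norm_nonneg[OF F q finite_index phi])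
    have le: "cohen_sum Es T m x \<phi> \<le> K * ((\<Prod>i<?n. X i + e) * (W + e))" if e: "0 < e" for e :: real
    proof -
      let ?c = "\<lambda>i. of_real (1 / (X i + e)) :: 'k" and ?d = "of_real (1 / (W + e)) :: 'k"
      let ?x = "\<lambda>i j. scl (Es ! i) (?c i) (x i j)" and ?\<phi> = "\<lambda>j y. ?d * \<phi> j y"
      have pos: "0 < X i + e" for i using e X[of i] by simp
      have posW: "0 < W + e" using e W by simp
      have nc: "norm (?c i) = 1 / (X i + e)" for i
        unfolding norm_of_real using pos[of i] by simp
      have nd: "norm ?d = 1 / (W + e)"
        unfolding norm_of_real using posW by simp
      have data': "cohen_data Es F m ?x ?\<phi>"
        unfolding cohen_data_def
        by (intro conjI allI impI ballI dual_mult[OF F] vecs_scl[OF normed_space_nth[OF Es]]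
            mem phi[rule_format])
      have "cohen_unit_data m ?x ?\<phi>"
        unfolding cohen_unit_data_def
      proof (intro conjI allI impI data')
        show "ell_norm p (Es ! i) m (?x i) \<le> 1" if i: "i < ?n" for i
          using pos[of i] e p
          by (simp add: ell_norm_scl[OF normed_space_nth[OF Es i]] mem[OF i] nc X_def[symmetric]
              del: of_real_divide)
        have "weak_norm (conj_exp p) ({..<?n} \<rightarrow>\<^sub>E {..<m}) F ?\<phi> \<le> norm ?d * W"
          unfolding W_def by (rule weak_norm_mult_le[OF F q finite_index phi])
        also have "\<dots> \<le> 1" unfolding nd using posW e by simp
        finally show "weak_norm (conj_exp p) ({..<?n} \<rightarrow>\<^sub>E {..<m}) F ?\<phi> \<le> 1" .
      qed
      then have "cohen_sum Es T m ?x ?\<phi> \<le> K" by (rule K(2))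
      moreover have "cohen_sum Es T m ?x ?\<phi> =
          (1 / ((\<Prod>i<?n. X i + e) * (W + e))) * cohen_sum Es T m x \<phi>"
        unfolding cohen_sum_def sum_distrib_left
      proof (rule sum.cong[OF refl])
        fix j assume j: "j \<in> {..<?n} \<rightarrow>\<^sub>E {..<m}"
        have "T (\<lambda>i\<in>{..<?n}. ?x i (j i)) = scl F (\<Prod>i<?n. ?c i) (T (\<lambda>i\<in>{..<?n}. x i (j i)))"
          by (rule multilinear_homogeneous[OF Es F mult]) (rule mem[OF _ index_lt[OF j]])
        moreover have "norm (\<Prod>i<?n. ?c i) = 1 / (\<Prod>i<?n. X i + e)"
          unfolding prod_norm[symmetric] nc by (simp add: prod_dividef)
        ultimately show "norm (?\<phi> j (T (\<lambda>i\<in>{..<?n}. ?x i (j i)))) =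
            (1 / ((\<Prod>i<?n. X i + e) * (W + e))) * norm (\<phi> j (T (\<lambda>i\<in>{..<?n}. x i (j i))))"
          by (simp add: dual_scl[OF F phi[rule_format, OF j]] multilinear_in_vecs[OF Es F mult]
              norm_mult nd abs_of_pos[OF posW] del: of_real_divide)
      qed
      moreover have "0 < (\<Prod>i<?n. X i + e) * (W + e)"
        using pos posW by (intro mult_pos_pos prod_pos) auto
      ultimately show ?thesis by (simp add: field_simps)
    qed
    have "((\<lambda>e. K * ((\<Prod>i<?n. X i + e) * (W + e))) \<longlongrightarrow> K * ((\<Prod>i<?n. X i + 0) * (W + 0))) (at_right 0)"
      by (intro tendsto_intros)
    then have "cohen_sum Es T m x \<phi> \<le> K * ((\<Prod>i<?n. X i + 0) * (W + 0))"
      by (rule tendsto_lowerbound) (auto simp: eventually_at_right_less intro!: eventually_at_rightI[of 0 1] le)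
    then show "cohen_sum Es T m x \<phi> \<le> K * ((\<Prod>i<?n. ell_norm p (Es ! i) m (x i))
        * weak_norm (conj_exp p) ({..<?n} \<rightarrow>\<^sub>E {..<m}) F \<phi>)"
      by (simp add: X_def W_def)
  qed
  then show ?thesis ..
qed

text \<open>
  Any finite set of multi-indices lies in a cube \<open>{..<m}\<^sup>n\<close>, where the inequality bounds the sum by the full
  \<open>\<ell>\<^sub>p\<close> norms and the full weak norm.
\<close>
lemma cohen_bound_imp_mCoh:
  assumes nf: "norming F" and T: "multilinear Es F T" "cohen_bound p Es F T C"
  shows "T \<in> mCoh p Es F"
proof -
  let ?n = "length Es" and ?q = "conj_exp p"
  let ?I = "{..<?n} \<rightarrow>\<^sub>E (UNIV :: nat set)"
  have C: "0 \<le> C" using T(2) by (simp add: cohen_bound_def)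
  have q: "0 < ?q" by (rule conj_exp_pos[OF p Es F])
  have "T \<in> cont_multilinear Es F"
    by (rule bounded_multilinear_continuous[OF Es F T(1)])
       (rule nrm_le_of_cohen_bound[OF p Es F nf T])
  moreover have "(\<lambda>j. norm (\<phi> j (T (\<lambda>i\<in>{..<?n}. x i (j i))))) summable_on ?I"
    if x: "\<And>i. i < ?n \<Longrightarrow> x i \<in> ell p (Es ! i)" and phi: "\<phi> \<in> weak_ell ?q ?I F" for x \<phi>
  proof (rule nonneg_bdd_above_summable_on)
    define X where "X i = (\<Sum>j. nrm (Es ! i) (x i j) powr p) powr (1 / p)" for i
    define W where "W = weak_norm ?q ?I F \<phi>"
    have finite_bound: "cohen_sum Es T m x \<phi> \<le> C * ((\<Prod>i<?n. X i) * W)" for m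
    proof -
      let ?J = "{..<?n} \<rightarrow>\<^sub>E {..<m}"
      have sub: "?J \<subseteq> ?I" by (auto intro: PiE_mono)
      have data: "cohen_data Es F m x \<phi>"
        using x phi sub by (auto simp: cohen_data_def ell_def weak_ell_def)
      have "ell_norm p (Es ! i) m (x i) \<le> X i" if "i < ?n" for i
        unfolding ell_norm_def X_def
        using x[OF that] p by (intro powr_mono2 sum_le_suminf) (auto simp: ell_def intro: sum_nonneg)
      moreover have "weak_norm ?q ?J F \<phi> \<le> W"
      proof (rule weak_norm_least[OF F q finite_index])
        fix y assume y: "y \<in> unit_ball F"
        have "(\<Sum>j\<in>?J. norm (\<phi> j y) powr ?q) \<le> (\<Sum>\<^sub>\<infinity>j\<in>?I. norm (\<phi> j y) powr ?q)"
          using phi y by (intro finite_sum_le_infsum finite_index sub) (auto simp: weak_ell_def)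
        then have "(\<Sum>j\<in>?J. norm (\<phi> j y) powr ?q) powr (1 / ?q)
            \<le> (\<Sum>\<^sub>\<infinity>j\<in>?I. norm (\<phi> j y) powr ?q) powr (1 / ?q)"
          using q by (intro powr_mono2) (auto intro: sum_nonneg)
        also have "\<dots> \<le> W"
          unfolding W_def weak_norm_def using phi y by (intro cSUP_upper) (auto simp: weak_ell_def)
        finally show "(\<Sum>j\<in>?J. norm (\<phi> j y) powr ?q) powr (1 / ?q) \<le> W" .
      qed
      moreover have "0 \<le> weak_norm ?q ?J F \<phi>"
        using data by (intro weak_norm_nonneg[OF F q finite_index]) (simp add: cohen_data_def)
      ultimately have "(\<Prod>i<?n. ell_norm p (Es ! i) m (x i)) * weak_norm ?q ?J F \<phi> \<le> (\<Prod>i<?n. X i) * W"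
        by (intro mult_mono prod_mono prod_nonneg) (auto simp: ell_norm_nonneg X_def)
      then show ?thesis
        using cohen_boundD[OF p Es F T(2) data] C mult_left_mono order_trans by blast
    qed
    have "sum (\<lambda>j. norm (\<phi> j (T (\<lambda>i\<in>{..<?n}. x i (j i))))) Y \<le> C * ((\<Prod>i<?n. X i) * W)"
      if Y: "finite Y" "Y \<subseteq> ?I" for Y
    proof -
      obtain m where "Y \<subseteq> {..<?n} \<rightarrow>\<^sub>E {..<m}" using finite_subset_index[OF Y] by blast
      then show ?thesis
        by (intro order_trans[OF sum_mono2 finite_bound[of m, unfolded cohen_sum_def]]) (auto simp: finite_index)
    qed
    then show "bdd_above (sum (\<lambda>j. norm (\<phi> j (T (\<lambda>i\<in>{..<?n}. x i (j i))))) ` {Y. Y \<subseteq> ?I \<and> finite Y})"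
      by (intro bdd_aboveI2) auto
  qed auto
  ultimately show ?thesis
    by (auto simp: mCoh_def cohen_ell_def multilinear_in_vecs[OF Es F T(1)])
qed

end


section \<open>The normed space of multiple Cohen strongly summing operators\<close>

context
  fixes p :: real and Es :: "('k::real_normed_field, 'u::ab_group_add) nspace list"
    and F :: "('k, 'v::ab_group_add) nspace"
  assumes p: "1 < p" and Es: "\<forall>E\<in>set Es. normed_space E"
    and F: "normed_space F"
begin

lemma mCoh_norm_le: "cohen_bound p Es F T C \<Longrightarrow> mCoh_norm p Es F T \<le> C"
  unfolding mCoh_norm_eq by (rule cInf_lower) (auto simp: cohen_bound_def intro!: bdd_belowI[of _ 0])

lemma mCoh_norm_nonneg:
  assumes "T \<in> mCoh p Es F"
  shows "0 \<le> mCoh_norm p Es F T"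
  unfolding mCoh_norm_eq using mCoh_imp_cohen_bound[OF p Es F assms]
  by (intro cInf_greatest) (auto simp: cohen_bound_def)

text \<open>
  The infimum in \<open>mCoh_norm\<close> is attained, since the inequality is closed in \<open>C\<close>.
\<close>
lemma mCoh_norm_bound:
  assumes T: "T \<in> mCoh p Es F"
  shows "cohen_bound p Es F T (mCoh_norm p Es F T)"
proof (rule cohen_boundI[OF p Es F mCoh_norm_nonneg[OF T]])
  fix m x \<phi> assume data: "cohen_data Es F m x \<phi>"
  define R where "R = (\<Prod>i<length Es. ell_norm p (Es ! i) m (x i))
    * weak_norm (conj_exp p) ({..<length Es} \<rightarrow>\<^sub>E {..<m}) F \<phi>"
  have R: "0 \<le> R" unfolding R_def by (rule cohen_rhs_nonneg[OF p Es F data])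
  have le: "cohen_sum Es T m x \<phi> \<le> C * R" if "cohen_bound p Es F T C" for C
    unfolding R_def by (rule cohen_boundD[OF p Es F that data])
  obtain C where C: "cohen_bound p Es F T C" using mCoh_imp_cohen_bound[OF p Es F T] by blast
  have "cohen_sum Es T m x \<phi> \<le> mCoh_norm p Es F T * R"
  proof (cases "R = 0")
    case True then show ?thesis using le[OF C] by simp
  next
    case False
    then have pos: "0 < R" using R by simp
    have "cohen_sum Es T m x \<phi> / R \<le> mCoh_norm p Es F T"
      unfolding mCoh_norm_eq using C le pos by (intro cInf_greatest) (auto simp: field_simps)
    then show ?thesis using pos by (simp add: field_simps)
  qed
  then show "cohen_sum Es T m x \<phi> \<le> mCoh_norm p Es F T * ((\<Prod>i<length Es. ell_norm p (Es ! i) m (x i))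
      * weak_norm (conj_exp p) ({..<length Es} \<rightarrow>\<^sub>E {..<m}) F \<phi>)" by (simp add: R_def)
qed

context
  assumes nf: "norming F"
begin

lemma nrm_le_mCoh_norm:
  "T \<in> mCoh p Es F \<Longrightarrow> x \<in> tuples Es \<Longrightarrow>
    nrm F (T x) \<le> mCoh_norm p Es F T * (\<Prod>i<length Es. nrm (Es ! i) (x i))"
  using nrm_le_of_cohen_bound[OF p Es F nf] mCoh_multilinear[OF p Es F] mCoh_norm_bound by blast

lemma mCoh_zero: "0 \<in> mCoh p Es F"
  by (rule cohen_bound_imp_mCoh[OF p Es F nf multilinear_zero[OF Es F] cohen_bound_zero[OF p Es F]])

lemma
  assumes S: "S \<in> mCoh p Es F" and T: "T \<in> mCoh p Es F"
  shows mCoh_add: "S + T \<in> mCoh p Es F"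
    and mCoh_norm_add: "mCoh_norm p Es F (S + T) \<le> mCoh_norm p Es F S + mCoh_norm p Es F T"
proof -
  note ST = mCoh_multilinear[OF p Es F S] mCoh_multilinear[OF p Es F T]
  note bound = cohen_bound_add[OF p Es F ST(1) mCoh_norm_bound[OF S] ST(2) mCoh_norm_bound[OF T]]
  show "S + T \<in> mCoh p Es F"
    by (rule cohen_bound_imp_mCoh[OF p Es F nf multilinear_add[OF Es F ST] bound])
  show "mCoh_norm p Es F (S + T) \<le> mCoh_norm p Es F S + mCoh_norm p Es F T"
    by (rule mCoh_norm_le[OF bound])
qed

lemma
  assumes T: "T \<in> mCoh p Es F"
  shows mCoh_scl: "(\<lambda>x. scl F c (T x)) \<in> mCoh p Es F"
    and mCoh_norm_scl_le: "mCoh_norm p Es F (\<lambda>x. scl F c (T x)) \<le> norm c * mCoh_norm p Es F T"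
proof -
  note mult = mCoh_multilinear[OF p Es F T]
  note bound = cohen_bound_scl[OF p Es F mult mCoh_norm_bound[OF T], of c]
  show "(\<lambda>x. scl F c (T x)) \<in> mCoh p Es F"
    by (rule cohen_bound_imp_mCoh[OF p Es F nf multilinear_scl[OF Es F mult] bound])
  show "mCoh_norm p Es F (\<lambda>x. scl F c (T x)) \<le> norm c * mCoh_norm p Es F T"
    by (rule mCoh_norm_le[OF bound])
qed

lemma mCoh_in_vecs: "T \<in> mCoh p Es F \<Longrightarrow> T x \<in> vecs F"
  by (rule multilinear_in_vecs[OF Es F mCoh_multilinear[OF p Es F]])

lemma mCoh_uminus: "T \<in> mCoh p Es F \<Longrightarrow> - T \<in> mCoh p Es F"
  using mCoh_scl[of T "-1"] by (simp add: normed_space_uminus[OF F] mCoh_in_vecs fun_Compl_def)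

lemma mCoh_diff: "S \<in> mCoh p Es F \<Longrightarrow> T \<in> mCoh p Es F \<Longrightarrow> S - T \<in> mCoh p Es F"
  using mCoh_add[of S "- T"] mCoh_uminus by simp

lemma mCoh_norm_zero: "mCoh_norm p Es F 0 = 0"
  using mCoh_norm_le[OF cohen_bound_zero[OF p Es F]] mCoh_norm_nonneg[OF mCoh_zero] by simp

lemma mCoh_norm_scl:
  assumes T: "T \<in> mCoh p Es F"
  shows "mCoh_norm p Es F (\<lambda>x. scl F c (T x)) = norm c * mCoh_norm p Es F T"
proof (cases "c = 0")
  case True
  then have "(\<lambda>x. scl F c (T x)) = 0" by (simp add: scl_zero_left[OF F mCoh_in_vecs[OF T]] zero_fun_def)
  then show ?thesis using True by (simp only: mCoh_norm_zero) simp
next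
  case False
  have "(\<lambda>x. scl F (1/c) (scl F c (T x))) = T"
    using False by (simp add: scl_scl[OF F mCoh_in_vecs[OF T]] scl_one[OF F mCoh_in_vecs[OF T]])
  then have "mCoh_norm p Es F T \<le> norm (1/c) * mCoh_norm p Es F (\<lambda>x. scl F c (T x))"
    using mCoh_norm_scl_le[OF mCoh_scl[OF T], of "1/c" c] by simp
  then have "norm c * mCoh_norm p Es F T \<le> mCoh_norm p Es F (\<lambda>x. scl F c (T x))"
    using False by (simp add: norm_divide field_simps)
  then show ?thesis using mCoh_norm_scl_le[OF T, of c] by simp
qed

text \<open>
  Definiteness is where the dual has to separate the points of \<open>F\<close>.
\<close>
lemma mCoh_norm_eq_0:
  assumes T: "T \<in> mCoh p Es F"
  shows "mCoh_norm p Es F T = 0 \<longleftrightarrow> T = 0"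
proof
  assume 0: "mCoh_norm p Es F T = 0"
  have "T x = 0" for x
  proof (cases "x \<in> tuples Es")
    case True
    then show ?thesis
      using nrm_le_mCoh_norm[OF T True] nrm_nonneg[OF F mCoh_in_vecs[OF T]]
        nrm_eq_0[OF F mCoh_in_vecs[OF T]] 0 by (metis mult_zero_left order_antisym)
  qed (rule multilinear_outside[OF Es F mCoh_multilinear[OF p Es F T]])
  then show "T = 0" by (simp add: fun_eq_iff)
qed (simp add: mCoh_norm_zero)

lemma normed_space_mCoh: "normed_space (fun_space F (mCoh p Es F) (mCoh_norm p Es F))"
  by (auto simp: normed_space_def fun_space_def mCoh_zero mCoh_add mCoh_scl mCoh_norm_nonneg
      mCoh_norm_eq_0 mCoh_norm_scl mCoh_norm_add fun_eq_iff mCoh_in_vecs scl_add_right[OF F]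
      scl_add_left[OF F] scl_scl[OF F] scl_one[OF F])

end

end


section \<open>Completeness\<close>

context
  fixes F :: "('k::real_normed_field, 'v::ab_group_add) nspace"
  assumes F: "normed_space F"
begin

lemma norm_limit_unique:
  assumes s: "\<And>k. s k \<in> vecs F" and y: "y \<in> vecs F" and z: "z \<in> vecs F"
    and "(\<lambda>k. nrm F (s k - y)) \<longlonglongrightarrow> 0" "(\<lambda>k. nrm F (s k - z)) \<longlonglongrightarrow> 0"
  shows "y = z"
proof -
  have "(\<lambda>k. nrm F (s k - y) + nrm F (s k - z)) \<longlonglongrightarrow> 0 + 0" by (intro tendsto_add assms)
  moreover have "nrm F (y - z) \<le> nrm F (s k - y) + nrm F (s k - z)" for k
    using nrm_triangle_diff[OF F y s z, of k] nrm_diff_commute[OF F y s, of k] by simp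
  ultimately have "nrm F (y - z) \<le> 0 + 0" by (intro LIMSEQ_le_const) auto
  then show ?thesis
    using nrm_nonneg[OF F vecs_diff[OF F y z]] nrm_eq_0[OF F vecs_diff[OF F y z]] by simp
qed

lemma norm_limit_add:
  assumes s: "\<And>k. s k \<in> vecs F" "y \<in> vecs F" and t: "\<And>k. t k \<in> vecs F" "z \<in> vecs F"
    and "(\<lambda>k. nrm F (s k - y)) \<longlonglongrightarrow> 0" "(\<lambda>k. nrm F (t k - z)) \<longlonglongrightarrow> 0"
  shows "(\<lambda>k. nrm F ((s k + t k) - (y + z))) \<longlonglongrightarrow> 0"
proof (rule Lim_null_comparison)
  show "(\<lambda>k. nrm F (s k - y) + nrm F (t k - z)) \<longlonglongrightarrow> 0"
    using tendsto_add[OF assms(5,6)] by simp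
  have "(s k + t k) - (y + z) = (s k - y) + (t k - z)" for k by simp
  then show "\<forall>\<^sub>F k in sequentially. norm (nrm F ((s k + t k) - (y + z))) \<le> nrm F (s k - y) + nrm F (t k - z)"
    using nrm_add_le[OF F vecs_diff[OF F s] vecs_diff[OF F t]]
      nrm_nonneg[OF F vecs_add[OF F vecs_diff[OF F s] vecs_diff[OF F t]]]
    by (intro always_eventually allI) (simp only: real_norm_def abs_of_nonneg)
qed

lemma norm_limit_scl:
  assumes s: "\<And>k. s k \<in> vecs F" "y \<in> vecs F" and "(\<lambda>k. nrm F (s k - y)) \<longlonglongrightarrow> 0"
  shows "(\<lambda>k. nrm F (scl F c (s k) - scl F c y)) \<longlonglongrightarrow> 0"
  using tendsto_mult_right_zero[OF assms(3), of "norm c"]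
  by (simp add: scl_diff_right[OF F s, symmetric] nrm_scl[OF F vecs_diff[OF F s]])

lemma mcomplete_convergent:
  assumes compl: "Metric_space.mcomplete (vecs F) (ndist F)" and s: "\<And>k. s k \<in> vecs F"
    and cauchy: "\<And>e. 0 < e \<Longrightarrow> \<exists>K. \<forall>k\<ge>K. \<forall>l\<ge>K. nrm F (s k - s l) < e"
  shows "\<exists>y\<in>vecs F. (\<lambda>k. nrm F (s k - y)) \<longlonglongrightarrow> 0"
proof -
  interpret Metric_space "vecs F" "ndist F" by (rule Metric_space_ndist[OF F])
  have "MCauchy s"
    unfolding MCauchy_def using s cauchy by (auto simp: ndist_def)
  then obtain y where "limitin (norm_topology F) s y sequentially"
    using compl by (auto simp: mcomplete_def norm_topology_def)
  then show ?thesis by (auto simp: limitin_norm_topology[OF F] ndist_def s)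
qed

lemma mcompleteI:
  assumes "\<And>s. (\<And>k. s k \<in> vecs F) \<Longrightarrow>
      (\<And>e. 0 < e \<Longrightarrow> \<exists>K. \<forall>k\<ge>K. \<forall>l\<ge>K. nrm F (s k - s l) < e) \<Longrightarrow>
      \<exists>y\<in>vecs F. (\<lambda>k. nrm F (s k - y)) \<longlonglongrightarrow> 0"
  shows "Metric_space.mcomplete (vecs F) (ndist F)"
proof -
  interpret Metric_space "vecs F" "ndist F" by (rule Metric_space_ndist[OF F])
  show ?thesis
    unfolding mcomplete_def
  proof (intro allI impI)
    fix s assume "MCauchy s"
    then have s: "\<And>k. s k \<in> vecs F"
      and cauchy: "\<And>e. 0 < e \<Longrightarrow> \<exists>K. \<forall>k l. K \<le> k \<longrightarrow> K \<le> l \<longrightarrow> ndist F (s k) (s l) < e"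
      by (auto simp: MCauchy_def)
    have "\<exists>K. \<forall>k\<ge>K. \<forall>l\<ge>K. nrm F (s k - s l) < e" if "0 < e" for e
      using cauchy[OF that] by (auto simp: ndist_def s)
    then obtain y where "y \<in> vecs F" "(\<lambda>k. nrm F (s k - y)) \<longlonglongrightarrow> 0"
      using assms[of s] s by blast
    then have "limitin (norm_topology F) s y sequentially"
      by (simp add: limitin_norm_topology[OF F] ndist_def s)
    then show "\<exists>y. limitin mtopology s y sequentially" by (auto simp: norm_topology_def)
  qed
qed

end

context
  fixes p :: real and Es :: "('k::real_normed_field, 'u::ab_group_add) nspace list"
    and F :: "('k, 'v::ab_group_add) nspace"
  assumes p: "1 < p" and Es: "\<forall>E\<in>set Es. normed_space E"
    and F: "normed_space F" and nf: "norming F"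
begin

lemma multilinear_limit:
  assumes A: "\<And>k. multilinear Es F (A k)" and B: "\<And>x. B x \<in> vecs F"
    and lim: "\<And>x. (\<lambda>k. nrm F (A k x - B x)) \<longlonglongrightarrow> 0"
  shows "multilinear Es F B"
proof (rule multilinearI[OF Es F])
  note mem = multilinear_in_vecs[OF Es F A]
  show "B x = 0" if "x \<notin> tuples Es" for x
  proof (rule norm_limit_unique[OF F mem B vecs_zero[OF F] lim])
    show "(\<lambda>k. nrm F (A k x - 0)) \<longlonglongrightarrow> 0"
      by (simp add: multilinear_outside[OF Es F A that] nrm_zero[OF F])
  qed
  fix x i u assume x: "x \<in> tuples Es" and i: "i < length Es" and u: "u \<in> vecs (Es ! i)"
  show "B (x(i := u + v)) = B (x(i := u)) + B (x(i := v))" if v: "v \<in> vecs (Es ! i)" for v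
    by (rule norm_limit_unique[OF F mem B vecs_add[OF F B B] lim])
       (simp add: multilinear_upd_add[OF Es F A x i u v] norm_limit_add[OF F mem B mem B lim lim])
  show "B (x(i := scl (Es ! i) c u)) = scl F c (B (x(i := u)))" for c
    by (rule norm_limit_unique[OF F mem B vecs_scl[OF F B] lim])
       (simp add: multilinear_upd_scl[OF Es F A x i u] norm_limit_scl[OF F mem B lim])
qed (rule B)

text \<open>
  The norm of \<open>mCoh\<close> dominates each \<open>\<parallel>T x\<parallel>\<close>, which yields the pointwise limit \<open>B\<close>. Letting \<open>l\<close> tend to infinity in
  the inequality for \<open>A k - A l\<close>, a finite sum of continuous expressions, shows that \<open>A k - B\<close> satisfies it with
  the same constant.
\<close>
lemma mCoh_Cauchy_limit:
  assumes compl: "Metric_space.mcomplete (vecs F) (ndist F)"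
    and A: "\<And>k. A k \<in> mCoh p Es F"
    and cauchy: "\<And>e. 0 < e \<Longrightarrow> \<exists>K. \<forall>k\<ge>K. \<forall>l\<ge>K. mCoh_norm p Es F (A k - A l) < e"
  shows "\<exists>B\<in>mCoh p Es F. (\<lambda>k. mCoh_norm p Es F (A k - B)) \<longlonglongrightarrow> 0 \<and>
    (\<forall>x. (\<lambda>k. nrm F (A k x - B x)) \<longlonglongrightarrow> 0)"
proof -
  have mult: "multilinear Es F (A k)" for k by (rule mCoh_multilinear[OF p Es F A])
  have mem: "A k x \<in> vecs F" for k x by (rule multilinear_in_vecs[OF Es F mult])
  have "\<exists>y\<in>vecs F. (\<lambda>k. nrm F (A k x - y)) \<longlonglongrightarrow> 0" for x
  proof (cases "x \<in> tuples Es")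
    case False
    then show ?thesis
      by (intro bexI[of _ 0]) (simp_all add: vecs_zero[OF F] nrm_zero[OF F] multilinear_outside[OF Es F mult])
  next
    case True
    define R where "R = (\<Prod>i<length Es. nrm (Es ! i) (x i))"
    have R: "0 \<le> R"
      unfolding R_def by (intro prod_nonneg) (auto intro: nrm_nonneg[OF normed_space_nth[OF Es]] tuples_nth[OF True])
    show ?thesis
    proof (rule mcomplete_convergent[OF F compl mem])
      fix e :: real assume e: "0 < e"
      then obtain K where K: "\<forall>k\<ge>K. \<forall>l\<ge>K. mCoh_norm p Es F (A k - A l) < e / (R + 1)"
        using cauchy[of "e / (R + 1)"] R by auto
      have "nrm F (A k x - A l x) < e" if kl: "K \<le> k" "K \<le> l" for k l
      proof -
        have "nrm F (A k x - A l x) \<le> mCoh_norm p Es F (A k - A l) * R"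
          using nrm_le_mCoh_norm[OF p Es F nf mCoh_diff[OF p Es F nf A A] True] by (simp add: R_def)
        also have "\<dots> \<le> e / (R + 1) * R"
          using K kl R by (intro mult_right_mono) (auto intro: less_imp_le)
        also have "\<dots> < e" using e R by (simp add: field_simps)
        finally show ?thesis .
      qed
      then show "\<exists>K. \<forall>k\<ge>K. \<forall>l\<ge>K. nrm F (A k x - A l x) < e" by blast
    qed
  qed
  then obtain B where B: "\<And>x. B x \<in> vecs F" and lim: "\<And>x. (\<lambda>k. nrm F (A k x - B x)) \<longlonglongrightarrow> 0"
    by metis
  have multB: "multilinear Es F B" by (rule multilinear_limit[OF mult B lim])
  have bound: "\<exists>K. \<forall>k\<ge>K. cohen_bound p Es F (A k - B) e" if e: "0 < e" for e
  proof -
    obtain K where K: "\<forall>k\<ge>K. \<forall>l\<ge>K. mCoh_norm p Es F (A k - A l) < e" using cauchy[OF e] by blast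
    have "cohen_bound p Es F (A k - B) e" if k: "K \<le> k" for k
    proof (rule cohen_boundI[OF p Es F less_imp_le[OF e]])
      fix m x \<phi> assume data: "cohen_data Es F m x \<phi>"
      show "cohen_sum Es (A k - B) m x \<phi> \<le> e * ((\<Prod>i<length Es. ell_norm p (Es ! i) m (x i))
        * weak_norm (conj_exp p) ({..<length Es} \<rightarrow>\<^sub>E {..<m}) F \<phi>)" (is "_ \<le> e * ?R")
      proof (rule LIMSEQ_le_const2)
        show "\<exists>N. \<forall>l\<ge>N. cohen_sum Es (A k - A l) m x \<phi> \<le> e * ?R"
        proof (intro exI allI impI)
          fix l assume l: "K \<le> l"
          have "cohen_bound p Es F (A k - A l) e"
            using K k l by (intro cohen_bound_mono[OF p Es F mCoh_norm_bound[OF p Es F]] less_imp_le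
                mCoh_diff[OF p Es F nf A A]) auto
          then show "cohen_sum Es (A k - A l) m x \<phi> \<le> e * ?R" by (rule cohen_boundD[OF p Es F _ data])
        qed
        show "(\<lambda>l. cohen_sum Es (A k - A l) m x \<phi>) \<longlonglongrightarrow> cohen_sum Es (A k - B) m x \<phi>"
          unfolding cohen_sum_def fun_diff_def
        proof (intro tendsto_sum tendsto_norm)
          fix j assume j: "j \<in> {..<length Es} \<rightarrow>\<^sub>E {..<m}"
          note phi = cohen_data_dual[OF p Es F data j]
          let ?t = "\<lambda>i\<in>{..<length Es}. x i (j i)"
          have "(\<lambda>l. \<phi> j (A k ?t) - \<phi> j (A l ?t)) \<longlonglongrightarrow> \<phi> j (A k ?t) - \<phi> j (B ?t)"
            by (intro tendsto_diff tendsto_const dual_tendsto[OF F phi mem B lim])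
          then show "(\<lambda>l. \<phi> j (A k ?t - A l ?t)) \<longlonglongrightarrow> \<phi> j (A k ?t - B ?t)"
            by (simp add: dual_diff[OF F phi mem mem] dual_diff[OF F phi mem B])
        qed
      qed
    qed
    then show ?thesis by blast
  qed
  obtain k where "cohen_bound p Es F (A k - B) 1" using bound[of 1] by auto
  then have "A k - (A k - B) \<in> mCoh p Es F"
    by (intro mCoh_diff[OF p Es F nf A] cohen_bound_imp_mCoh[OF p Es F nf] multilinear_diff[OF Es F mult multB])
  then have BM: "B \<in> mCoh p Es F" by simp
  have "(\<lambda>k. mCoh_norm p Es F (A k - B)) \<longlonglongrightarrow> 0"
  proof (rule LIMSEQ_I)
    fix r :: real assume r: "0 < r"
    then obtain K where "\<forall>k\<ge>K. cohen_bound p Es F (A k - B) (r / 2)" using bound[of "r / 2"] by auto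
    then have "mCoh_norm p Es F (A k - B) \<le> r / 2" if "K \<le> k" for k
      using mCoh_norm_le[OF p Es F] that by blast
    then have "norm (mCoh_norm p Es F (A k - B) - 0) < r" if "K \<le> k" for k
      using that r mCoh_norm_nonneg[OF p Es F mCoh_diff[OF p Es F nf A BM], of k] by fastforce
    then show "\<exists>K. \<forall>k\<ge>K. norm (mCoh_norm p Es F (A k - B) - 0) < r" by blast
  qed
  then show ?thesis using BM lim by blast
qed

end


section \<open>Fixing the last variable\<close>

definition fix_last ::
  "('k, 'u) nspace list \<Rightarrow> 'u \<Rightarrow> ((nat \<Rightarrow> 'u) \<Rightarrow> 'v::zero) \<Rightarrow> (nat \<Rightarrow> 'u) \<Rightarrow> 'v" where
  "fix_last Es a A = (\<lambda>x. if x \<in> tuples Es then A (x(length Es := a)) else 0)"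

lemma tuples_append: "x \<in> tuples Es \<Longrightarrow> a \<in> vecs E \<Longrightarrow> x(length Es := a) \<in> tuples (Es @ [E])"
  by (auto simp: tuples_def PiE_def extensional_def Pi_def nth_append less_Suc_eq)

context
  fixes p :: real and Es :: "('k::real_normed_field, 'u::ab_group_add) nspace list"
    and E :: "('k, 'u) nspace" and F :: "('k, 'v::ab_group_add) nspace" and a :: 'u
  assumes p: "1 < p" and Es: "\<forall>E\<in>set Es. normed_space E" and E: "normed_space E"
    and F: "normed_space F" and a: "a \<in> vecs E"
begin

lemma normed_spaces_append: "\<forall>G\<in>set (Es @ [E]). normed_space G"
  using Es E by simp

lemma multilinear_fix_last:
  assumes A: "multilinear (Es @ [E]) F A"
  shows "multilinear Es F (fix_last Es a A)"
proof (rule multilinearI[OF Es F])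
  note Es' = normed_spaces_append
  show "fix_last Es a A x \<in> vecs F" for x
    by (simp add: fix_last_def multilinear_in_vecs[OF Es' F A] vecs_zero[OF F])
  show "fix_last Es a A x = 0" if "x \<notin> tuples Es" for x using that by (simp add: fix_last_def)
  fix x i u assume x: "x \<in> tuples Es" and i: "i < length Es" and u: "u \<in> vecs (Es ! i)"
  have eq: "fix_last Es a A (x(i := w)) = A ((x(length Es := a))(i := w))" if "w \<in> vecs (Es ! i)" for w
    using tuples_upd[OF x i that] i by (simp add: fix_last_def fun_upd_twist)
  have nth: "(Es @ [E]) ! i = Es ! i" using i by (simp add: nth_append)
  note E_i = normed_space_nth[OF Es i]
  show "fix_last Es a A (x(i := u + v)) = fix_last Es a A (x(i := u)) + fix_last Es a A (x(i := v))"
    if v: "v \<in> vecs (Es ! i)" for v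
    using multilinear_upd_add[OF Es' F A tuples_append[OF x a], of i u v] i u v
    by (simp add: eq vecs_add[OF E_i] nth)
  show "fix_last Es a A (x(i := scl (Es ! i) c u)) = scl F c (fix_last Es a A (x(i := u)))" for c
    using multilinear_upd_scl[OF Es' F A tuples_append[OF x a], of i u c] i u
    by (simp add: eq vecs_scl[OF E_i] nth)
qed

text \<open>
  Data for the operator with last variable \<open>a\<close> become data for \<open>A\<close>: the last sequence is \<open>(a, 0, 0, \<dots>)\<close>, and the
  functionals are extended by 0 to all new multi-indices. The weak norm does not increase
  and the last sequence contributes the factor \<open>\<parallel>a\<parallel>\<close>. The length is raised from \<open>m\<close> to \<open>Suc m\<close>, padding the other
  sequences with zeros, so that the entry \<open>a\<close> is present even for \<open>m = 0\<close>.
\<close>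
lemma cohen_bound_fix_last:
  assumes A: "multilinear (Es @ [E]) F A" and bound: "cohen_bound p (Es @ [E]) F A C"
  shows "cohen_bound p Es F (fix_last Es a A) (C * nrm E a)"
proof (rule cohen_boundI[OF p Es F])
  note Es' = normed_spaces_append
  let ?n = "length Es" and ?q = "conj_exp p"
  have q: "0 < ?q" by (rule conj_exp_pos[OF p Es F])
  have C: "0 \<le> C" using bound by (simp add: cohen_bound_def)
  then show "0 \<le> C * nrm E a" using nrm_nonneg[OF E a] by simp
  fix m x \<phi> assume data: "cohen_data Es F m x \<phi>"
  define I where "I = {..<?n} \<rightarrow>\<^sub>E {..<m}"
  define J where "J = {..<Suc ?n} \<rightarrow>\<^sub>E {..<Suc m}"
  \<comment> \<open>The multi-indices whose last entry is 0 are a copy of the old ones.\<close>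
  define h where "h j = j(?n := 0 :: nat)" for j :: "nat \<Rightarrow> nat"
  define x' where "x' i k = (if i = ?n then (if k = 0 then a else 0) else if k < m then x i k else 0)" for i k
  define \<phi>' where "\<phi>' k = (if k \<in> h ` I then \<phi> (restrict k {..<?n}) else (\<lambda>_. 0))" for k
  have phi: "\<phi> j \<in> dual F" if "j \<in> I" for j
    using data that by (simp add: cohen_data_def I_def)
  have res: "restrict (h j) {..<?n} = j" if "j \<in> I" for j
    using that by (auto simp: I_def h_def PiE_def extensional_def fun_eq_iff)
  have inj: "inj_on h I" by (rule inj_on_inverseI[where g="\<lambda>k. restrict k {..<?n}"]) (rule res)
  have sub: "h ` I \<subseteq> J"
    by (auto simp: I_def J_def h_def PiE_def extensional_def Pi_def less_Suc_eq)
  have phi': "\<phi>' (h j) = \<phi> j" if "j \<in> I" for j using that res by (simp add: \<phi>'_def)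
  have reindex: "(\<Sum>k\<in>J. g k) = (\<Sum>j\<in>I. g (h j))" if "\<And>k. k \<notin> h ` I \<Longrightarrow> g k = 0"
    for g :: "(nat \<Rightarrow> nat) \<Rightarrow> real"
  proof -
    have "(\<Sum>k\<in>J. g k) = (\<Sum>k\<in>h ` I. g k)"
      by (rule sum.mono_neutral_right) (use sub that in \<open>auto simp: J_def finite_index\<close>)
    then show ?thesis by (simp add: sum.reindex[OF inj])
  qed
  have xm: "x i j \<in> vecs (Es ! i)" if "i < ?n" "j < m" for i j
    using data that by (simp add: cohen_data_def)
  have data': "cohen_data (Es @ [E]) F (Suc m) x' \<phi>'"
    unfolding cohen_data_def
  proof (intro conjI allI impI ballI)
    show "x' i j \<in> vecs ((Es @ [E]) ! i)" if "i < length (Es @ [E])" for i j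
      using that a xm by (auto simp: x'_def nth_append vecs_zero[OF E] vecs_zero[OF normed_space_nth[OF Es]])
    show "\<phi>' k \<in> dual F" for k
      using phi res by (auto simp: \<phi>'_def dual_zero_functional[OF F])
  qed
  have "cohen_sum (Es @ [E]) A (Suc m) x' \<phi>' = (\<Sum>k\<in>J. norm (\<phi>' k (A (\<lambda>i\<in>{..<Suc ?n}. x' i (k i)))))"
    by (simp add: cohen_sum_def J_def)
  also have "\<dots> = (\<Sum>j\<in>I. norm (\<phi>' (h j) (A (\<lambda>i\<in>{..<Suc ?n}. x' i (h j i)))))"
    by (rule reindex) (simp add: \<phi>'_def)
  also have "\<dots> = cohen_sum Es (fix_last Es a A) m x \<phi>"
    unfolding cohen_sum_def I_def[symmetric]
  proof (rule sum.cong[OF refl])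
    fix j assume j: "j \<in> I"
    then have lt: "\<And>i. i < ?n \<Longrightarrow> j i < m" by (auto simp: I_def)
    have "(\<lambda>i\<in>{..<Suc ?n}. x' i (h j i)) = (\<lambda>i\<in>{..<?n}. x i (j i))(?n := a)"
      using lt by (auto simp: fun_eq_iff x'_def h_def)
    moreover have "(\<lambda>i\<in>{..<?n}. x i (j i)) \<in> tuples Es"
      using cohen_data_tuple[OF p Es F data] j by (simp add: I_def)
    ultimately show "norm (\<phi>' (h j) (A (\<lambda>i\<in>{..<Suc ?n}. x' i (h j i)))) =
        norm (\<phi> j (fix_last Es a A (\<lambda>i\<in>{..<?n}. x i (j i))))"
      by (simp add: phi'[OF j] fix_last_def)
  qed
  finally have sum_eq: "cohen_sum (Es @ [E]) A (Suc m) x' \<phi>' = cohen_sum Es (fix_last Es a A) m x \<phi>" .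
  have ell: "ell_norm p ((Es @ [E]) ! i) (Suc m) (x' i) = ell_norm p (Es ! i) m (x i)" if "i < ?n" for i
    using that nrm_zero[OF normed_space_nth[OF Es that]] by (simp add: ell_norm_def x'_def nth_append)
  have "ell_norm p E (Suc m) (x' ?n) = nrm E a"
  proof -
    have "(\<Sum>j<Suc m. nrm E (x' ?n j) powr p) = nrm E a powr p"
      unfolding sum.lessThan_Suc_shift by (simp add: x'_def nrm_zero[OF E])
    then show ?thesis using p nrm_nonneg[OF E a] by (simp add: ell_norm_def powr_powr)
  qed
  then have prod_eq: "(\<Prod>i<length (Es @ [E]). ell_norm p ((Es @ [E]) ! i) (Suc m) (x' i)) =
      (\<Prod>i<?n. ell_norm p (Es ! i) m (x i)) * nrm E a"
    by (simp add: ell)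
  have weak_le: "weak_norm ?q J F \<phi>' \<le> weak_norm ?q I F \<phi>"
  proof (rule weak_norm_least[OF F q])
    show "finite J" by (simp add: J_def finite_index)
    fix y assume y: "y \<in> unit_ball F"
    have "(\<Sum>k\<in>J. norm (\<phi>' k y) powr ?q) = (\<Sum>j\<in>I. norm (\<phi>' (h j) y) powr ?q)"
      by (rule reindex) (simp add: \<phi>'_def)
    also have "\<dots> = (\<Sum>j\<in>I. norm (\<phi> j y) powr ?q)" by (simp add: phi')
    finally show "(\<Sum>k\<in>J. norm (\<phi>' k y) powr ?q) powr (1 / ?q) \<le> weak_norm ?q I F \<phi>"
      using weak_norm_upper[OF F q _ _ y, of I \<phi>] phi by (simp add: I_def finite_index)
  qed
  have "cohen_sum Es (fix_last Es a A) m x \<phi> \<le>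
      C * ((\<Prod>i<?n. ell_norm p (Es ! i) m (x i)) * nrm E a * weak_norm ?q J F \<phi>')"
    using cohen_boundD[OF p Es' F bound data'] by (simp only: sum_eq prod_eq) (simp add: J_def)
  also have "\<dots> \<le> C * ((\<Prod>i<?n. ell_norm p (Es ! i) m (x i)) * nrm E a * weak_norm ?q I F \<phi>)"
    by (intro mult_left_mono weak_le C mult_nonneg_nonneg prod_nonneg ballI ell_norm_nonneg nrm_nonneg[OF E a])
  finally show "cohen_sum Es (fix_last Es a A) m x \<phi> \<le>
      C * nrm E a * ((\<Prod>i<?n. ell_norm p (Es ! i) m (x i)) * weak_norm ?q ({..<?n} \<rightarrow>\<^sub>E {..<m}) F \<phi>)"
    by (simp add: I_def mult_ac)
qed

lemma
  assumes nf: "norming F" and A: "A \<in> mCoh p (Es @ [E]) F"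
  shows fix_last_mCoh: "fix_last Es a A \<in> mCoh p Es F"
    and mCoh_norm_fix_last:
      "mCoh_norm p Es F (fix_last Es a A) \<le> mCoh_norm p (Es @ [E]) F A * nrm E a"
proof -
  note Es' = normed_spaces_append
  note mult = mCoh_multilinear[OF p Es' F A]
  note bound = cohen_bound_fix_last[OF mult mCoh_norm_bound[OF p Es' F A]]
  show "fix_last Es a A \<in> mCoh p Es F"
    by (rule cohen_bound_imp_mCoh[OF p Es F nf multilinear_fix_last[OF mult] bound])
  show "mCoh_norm p Es F (fix_last Es a A) \<le> mCoh_norm p (Es @ [E]) F A * nrm E a"
    by (rule mCoh_norm_le[OF p Es F bound])
qed

end

lemma normed_space_scalar_space: "normed_space scalar_space"
  by (auto simp: normed_space_def scalar_space_def zero_prod_def prod_eq_iff algebra_simps norm_mult norm_triangle_ineq)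

text \<open>
  The operator \<open>A1\<close> is \<open>A\<close> with its last variable fixed at a vector of norm 1.
\<close>
lemma property_B_mCoh:
  assumes p: "1 < p"
    and nf: "\<And>F :: ('k::real_normed_field, 'v::ab_group_add) nspace. normed_space F \<Longrightarrow> norming F"
  shows "property_B (mCoh p :: ('k, 'a::ab_group_add \<times> 'k, 'v) mult_class) (mCoh_norm p) 1"
  unfolding property_B_def
proof (intro conjI allI impI; (elim conjE)?)
  fix Es :: "('k, 'a \<times> 'k) nspace list" and F :: "('k, 'v) nspace"
  assume "\<forall>E\<in>set Es. banach_space E" "banach_space F"
  then have "\<forall>E\<in>set Es. normed_space E" "normed_space F" by (auto simp: banach_space_def)
  then show "normed_space (fun_space F (mCoh p Es F) (mCoh_norm p Es F))"
    using normed_space_mCoh[OF p] nf by blast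
  show "mCoh p Es F \<subseteq> cont_multilinear Es F" by (auto simp: mCoh_def)
next
  fix n and E :: "('k, 'a \<times> 'k) nspace" and F :: "('k, 'v) nspace" and A
  assume "banach_space E" "banach_space F" and A: "A \<in> mCoh p (replicate n E @ [scalar_space]) F"
  then have E: "\<forall>G\<in>set (replicate n E). normed_space G" and F: "normed_space F"
    by (auto simp: banach_space_def)
  have eq: "fix_last_1 n E A = fix_last (replicate n E) (0, 1) A"
    by (auto simp: fix_last_1_def fix_last_def fun_eq_iff)
  have one: "(0, 1) \<in> vecs (scalar_space :: ('k, 'a \<times> 'k) nspace)"
    "nrm (scalar_space :: ('k, 'a \<times> 'k) nspace) (0, 1) = 1"
    by (simp_all add: scalar_space_def)
  show "fix_last_1 n E A \<in> mCoh p (replicate n E) F"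
    unfolding eq by (rule fix_last_mCoh[OF p E normed_space_scalar_space F one(1) nf[OF F] A])
  show "mCoh_norm p (replicate n E) F (fix_last_1 n E A)
      \<le> 1 * mCoh_norm p (replicate n E @ [scalar_space]) F A"
    unfolding eq using mCoh_norm_fix_last[OF p E normed_space_scalar_space F one(1) nf[OF F] A] one(2)
    by simp
qed simp


section \<open>Polarisation\<close>

lemma card_ne_0_if_member: "x \<in> S \<Longrightarrow> finite S \<Longrightarrow> card S \<noteq> 0"
  by auto

lemma tuples_replicate: "tuples (replicate n E) = {..<n} \<rightarrow>\<^sub>E vecs E"
  by (auto simp: tuples_def intro!: PiE_cong)

lemma tuples_replicateI: "(\<And>i. i < n \<Longrightarrow> x i \<in> vecs E) \<Longrightarrow> restrict x {..<n} \<in> tuples (replicate n E)"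
  by (auto simp: tuples_replicate)

lemma tuples_replicate_comp:
  assumes "x \<in> tuples (replicate n E)" "\<pi> permutes {..<n}"
  shows "x \<circ> \<pi> \<in> tuples (replicate n E)"
  using assms permutes_in_image[OF assms(2)]
  by (auto simp: tuples_replicate PiE_iff extensional_def permutes_not_in)

context
  fixes E :: "('k::real_normed_field, 'u::ab_group_add) nspace"
    and F :: "('k, 'v::ab_group_add) nspace" and n :: nat
  assumes E: "normed_space E" and F: "normed_space F"
begin

lemma normed_spaces_replicate: "\<forall>G\<in>set (replicate n E). normed_space G"
  using E by simp

text \<open>
  Full expansion of an operator at a sum, one variable at a time: after \<open>m\<close> steps the first \<open>m\<close> variables are
  expanded, while the remaining ones hold arbitrary vectors \<open>z i\<close>.
\<close>
lemma multilinear_expand: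
  assumes A: "multilinear (replicate n E) F A" and x: "\<And>j. j \<in> S \<Longrightarrow> x j \<in> vecs E"
  shows "A (\<lambda>i\<in>{..<n}. \<Sum>j\<in>S. x j) = (\<Sum>f\<in>{..<n} \<rightarrow>\<^sub>E S. A (\<lambda>i\<in>{..<n}. x (f i)))"
proof -
  note Es = normed_spaces_replicate
  let ?s = "\<Sum>j\<in>S. x j"
  have s: "?s \<in> vecs E" by (rule vecs_sum[OF E x])
  have "A (\<lambda>i\<in>{..<n}. if i < m then ?s else z i) =
      (\<Sum>f\<in>{..<m} \<rightarrow>\<^sub>E S. A (\<lambda>i\<in>{..<n}. if i < m then x (f i) else z i))"
    if "m \<le> n" "\<And>i. i < n \<Longrightarrow> z i \<in> vecs E" for m z
    using that
  proof (induction m arbitrary: z)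
    case 0 then show ?case by simp
  next
    case (Suc m)
    let ?w = "\<lambda>i\<in>{..<n}. if i < m then ?s else z i"
    have w: "?w \<in> tuples (replicate n E)" using Suc.prems s by (intro tuples_replicateI) auto
    have "(\<lambda>i\<in>{..<n}. if i < Suc m then ?s else z i) = ?w(m := ?s)"
      using Suc.prems by (auto simp: fun_eq_iff)
    then have "A (\<lambda>i\<in>{..<n}. if i < Suc m then ?s else z i) = (\<Sum>j\<in>S. A (?w(m := x j)))"
      using multilinear_upd_sum[OF Es F A w, of m S x] Suc.prems x by simp
    also have "\<dots> = (\<Sum>j\<in>S. \<Sum>f\<in>{..<m} \<rightarrow>\<^sub>E S. A (\<lambda>i\<in>{..<n}. if i < Suc m then x ((f(m := j)) i) else z i))"
    proof (rule sum.cong[OF refl])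
      fix j assume j: "j \<in> S"
      have "?w(m := x j) = (\<lambda>i\<in>{..<n}. if i < m then ?s else (z(m := x j)) i)"
        using Suc.prems by (auto simp: fun_eq_iff)
      then have "A (?w(m := x j)) =
          (\<Sum>f\<in>{..<m} \<rightarrow>\<^sub>E S. A (\<lambda>i\<in>{..<n}. if i < m then x (f i) else (z(m := x j)) i))"
        by (simp only:) (rule Suc.IH, use Suc.prems x[OF j] in auto)
      also have "\<dots> = (\<Sum>f\<in>{..<m} \<rightarrow>\<^sub>E S. A (\<lambda>i\<in>{..<n}. if i < Suc m then x ((f(m := j)) i) else z i))"
        by (intro sum.cong refl arg_cong[where f=A]) (auto simp: fun_eq_iff)
      finally show "A (?w(m := x j)) =
          (\<Sum>f\<in>{..<m} \<rightarrow>\<^sub>E S. A (\<lambda>i\<in>{..<n}. if i < Suc m then x ((f(m := j)) i) else z i))" .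
    qed
    also have "\<dots> = (\<Sum>f\<in>{..<Suc m} \<rightarrow>\<^sub>E S. A (\<lambda>i\<in>{..<n}. if i < Suc m then x (f i) else z i))"
      unfolding lessThan_Suc PiE_insert_eq
      by (subst sum.reindex[OF inj_combinator])
         (simp_all add: sum.cartesian_product split_def o_def)
    finally show ?case .
  qed
  from this[of n "\<lambda>_. 0"] show ?thesis by (simp add: vecs_zero[OF E] cong: restrict_cong)
qed

lemma symmetric_comp_surj:
  assumes sym: "symmetric_in n (replicate n E) A" and x: "x \<in> tuples (replicate n E)"
    and f: "f ` {..<n} = {..<n}"
  shows "A (\<lambda>i\<in>{..<n}. x (f i)) = A x"
proof -
  define \<pi> where "\<pi> i = (if i < n then f i else i)" for i
  have "inj_on f {..<n}" by (rule eq_card_imp_inj_on) (simp_all add: f)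
  then have "bij_betw f {..<n} {..<n}" using f by (simp add: bij_betw_def)
  then have "bij_betw \<pi> {..<n} {..<n}"
    by (rule bij_betw_cong[THEN iffD1, rotated]) (simp add: \<pi>_def)
  then have "\<pi> permutes {..<n}"
    by (rule bij_imp_permutes) (simp add: \<pi>_def)
  moreover have "x \<circ> \<pi> = (\<lambda>i\<in>{..<n}. x (f i))"
    using x by (auto simp: fun_eq_iff \<pi>_def tuples_replicate PiE_iff extensional_def)
  ultimately show ?thesis using sym x by (metis symmetric_in_def)
qed

text \<open>
  The polarisation argument. Expand the alternating sum of \<open>A (s, \<dots>, s)\<close>, where \<open>s\<close> runs through the sums of \<open>x j\<close>
  over \<open>j \<in> S\<close>, for all \<open>S \<subseteq> {..<n}\<close>. The coefficient of \<open>A (x (f 0), \<dots>, x (f (n - 1)))\<close> is an alternating sum over the sets between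
  the range of \<open>f\<close> and \<open>{..<n}\<close>, hence vanishes unless \<open>f\<close> is onto; in that case symmetry turns the term into \<open>A x\<close>.
  All values on the diagonal being 0, a nonzero multiple of \<open>A x\<close> is 0.
\<close>
lemma symmetric_zero_if_diag_zero:
  assumes A: "multilinear (replicate n E) F A" and sym: "symmetric_in n (replicate n E) A"
    and diag: "diag n E A = 0"
  shows "A = 0"
proof -
  note Es = normed_spaces_replicate
  note mem = multilinear_in_vecs[OF Es F A]
  let ?I = "{..<n}"
  have "A x = 0" if x: "x \<in> tuples (replicate n E)" for x
  proof -
    have xi: "x i \<in> vecs E" if "i < n" for i using tuples_nth[OF x] that by simp
    define a where "a f = A (\<lambda>i\<in>?I. x (f i))" for f :: "nat \<Rightarrow> nat"
    define c where "c f = (\<Sum>S | S \<subseteq> ?I \<and> f ` ?I \<subseteq> S. (-1) ^ card S :: 'k)" for f :: "nat \<Rightarrow> nat"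
    have a: "a f \<in> vecs F" for f by (simp add: a_def mem)
    have "0 = scl F ((-1) ^ card S) (A (\<lambda>i\<in>?I. \<Sum>j\<in>S. x j))" if "S \<subseteq> ?I" for S
    proof -
      have "(\<Sum>j\<in>S. x j) \<in> vecs E" using that xi by (intro vecs_sum[OF E]) auto
      then show ?thesis using fun_cong[OF diag, of "\<Sum>j\<in>S. x j"] by (simp add: diag_def scl_zero_right[OF F])
    qed
    then have "0 = (\<Sum>S\<in>Pow ?I. scl F ((-1) ^ card S) (A (\<lambda>i\<in>?I. \<Sum>j\<in>S. x j)))"
      by (intro sum.neutral[symmetric]) auto
    also have "\<dots> = (\<Sum>S\<in>Pow ?I. \<Sum>f\<in>?I \<rightarrow>\<^sub>E S. scl F ((-1) ^ card S) (a f))"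
    proof (rule sum.cong[OF refl])
      fix S assume "S \<in> Pow ?I"
      then show "scl F ((-1) ^ card S) (A (\<lambda>i\<in>?I. \<Sum>j\<in>S. x j)) = (\<Sum>f\<in>?I \<rightarrow>\<^sub>E S. scl F ((-1) ^ card S) (a f))"
        using multilinear_expand[OF A, of S x] xi by (auto simp: a_def scl_sum_right[OF F mem] subset_iff)
    qed
    also have "\<dots> = (\<Sum>S\<in>Pow ?I. \<Sum>f | f \<in> ?I \<rightarrow>\<^sub>E ?I \<and> f ` ?I \<subseteq> S. scl F ((-1) ^ card S) (a f))"
      by (intro sum.cong refl) (auto simp: PiE_iff extensional_def)
    also have "\<dots> = (\<Sum>f\<in>?I \<rightarrow>\<^sub>E ?I. \<Sum>S | S \<in> Pow ?I \<and> f ` ?I \<subseteq> S. scl F ((-1) ^ card S) (a f))"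
      by (rule sum.swap_restrict) (auto simp: finite_index)
    also have "\<dots> = (\<Sum>f\<in>?I \<rightarrow>\<^sub>E ?I. scl F (c f) (a f))"
      by (simp add: c_def scl_sum_left[OF F a])
    also have "\<dots> = (\<Sum>f\<in>?I \<rightarrow>\<^sub>E ?I. scl F (if f ` ?I = ?I then (-1) ^ n else 0) (A x))"
    proof (rule sum.cong[OF refl])
      fix f assume f: "f \<in> ?I \<rightarrow>\<^sub>E ?I"
      show "scl F (c f) (a f) = scl F (if f ` ?I = ?I then (-1) ^ n else 0) (A x)"
      proof (cases "f ` ?I = ?I")
        case True
        have "{S. S \<subseteq> ?I \<and> f ` ?I \<subseteq> S} = {?I}" using True by auto
        then have "c f = (-1) ^ n" by (simp add: c_def)
        then show ?thesis using True symmetric_comp_surj[OF sym x True] by (simp add: a_def)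
      next
        case False
        then have "f ` ?I \<subset> ?I" using f by (auto simp: PiE_iff)
        then have "c f = 0"
          unfolding c_def using card_subsupersets_even_odd[of ?I "f ` ?I"]
          by (intro sum_alternating_cancels) (simp_all add: conj_assoc)
        then show ?thesis using False by (simp add: scl_zero_left[OF F] a mem)
      qed
    qed
    also have "\<dots> = scl F (\<Sum>f\<in>?I \<rightarrow>\<^sub>E ?I. if f ` ?I = ?I then (-1) ^ n else 0) (A x)"
      by (simp add: scl_sum_left[OF F mem])
    also have "(\<Sum>f\<in>?I \<rightarrow>\<^sub>E ?I. if f ` ?I = ?I then (-1) ^ n else 0) =
        of_nat (card {f \<in> ?I \<rightarrow>\<^sub>E ?I. f ` ?I = ?I}) * (-1 :: 'k) ^ n"
      by (simp add: sum.If_cases finite_index Int_def)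
    finally have "nrm F (scl F (of_nat (card {f \<in> ?I \<rightarrow>\<^sub>E ?I. f ` ?I = ?I}) * (-1 :: 'k) ^ n) (A x)) = 0"
      by (simp only: nrm_zero[OF F])
    moreover have "card {f \<in> ?I \<rightarrow>\<^sub>E ?I. f ` ?I = ?I} \<noteq> 0"
    proof -
      have "(\<lambda>i\<in>?I. i) \<in> {f \<in> ?I \<rightarrow>\<^sub>E ?I. f ` ?I = ?I}" by auto
      moreover have "finite {f \<in> ?I \<rightarrow>\<^sub>E ?I. f ` ?I = ?I}" by (simp add: finite_index)
      ultimately show ?thesis by (rule card_ne_0_if_member)
    qed
    ultimately have "nrm F (A x) = 0"
      by (simp add: nrm_scl[OF F mem] norm_mult norm_power)
    then show "A x = 0" by (simp add: nrm_eq_0[OF F mem])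
  qed
  then show ?thesis using multilinear_outside[OF Es F A] by (auto simp: fun_eq_iff)
qed

lemma diag_zero: "diag n E (0 :: _ \<Rightarrow> 'v) = 0"
  by (auto simp: diag_def)

lemma diag_add: "diag n E (A + B) = diag n E A + (diag n E B :: 'u \<Rightarrow> 'v)"
  by (auto simp: diag_def fun_eq_iff)

lemma diag_diff: "diag n E (A - B) = diag n E A - (diag n E B :: 'u \<Rightarrow> 'v)"
  by (auto simp: diag_def fun_eq_iff)

lemma diag_scl: "diag n E (\<lambda>x. scl F c (A x)) = (\<lambda>x. scl F c (diag n E A x))"
  by (auto simp: diag_def fun_eq_iff scl_zero_right[OF F])

lemma symmetric_in_zero: "symmetric_in n (replicate n E) (0 :: _ \<Rightarrow> 'v)"
  by (simp add: symmetric_in_def)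

lemma symmetric_in_add:
  "symmetric_in n (replicate n E) A \<Longrightarrow> symmetric_in n (replicate n E) B \<Longrightarrow>
    symmetric_in n (replicate n E) (A + B :: _ \<Rightarrow> 'v)"
  by (simp add: symmetric_in_def)

lemma symmetric_in_diff:
  "symmetric_in n (replicate n E) A \<Longrightarrow> symmetric_in n (replicate n E) B \<Longrightarrow>
    symmetric_in n (replicate n E) (A - B :: _ \<Rightarrow> 'v)"
  by (simp add: symmetric_in_def)

lemma symmetric_in_scl:
  "symmetric_in n (replicate n E) A \<Longrightarrow> symmetric_in n (replicate n E) (\<lambda>x. scl F c (A x))"
  by (simp add: symmetric_in_def)

text \<open>
  The difference of two symmetric operators with the same diagonal has diagonal 0, so the description in \<open>polar\<close>
  is unambiguous.
\<close>
lemma polar_diag: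
  assumes A: "multilinear (replicate n E) F A" and sym: "symmetric_in n (replicate n E) A"
  shows "polar n E F (diag n E A) = A"
  unfolding polar_def
proof (rule the_equality)
  fix B assume B: "multilinear (replicate n E) F B \<and> symmetric_in n (replicate n E) B \<and>
    diag n E B = diag n E A"
  then have "B - A = 0"
    by (intro symmetric_zero_if_diag_zero multilinear_diff[OF normed_spaces_replicate F] A
        symmetric_in_diff sym) (auto simp: diag_diff)
  then show "B = A" by simp
qed (use A sym in blast)

definition symmetrisation :: "((nat \<Rightarrow> 'u) \<Rightarrow> 'v) \<Rightarrow> (nat \<Rightarrow> 'u) \<Rightarrow> 'v" where
  "symmetrisation A x = (if x \<in> tuples (replicate n E)
     then scl F (1 / fact n) (\<Sum>\<pi> | \<pi> permutes {..<n}. A (x \<circ> \<pi>)) else 0)"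

context
  fixes A assumes A: "multilinear (replicate n E) F A"
begin

lemma multilinear_symmetrisation: "multilinear (replicate n E) F (symmetrisation A)"
proof (rule multilinearI[OF normed_spaces_replicate F])
  note Es = normed_spaces_replicate
  note mem = multilinear_in_vecs[OF Es F A]
  show "symmetrisation A x \<in> vecs F" for x
    by (simp add: symmetrisation_def vecs_zero[OF F] vecs_scl[OF F] vecs_sum[OF F] mem)
  show "symmetrisation A x = 0" if "x \<notin> tuples (replicate n E)" for x
    using that by (simp add: symmetrisation_def)
  fix x i u
  assume x: "x \<in> tuples (replicate n E)" and i': "i < length (replicate n E)"
    and u': "u \<in> vecs (replicate n E ! i)"
  then have i: "i < n" and u: "u \<in> vecs E" by simp_all
  \<comment> \<open>After permuting, the distinguished entry sits at position \<open>inv \<pi> i\<close>.\<close>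
  have eq: "symmetrisation A (x(i := w)) =
      scl F (1 / fact n) (\<Sum>\<pi> | \<pi> permutes {..<n}. A ((x \<circ> \<pi>)(inv \<pi> i := w)))" if "w \<in> vecs E" for w
  proof -
    have "x(i := w) \<circ> \<pi> = (x \<circ> \<pi>)(inv \<pi> i := w)" if "\<pi> permutes {..<n}" for \<pi>
      using permutes_inverses[OF that] by (auto simp: fun_eq_iff)
    moreover have "x(i := w) \<in> tuples (replicate n E)" using tuples_upd[OF x i'] that i by simp
    ultimately show ?thesis by (simp add: symmetrisation_def)
  qed
  have inv: "inv \<pi> i < n" if "\<pi> permutes {..<n}" for \<pi>
    using permutes_in_image[OF permutes_inv[OF that], of i] i by simp
  show "symmetrisation A (x(i := u + v)) = symmetrisation A (x(i := u)) + symmetrisation A (x(i := v))"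
    if v': "v \<in> vecs (replicate n E ! i)" for v
  proof -
    have v: "v \<in> vecs E" using v' i by simp
    have "A ((x \<circ> \<pi>)(inv \<pi> i := u + v)) = A ((x \<circ> \<pi>)(inv \<pi> i := u)) + A ((x \<circ> \<pi>)(inv \<pi> i := v))"
      if "\<pi> permutes {..<n}" for \<pi>
      using multilinear_upd_add[OF Es F A tuples_replicate_comp[OF x that], of "inv \<pi> i" u v] inv[OF that] u v
      by simp
    then show ?thesis
      by (simp add: eq u v vecs_add[OF E] sum.distrib scl_add_right[OF F] vecs_sum[OF F] mem)
  qed
  show "symmetrisation A (x(i := scl (replicate n E ! i) c u)) = scl F c (symmetrisation A (x(i := u)))" for c
  proof -
    have "A ((x \<circ> \<pi>)(inv \<pi> i := scl E c u)) = scl F c (A ((x \<circ> \<pi>)(inv \<pi> i := u)))"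
      if "\<pi> permutes {..<n}" for \<pi>
      using multilinear_upd_scl[OF Es F A tuples_replicate_comp[OF x that], of "inv \<pi> i" u c] inv[OF that] u
      by simp
    then show ?thesis
      by (simp add: eq u i vecs_scl[OF E] scl_sum_right[OF F mem, symmetric] scl_scl[OF F]
          vecs_sum[OF F] mem mult.commute)
  qed
qed

lemma symmetric_symmetrisation: "symmetric_in n (replicate n E) (symmetrisation A)"
  unfolding symmetric_in_def
proof (intro ballI allI impI)
  fix x \<sigma> assume x: "x \<in> tuples (replicate n E)" and \<sigma>: "\<sigma> permutes {..<n}"
  have "(\<Sum>\<pi> | \<pi> permutes {..<n}. A (x \<circ> \<sigma> \<circ> \<pi>)) = (\<Sum>\<pi> | \<pi> permutes {..<n}. A (x \<circ> \<pi>))"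
    using setum_permutations_compose_left[OF \<sigma>, of "\<lambda>\<pi>. A (x \<circ> \<pi>)"] by (simp add: comp_assoc)
  then show "symmetrisation A (x \<circ> \<sigma>) = symmetrisation A x"
    using tuples_replicate_comp[OF x \<sigma>] x by (simp add: symmetrisation_def)
qed

lemma diag_symmetrisation: "diag n E (symmetrisation A) = diag n E A"
proof
  fix x
  show "diag n E (symmetrisation A) x = diag n E A x"
  proof (cases "x \<in> vecs E")
    case True
    let ?x = "\<lambda>i\<in>{..<n}. x"
    have mem: "A ?x \<in> vecs F" by (rule multilinear_in_vecs[OF normed_spaces_replicate F A])
    have "?x \<circ> \<pi> = ?x" if "\<pi> permutes {..<n}" for \<pi>
      using permutes_in_image[OF that] by (auto simp: fun_eq_iff restrict_def)
    then have "(\<Sum>\<pi> | \<pi> permutes {..<n}. A (?x \<circ> \<pi>)) = (\<Sum>\<pi> | \<pi> permutes {..<n}. scl F 1 (A ?x))"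
      by (simp add: scl_one[OF F mem])
    also have "\<dots> = scl F (fact n) (A ?x)"
      by (simp add: scl_sum_left[OF F mem, symmetric] card_permutations[OF card_lessThan])
    finally show ?thesis
      using True tuples_replicateI[of n "\<lambda>_. x" E]
      by (simp add: diag_def symmetrisation_def scl_scl[OF F mem] scl_one[OF F mem])
  qed (simp add: diag_def)
qed

text \<open>
  Every polynomial comes from some multilinear operator, and symmetrising that operator provides a
  candidate for the description in \<open>polar\<close>.
\<close>
lemma polar_symmetric: "symmetric_in n (replicate n E) (polar n E F (diag n E A))"
  and diag_polar: "diag n E (polar n E F (diag n E A)) = diag n E A"
  using polar_diag[OF multilinear_symmetrisation symmetric_symmetrisation]
    symmetric_symmetrisation diag_symmetrisation by simp_all

end

end


section \<open>The space of multiple Cohen strongly summing polynomials\<close>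

text \<open>
  A linear isometric copy of a subspace of a normed space is a normed space. It is applied to \<open>diag\<close> on the
  symmetric operators.
\<close>
lemma normed_space_image:
  fixes M :: "('k::real_normed_field, 'u::ab_group_add) nspace" and P :: "('k, 'v::ab_group_add) nspace"
  assumes M: "normed_space M" and sub: "S \<subseteq> vecs M" and zero: "0 \<in> S"
    and add: "\<And>x y. x \<in> S \<Longrightarrow> y \<in> S \<Longrightarrow> x + y \<in> S" and scl: "\<And>c x. x \<in> S \<Longrightarrow> scl M c x \<in> S"
    and vecs: "vecs P = D ` S" and D_add: "\<And>x y. D (x + y) = D x + D y"
    and D_eq_0: "\<And>x. x \<in> S \<Longrightarrow> D x = 0 \<longleftrightarrow> x = 0"
    and D_scl: "\<And>c x. scl P c (D x) = D (scl M c x)" and D_nrm: "\<And>x. x \<in> S \<Longrightarrow> nrm P (D x) = nrm M x"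
  shows "normed_space P"
proof -
  have mem: "x \<in> vecs M" if "x \<in> S" for x using sub that by blast
  show ?thesis
    unfolding normed_space_def vecs ball_simps(9)
  proof (intro conjI ballI allI)
    show "0 \<in> D ` S" using D_eq_0[OF zero] zero by (metis imageI)
    fix x c assume x: "x \<in> S"
    show "scl P c (D x) \<in> D ` S" using scl[OF x] by (simp add: D_scl)
    show "scl P 1 (D x) = D x" by (simp add: D_scl scl_one[OF M mem[OF x]])
    show "0 \<le> nrm P (D x)" by (simp add: D_nrm[OF x] nrm_nonneg[OF M mem[OF x]])
    show "(nrm P (D x) = 0) = (D x = 0)"
      by (simp add: D_nrm[OF x] D_eq_0[OF x] nrm_eq_0[OF M mem[OF x]])
    show "nrm P (scl P c (D x)) = norm c * nrm P (D x)"
      by (simp add: D_scl D_nrm[OF x] D_nrm[OF scl[OF x]] nrm_scl[OF M mem[OF x]])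
    show "scl P (c + d) (D x) = scl P c (D x) + scl P d (D x)" for d
      by (simp add: D_scl D_add[symmetric] scl_add_left[OF M mem[OF x]])
    show "scl P c (scl P d (D x)) = scl P (c * d) (D x)" for d
      by (simp add: D_scl scl_scl[OF M mem[OF x]])
    fix y assume y: "y \<in> S"
    show "D x + D y \<in> D ` S" using add[OF x y] by (simp add: D_add[symmetric])
    show "scl P c (D x + D y) = scl P c (D x) + scl P c (D y)"
      by (simp add: D_scl D_add[symmetric] scl_add_right[OF M mem[OF x] mem[OF y]])
    show "nrm P (D x + D y) \<le> nrm P (D x) + nrm P (D y)"
      by (simp add: D_add[symmetric] D_nrm x y add nrm_add_le[OF M mem[OF x] mem[OF y]])
  qed
qed

context
  fixes p :: real and E :: "('k::real_normed_field, 'u::ab_group_add) nspace"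
    and F :: "('k, 'v::ab_group_add) nspace" and n :: nat
  assumes p: "1 < p" and E: "normed_space E" and F: "normed_space F" and nf: "norming F"
begin

lemma poly_mCohD:
  assumes P: "P \<in> poly_mCoh p n E F"
  shows "polar n E F P \<in> mCoh p (replicate n E) F"
    and "symmetric_in n (replicate n E) (polar n E F P)"
    and "diag n E (polar n E F P) = P"
proof -
  obtain A where "multilinear (replicate n E) F A" "P = diag n E A"
    using P by (auto simp: poly_mCoh_def cont_polynomials_def cont_multilinear_def)
  then show "symmetric_in n (replicate n E) (polar n E F P)" "diag n E (polar n E F P) = P"
    using polar_symmetric[OF E F] diag_polar[OF E F] by auto
  show "polar n E F P \<in> mCoh p (replicate n E) F" using P by (simp add: poly_mCoh_def)
qed

lemma
  assumes A: "A \<in> mCoh p (replicate n E) F" and sym: "symmetric_in n (replicate n E) A"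
  shows diag_in_poly_mCoh: "diag n E A \<in> poly_mCoh p n E F"
    and polar_diag_mCoh: "polar n E F (diag n E A) = A"
    and poly_mCoh_norm_diag: "poly_mCoh_norm p n E F (diag n E A) = mCoh_norm p (replicate n E) F A"
proof -
  show polar: "polar n E F (diag n E A) = A"
    by (rule polar_diag[OF E F mCoh_multilinear[OF p normed_spaces_replicate[OF E F] F A] sym])
  show "diag n E A \<in> poly_mCoh p n E F"
    using A by (auto simp: poly_mCoh_def cont_polynomials_def polar mCoh_def)
  show "poly_mCoh_norm p n E F (diag n E A) = mCoh_norm p (replicate n E) F A"
    by (simp add: poly_mCoh_norm_def polar)
qed

lemma poly_mCoh_cases:
  assumes "P \<in> poly_mCoh p n E F"
  obtains A where "A \<in> mCoh p (replicate n E) F" "symmetric_in n (replicate n E) A" "P = diag n E A"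
  using poly_mCohD[OF assms] by metis

lemma diag_eq_iff:
  assumes "A \<in> mCoh p (replicate n E) F" "symmetric_in n (replicate n E) A"
    and "B \<in> mCoh p (replicate n E) F" "symmetric_in n (replicate n E) B"
  shows "diag n E A = diag n E B \<longleftrightarrow> A = B"
  using polar_diag_mCoh[OF assms(1,2)] polar_diag_mCoh[OF assms(3,4)] by metis

lemma normed_space_poly_mCoh:
  "normed_space (fun_space F (poly_mCoh p n E F) (poly_mCoh_norm p n E F))"
proof (rule normed_space_image)
  note Es = normed_spaces_replicate[OF E F, of n]
  let ?S = "{A \<in> mCoh p (replicate n E) F. symmetric_in n (replicate n E) A}"
  show "normed_space (fun_space F (mCoh p (replicate n E) F) (mCoh_norm p (replicate n E) F))"
    by (rule normed_space_mCoh[OF p Es F nf])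
  show "?S \<subseteq> vecs (fun_space F (mCoh p (replicate n E) F) (mCoh_norm p (replicate n E) F))"
    by (auto simp: fun_space_def)
  show "0 \<in> ?S" by (simp add: mCoh_zero[OF p Es F nf] symmetric_in_zero[OF E F])
  show "A + B \<in> ?S" if "A \<in> ?S" "B \<in> ?S" for A B
    using that by (simp add: mCoh_add[OF p Es F nf] symmetric_in_add[OF E F])
  show "scl (fun_space F (mCoh p (replicate n E) F) (mCoh_norm p (replicate n E) F)) c A \<in> ?S"
    if "A \<in> ?S" for c A
    using that by (simp add: fun_space_def mCoh_scl[OF p Es F nf] symmetric_in_scl[OF E F])
  show "vecs (fun_space F (poly_mCoh p n E F) (poly_mCoh_norm p n E F)) = diag n E ` ?S"
    by (auto simp: fun_space_def diag_in_poly_mCoh elim!: poly_mCoh_cases)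
  show "diag n E (A + B) = diag n E A + diag n E B" for A B :: "(nat \<Rightarrow> 'u) \<Rightarrow> 'v"
    by (rule diag_add[OF E F])
  show "diag n E A = 0 \<longleftrightarrow> A = 0" if "A \<in> ?S" for A
    using diag_eq_iff[of A 0] that mCoh_zero[OF p Es F nf] symmetric_in_zero[OF E F, of n]
      diag_zero[OF E F, of n]
    by simp
  show "scl (fun_space F (poly_mCoh p n E F) (poly_mCoh_norm p n E F)) c (diag n E A) =
      diag n E (scl (fun_space F (mCoh p (replicate n E) F) (mCoh_norm p (replicate n E) F)) c A)" for c A
    by (simp add: fun_space_def diag_scl[OF E F])
  show "nrm (fun_space F (poly_mCoh p n E F) (poly_mCoh_norm p n E F)) (diag n E A) =
      nrm (fun_space F (mCoh p (replicate n E) F) (mCoh_norm p (replicate n E) F)) A" if "A \<in> ?S" for A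
    using that by (simp add: fun_space_def poly_mCoh_norm_diag)
qed

text \<open>
  The symmetric operators of a Cauchy sequence of polynomials form a Cauchy sequence in \<open>mCoh\<close>. Its limit is
  symmetric, being a pointwise limit, and the polynomial of this limit is the limit of the given sequence.
\<close>
lemma banach_space_poly_mCoh:
  assumes compl: "Metric_space.mcomplete (vecs F) (ndist F)"
  shows "banach_space (fun_space F (poly_mCoh p n E F) (poly_mCoh_norm p n E F))" (is "banach_space ?P")
  unfolding banach_space_def
proof (intro conjI normed_space_poly_mCoh mcompleteI[OF normed_space_poly_mCoh])
  note Es = normed_spaces_replicate[OF E F, of n]
  fix s :: "nat \<Rightarrow> 'u \<Rightarrow> 'v"
  assume s: "\<And>k. s k \<in> vecs ?P"
    and cauchy: "\<And>e. 0 < e \<Longrightarrow> \<exists>K. \<forall>k\<ge>K. \<forall>l\<ge>K. nrm ?P (s k - s l) < e"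
  have "\<forall>k. \<exists>A. A \<in> mCoh p (replicate n E) F \<and> symmetric_in n (replicate n E) A \<and> s k = diag n E A"
    using s by (auto simp: fun_space_def elim: poly_mCoh_cases)
  then obtain A where A: "\<And>k. A k \<in> mCoh p (replicate n E) F"
    and sym: "\<And>k. symmetric_in n (replicate n E) (A k)" and s_eq: "\<And>k. s k = diag n E (A k)" by metis
  have norm_eq: "nrm ?P (s k - diag n E B) = mCoh_norm p (replicate n E) F (A k - B)"
    if "B \<in> mCoh p (replicate n E) F" "symmetric_in n (replicate n E) B" for k B
    using poly_mCoh_norm_diag[OF mCoh_diff[OF p Es F nf A that(1)] symmetric_in_diff[OF E F sym that(2)], of k]
    by (simp add: fun_space_def s_eq diag_diff[OF E F])
  have "\<exists>K. \<forall>k\<ge>K. \<forall>l\<ge>K. mCoh_norm p (replicate n E) F (A k - A l) < e" if "0 < e" for e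
    using cauchy[OF that] norm_eq[OF A sym] by (simp add: s_eq)
  then have "\<exists>B\<in>mCoh p (replicate n E) F. (\<lambda>k. mCoh_norm p (replicate n E) F (A k - B)) \<longlonglongrightarrow> 0 \<and>
      (\<forall>x. (\<lambda>k. nrm F (A k x - B x)) \<longlonglongrightarrow> 0)"
    by (rule mCoh_Cauchy_limit[OF p Es F nf compl A])
  then obtain B where B: "B \<in> mCoh p (replicate n E) F"
    and lim: "(\<lambda>k. mCoh_norm p (replicate n E) F (A k - B)) \<longlonglongrightarrow> 0"
    and pointwise: "\<And>x. (\<lambda>k. nrm F (A k x - B x)) \<longlonglongrightarrow> 0"
    by blast
  have symB: "symmetric_in n (replicate n E) B"
    unfolding symmetric_in_def
  proof (intro ballI allI impI)
    fix x \<pi> assume x: "x \<in> tuples (replicate n E)" and \<pi>: "\<pi> permutes {..<n}"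
    have "A k (x \<circ> \<pi>) = A k x" for k using sym x \<pi> by (simp add: symmetric_in_def)
    then have lim_comp: "(\<lambda>k. nrm F (A k x - B (x \<circ> \<pi>))) \<longlonglongrightarrow> 0" using pointwise[of "x \<circ> \<pi>"] by simp
    show "B (x \<circ> \<pi>) = B x"
      by (rule norm_limit_unique[OF F mCoh_in_vecs[OF p Es F nf A] mCoh_in_vecs[OF p Es F nf B]
            mCoh_in_vecs[OF p Es F nf B] lim_comp pointwise])
  qed
  show "\<exists>y\<in>vecs ?P. (\<lambda>k. nrm ?P (s k - y)) \<longlonglongrightarrow> 0"
    using diag_in_poly_mCoh[OF B symB] lim
    by (intro bexI[of _ "diag n E B"]) (simp_all add: norm_eq[OF B symB], simp add: fun_space_def)
qed

end


section \<open>Constants and differentials\<close>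

context
  fixes p :: real and E :: "('k::real_normed_field, 'u::ab_group_add) nspace"
    and F :: "('k, 'v::ab_group_add) nspace"
  assumes p: "1 < p" and E: "normed_space E" and F: "normed_space F" and nf: "norming F"
begin

lemma
  assumes y: "y \<in> vecs F"
  shows constant_in_poly_mCoh: "(\<lambda>x. if x \<in> vecs E then y else 0) \<in> poly_mCoh p 0 E F"
    and poly_mCoh_norm_constant: "poly_mCoh_norm p 0 E F (\<lambda>x. if x \<in> vecs E then y else 0) = nrm F y"
proof -
  define A where "A = (\<lambda>t :: nat \<Rightarrow> 'u. if t = (\<lambda>_. undefined) then y else 0)"
  have tuples: "tuples [] = {\<lambda>_. undefined :: 'u}" by (simp add: tuples_def)
  have Es: "\<forall>G\<in>set []. normed_space G" by simp
  have mult: "multilinear [] F A"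
    by (auto simp: multilinear_def tuples A_def y)
  note bound = cohen_bound_no_variables[OF p Es F mult refl]
  have A: "A \<in> mCoh p (replicate 0 E) F"
    using cohen_bound_imp_mCoh[OF p Es F nf mult bound] by simp
  have sym: "symmetric_in 0 (replicate 0 E) A" by (simp add: symmetric_in_def)
  have eq: "diag 0 E A = (\<lambda>x. if x \<in> vecs E then y else 0)"
    by (auto simp: diag_def A_def fun_eq_iff)
  show "(\<lambda>x. if x \<in> vecs E then y else 0) \<in> poly_mCoh p 0 E F"
    using diag_in_poly_mCoh[OF p E F nf A sym] by (simp add: eq)
  have "mCoh_norm p [] F A = nrm F y"
    using mCoh_norm_le[OF p Es F bound] nrm_le_mCoh_norm[OF p Es F nf, of A "\<lambda>_. undefined"] A
    by (simp add: tuples A_def)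
  then show "poly_mCoh_norm p 0 E F (\<lambda>x. if x \<in> vecs E then y else 0) = nrm F y"
    using poly_mCoh_norm_diag[OF p E F nf A sym] by (simp add: eq)
qed

lemma poly_mCoh_degree_0:
  "poly_mCoh p 0 E F = (\<lambda>y x. if x \<in> vecs E then y else 0) ` vecs F"
proof (intro equalityI subsetI)
  fix P assume "P \<in> poly_mCoh p 0 E F"
  then obtain A where A: "A \<in> mCoh p (replicate 0 E) F" and P: "P = diag 0 E A"
    by (rule poly_mCoh_cases[OF p E F nf])
  have "P = (\<lambda>x. if x \<in> vecs E then A (\<lambda>_. undefined) else 0)"
    by (auto simp: P diag_def fun_eq_iff restrict_def)
  then show "P \<in> (\<lambda>y x. if x \<in> vecs E then y else 0) ` vecs F"
    using mCoh_in_vecs[OF p normed_spaces_replicate[OF E F] F nf A] by blast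
qed (auto intro: constant_in_poly_mCoh)

text \<open>
  The operator in the first \<open>k\<close> of \<open>n\<close> variables that is left when the others are fixed at \<open>a\<close>. Fixing the last
  variables rather than the first ones keeps the numbering of the free variables; for a symmetric
  operator this makes no difference.
\<close>
definition fix_tail :: "nat \<Rightarrow> 'u \<Rightarrow> ((nat \<Rightarrow> 'u) \<Rightarrow> 'v) \<Rightarrow> nat \<Rightarrow> (nat \<Rightarrow> 'u) \<Rightarrow> 'v" where
  "fix_tail n a A k x = (if x \<in> tuples (replicate k E)
     then A (\<lambda>i\<in>{..<n}. if i < k then x i else a) else 0)"

context
  fixes n A a
  assumes A: "A \<in> mCoh p (replicate n E) F" and sym: "symmetric_in n (replicate n E) A"
    and a: "a \<in> vecs E"
begin

text \<open>
  Downward induction on \<open>k\<close>, each step fixing one more variable at the cost of a factor \<open>\<parallel>a\<parallel>\<close>.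
\<close>
lemma fix_tail_mCoh:
  assumes "k \<le> n"
  shows "fix_tail n a A k \<in> mCoh p (replicate k E) F \<and>
    mCoh_norm p (replicate k E) F (fix_tail n a A k)
      \<le> mCoh_norm p (replicate n E) F A * nrm E a ^ (n - k)"
  using assms
proof (induction rule: inc_induct)
  case base
  have "fix_tail n a A n = A"
  proof
    fix x
    show "fix_tail n a A n x = A x"
    proof (cases "x \<in> tuples (replicate n E)")
      case True
      then have "(\<lambda>i\<in>{..<n}. if i < n then x i else a) = x"
        by (auto simp: tuples_replicate fun_eq_iff PiE_iff extensional_def)
      then show ?thesis using True by (simp add: fix_tail_def)
    next
      case False
      then show ?thesis
        using multilinear_outside[OF normed_spaces_replicate[OF E F] F
            mCoh_multilinear[OF p normed_spaces_replicate[OF E F] F A]]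
        by (simp add: fix_tail_def)
    qed
  qed
  then show ?case using A by simp
next
  case (step k)
  note Es = normed_spaces_replicate[OF E F, of k]
  have rep: "replicate (Suc k) E = replicate k E @ [E]" by (simp add: replicate_append_same)
  have eq: "fix_tail n a A k = fix_last (replicate k E) a (fix_tail n a A (Suc k))"
  proof
    fix x
    show "fix_tail n a A k x = fix_last (replicate k E) a (fix_tail n a A (Suc k)) x"
    proof (cases "x \<in> tuples (replicate k E)")
      case True
      have "x(k := a) \<in> tuples (replicate (Suc k) E)"
        unfolding rep using tuples_append[OF True a] by simp
      moreover have "(\<lambda>i\<in>{..<n}. if i < Suc k then (x(k := a)) i else a) = (\<lambda>i\<in>{..<n}. if i < k then x i else a)"
        by (auto simp: fun_eq_iff)
      ultimately show ?thesis using True by (simp add: fix_tail_def fix_last_def)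
    qed (simp add: fix_tail_def fix_last_def)
  qed
  have mem: "fix_tail n a A (Suc k) \<in> mCoh p (replicate k E @ [E]) F"
    using step.IH by (simp only: rep)
  have "mCoh_norm p (replicate k E) F (fix_tail n a A k)
      \<le> mCoh_norm p (replicate k E @ [E]) F (fix_tail n a A (Suc k)) * nrm E a"
    unfolding eq by (rule mCoh_norm_fix_last[OF p Es E F a nf mem])
  also have "\<dots> \<le> mCoh_norm p (replicate n E) F A * nrm E a ^ (n - Suc k) * nrm E a"
    using step.IH nrm_nonneg[OF E a] by (intro mult_right_mono) (simp_all only: rep)
  also have "\<dots> = mCoh_norm p (replicate n E) F A * nrm E a ^ (n - k)"
    using step.hyps by (simp add: Suc_diff_Suc[symmetric])
  finally show ?case
    using fix_last_mCoh[OF p Es E F a nf mem] by (simp add: eq)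
qed

lemma symmetric_fix_tail:
  assumes k: "k \<le> n"
  shows "symmetric_in k (replicate k E) (fix_tail n a A k)"
  unfolding symmetric_in_def
proof (intro ballI allI impI)
  fix x \<pi> assume x: "x \<in> tuples (replicate k E)" and \<pi>: "\<pi> permutes {..<k}"
  let ?z = "\<lambda>i\<in>{..<n}. if i < k then x i else a"
  have z: "?z \<in> tuples (replicate n E)"
    using tuples_nth[OF x] a by (intro tuples_replicateI) auto
  have \<pi>n: "\<pi> permutes {..<n}" by (rule permutes_subset[OF \<pi>]) (use k in auto)
  have "\<pi> i < k \<longleftrightarrow> i < k" "\<pi> i < n \<longleftrightarrow> i < n" for i
    using permutes_in_image[OF \<pi>, of i] permutes_in_image[OF \<pi>n, of i] by simp_all
  then have "(\<lambda>i\<in>{..<n}. if i < k then (x \<circ> \<pi>) i else a) = ?z \<circ> \<pi>"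
    by (auto simp: fun_eq_iff)
  moreover have "A (?z \<circ> \<pi>) = A ?z" using sym z \<pi>n by (simp add: symmetric_in_def)
  ultimately show "fix_tail n a A k (x \<circ> \<pi>) = fix_tail n a A k x"
    using x tuples_replicate_comp[OF x \<pi>] by (simp add: fix_tail_def)
qed

text \<open>
  The differential has \<open>a\<close> in the first \<open>n - k\<close> variables, \<open>fix_tail\<close> in the last ones; a rotation of the
  variables relates them.
\<close>
lemma diag_fix_tail:
  assumes k: "k \<le> n" and x: "x \<in> vecs E"
  shows "diag k E (fix_tail n a A k) x = A (\<lambda>i\<in>{..<n}. if i < n - k then a else x)"
proof -
  let ?z = "\<lambda>i\<in>{..<n}. if i < k then x else a"
  define \<pi> where "\<pi> i = (if i < n then if i < n - k then i + k else i - (n - k) else i)" for i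
  have "bij_betw \<pi> {..<n} {..<n}"
    by (rule bij_betw_byWitness[where f'="\<lambda>i. if i < k then i + (n - k) else i - k"])
       (use k in \<open>auto simp: \<pi>_def\<close>)
  then have \<pi>: "\<pi> permutes {..<n}" by (rule bij_imp_permutes) (simp add: \<pi>_def)
  have z: "?z \<in> tuples (replicate n E)" using x a by (intro tuples_replicateI) auto
  have "(\<lambda>i\<in>{..<k}. x) \<in> tuples (replicate k E)" using x by (intro tuples_replicateI) auto
  then have "diag k E (fix_tail n a A k) x = A (\<lambda>i\<in>{..<n}. if i < k then (\<lambda>i\<in>{..<k}. x) i else a)"
    using x by (simp add: diag_def fix_tail_def)
  also have "(\<lambda>i\<in>{..<n}. if i < k then (\<lambda>i\<in>{..<k}. x) i else a) = ?z"
    by (auto simp: fun_eq_iff)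
  also have "A ?z = A (?z \<circ> \<pi>)" using sym z \<pi> by (simp add: symmetric_in_def)
  also have "?z \<circ> \<pi> = (\<lambda>i\<in>{..<n}. if i < n - k then a else x)"
    using k by (auto simp: fun_eq_iff \<pi>_def)
  finally show ?thesis .
qed

lemma
  assumes k: "k \<le> n"
  shows differential_in_poly_mCoh: "differential k n E F a (diag n E A) \<in> poly_mCoh p k E F"
    and poly_mCoh_norm_differential:
      "poly_mCoh_norm p k E F (\<lambda>x. scl F (1 / fact k) (differential k n E F a (diag n E A) x))
        \<le> 2 ^ n * poly_mCoh_norm p n E F (diag n E A) * nrm E a ^ (n - k)"
proof -
  note Es = normed_spaces_replicate[OF E F, of k]
  let ?B = "fix_tail n a A k"
  have B: "?B \<in> mCoh p (replicate k E) F" using fix_tail_mCoh[OF k] by blast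
  have symB: "symmetric_in k (replicate k E) (\<lambda>x. scl F c (?B x))" for c
    by (rule symmetric_in_scl[OF E F symmetric_fix_tail[OF k]])
  note BM = mCoh_scl[OF p Es F nf B]
  have mem: "A x \<in> vecs F" for x by (rule mCoh_in_vecs[OF p normed_spaces_replicate[OF E F] F nf A])
  have d: "differential k n E F a (diag n E A) = diag k E (\<lambda>x. scl F (fact k * of_nat (n choose k)) (?B x))"
  proof
    fix x
    show "differential k n E F a (diag n E A) x = diag k E (\<lambda>x. scl F (fact k * of_nat (n choose k)) (?B x)) x"
      unfolding differential_def polar_diag_mCoh[OF p E F nf A sym]
      by (simp add: diag_scl[OF E F] diag_fix_tail[OF k]) (simp add: diag_def scl_zero_right[OF F])
  qed
  show "differential k n E F a (diag n E A) \<in> poly_mCoh p k E F"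
    unfolding d by (rule diag_in_poly_mCoh[OF p E F nf BM symB])
  have "(\<lambda>x. scl F (1 / fact k) (differential k n E F a (diag n E A) x)) =
      diag k E (\<lambda>x. scl F (of_nat (n choose k)) (?B x))"
    unfolding d diag_scl[OF E F, symmetric]
    by (simp add: scl_scl[OF F mCoh_in_vecs[OF p Es F nf B]])
  then have "poly_mCoh_norm p k E F (\<lambda>x. scl F (1 / fact k) (differential k n E F a (diag n E A) x))
      = of_nat (n choose k) * mCoh_norm p (replicate k E) F ?B"
    using poly_mCoh_norm_diag[OF p E F nf BM symB] by (simp add: mCoh_norm_scl[OF p Es F nf B])
  also have "\<dots> \<le> 2 ^ n * (mCoh_norm p (replicate n E) F A * nrm E a ^ (n - k))"
  proof (rule mult_mono)
    show "of_nat (n choose k) \<le> (2 :: real) ^ n"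
      using binomial_le_pow2[of n k] by (metis of_nat_le_iff of_nat_numeral of_nat_power)
  qed (use fix_tail_mCoh[OF k] mCoh_norm_nonneg[OF p Es F B] in auto)
  also have "\<dots> = 2 ^ n * poly_mCoh_norm p n E F (diag n E A) * nrm E a ^ (n - k)"
    by (simp add: poly_mCoh_norm_diag[OF p E F nf A sym])
  finally show "poly_mCoh_norm p k E F (\<lambda>x. scl F (1 / fact k) (differential k n E F a (diag n E A) x))
      \<le> 2 ^ n * poly_mCoh_norm p n E F (diag n E A) * nrm E a ^ (n - k)" .
qed

end

end

lemma global_holomorphy_type_poly_mCoh:
  assumes p: "1 < p"
    and nf: "\<And>F :: ('k::real_normed_field, 'v::ab_group_add) nspace. normed_space F \<Longrightarrow> norming F"
  shows "global_holomorphy_type (poly_mCoh p :: ('k, 'u::ab_group_add, 'v) poly_class) (poly_mCoh_norm p) 2"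
  unfolding global_holomorphy_type_def
proof (intro conjI allI impI ballI; (elim conjE)?)
  fix E :: "('k, 'u) nspace" and F :: "('k, 'v) nspace"
  assume "banach_space E" "banach_space F"
  then have E: "normed_space E" and F: "normed_space F"
    and compl: "Metric_space.mcomplete (vecs F) (ndist F)" by (auto simp: banach_space_def)
  note nfF = nf[OF F]
  show "poly_mCoh p n E F \<subseteq> cont_polynomials n E F" for n by (auto simp: poly_mCoh_def)
  show "banach_space (fun_space F (poly_mCoh p n E F) (poly_mCoh_norm p n E F))" for n
    by (rule banach_space_poly_mCoh[OF p E F nfF compl])
  show "poly_mCoh p 0 E F = (\<lambda>y x. if x \<in> vecs E then y else 0) ` vecs F"
    by (rule poly_mCoh_degree_0[OF p E F nfF])
  show "poly_mCoh_norm p 0 E F (\<lambda>x. if x \<in> vecs E then y else 0) = nrm F y" if "y \<in> vecs F" for y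
    by (rule poly_mCoh_norm_constant[OF p E F nfF that])
  fix n k a P assume k: "k \<le> n" and a: "a \<in> vecs E" and "P \<in> poly_mCoh p n E F"
  then obtain A where A: "A \<in> mCoh p (replicate n E) F" "symmetric_in n (replicate n E) A"
    and P: "P = diag n E A" by (metis poly_mCoh_cases[OF p E F nfF])
  show "differential k n E F a P \<in> poly_mCoh p k E F"
    unfolding P by (rule differential_in_poly_mCoh[OF p E F nfF A a k])
  show "poly_mCoh_norm p k E F (\<lambda>x. scl F (1 / fact k) (differential k n E F a P x))
      \<le> 2 ^ n * poly_mCoh_norm p n E F P * nrm E a ^ (n - k)"
    unfolding P by (rule poly_mCoh_norm_differential[OF p E F nfF A a k])
qed simp

theorem theorem7p4:
  fixes p :: real
  assumes "1 < p"
  shows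
    "(property_B (mCoh p :: (real, 'a::ab_group_add \<times> real, 'b::ab_group_add) mult_class)
        (mCoh_norm p) 1 \<and>
      global_holomorphy_type (poly_mCoh p :: (real, 'a, 'b) poly_class) (poly_mCoh_norm p) 2) \<and>
     (property_B (mCoh p :: (complex, 'a \<times> complex, 'b) mult_class)
        (mCoh_norm p) 1 \<and>
      global_holomorphy_type (poly_mCoh p :: (complex, 'a, 'b) poly_class) (poly_mCoh_norm p) 2)"
  using assms
  by (intro conjI property_B_mCoh global_holomorphy_type_poly_mCoh norming_real norming_complex)

end
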